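(* Fix an integer $p\ge2$. If $(\beta_1,\beta_2)$ is off the phase transition curve, then $$\lim_{n\to\infty}\frac{\partial^2}{\partial\beta_2^2}\psi_n(\beta_1,\beta_2)=\frac{\partial^2}{\partial\beta_2^2}\lim_{n\to\infty}\psi_n(\beta_1,\beta_2)=\frac{p^2(x^* )^{2p-2}}{|\ell''(x^* )|}.$$ If $(\beta_1,\beta_2)$ is on the phase transition curve but is not the critical point, then $$\lim_{n\to\infty}\frac1n\frac{\partial^2}{\partial\beta_2^2}\psi_n(\beta_1,\beta_2)=\frac{((x_1^* )^p-(x_2^* )^p)^2\sqrt{x_1^*(1-x_1^* )|\ell''(x_1^* )|}\sqrt{x_2^*(1-x_2^* )|\ell''(x_2^* )|}}{\left(\sqrt{x_1^*(1-x_1^* )|\ell''(x_1^* )|}+\sqrt{x_2^*(1-x_2^* )|\ell''(x_2^* )|}\right)^2}.$$ At the critical point $(\beta_1,\beta_2)=(\beta_1^c,\beta_2^c)$, $$\lim_{n\to\infty}\frac{1}{n^{1/2}}\frac{\partial^2}{\partial\beta_2^2}\psi_n(\beta_1,\beta_2)=\frac{2\sqrt6\,\Gamma(\frac34)}{\Gamma(\frac14)}\frac{(p-1)^{2p-1}}{p^{2p-\frac32}}.$$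
   Context: For $n\ge 1$, a directed graph (loops allowed, no duplicate edges) on $n$ nodes is identified with its adjacency matrix $X=(X_{ij})_{1\le i,j\le n}\in\{0,1\}^{n\times n}$. Set $$e(X)=n^{-2}\sum_{1\le i,j\le n}X_{ij},\qquad s(X)=n^{-p-1}\sum_{1\le i,j_1,\dots,j_p\le n}X_{ij_1}X_{ij_2}\cdots X_{ij_p}.$$ For real $\beta_1,\beta_2$, $Z_n(\beta_1,\beta_2)=\sum_{X\in\{0,1\}^{n\times n}}\exp[n^2(\beta_1e(X)+\beta_2s(X))]$ and $\psi_n(\beta_1,\beta_2)=n^{-2}\log Z_n(\beta_1,\beta_2)$. The function $\ell:[0,1]\to\mathbb{R}$ is $\ell(x)=\beta_1x+\beta_2x^p-x\log x-(1-x)\log(1-x)$ (with $0\log0=0$); $\ell''$ is its second derivative in $x$. Phase transition curve: by a known result of Radin and Yin there is a curve in the $(\beta_1,\beta_2)$-plane, of the form $\beta_2=q(\beta_1)$ for $\beta_1\le\beta_1^c$, with endpoint (the critical point) $$(\beta_1^c,\beta_2^c)=\left(\log(p-1)-\frac{p}{p-1},\ \frac{p^{p-1}}{(p-1)^p}\right),$$ such that off the curve and at the endpoint $\ell$ has a unique global maximizer $x^*\in(0,1)$, while on the curve away from the endpoint $\ell$ has exactly two global maximizers $x_1^*,x_2^*$, with $0<x_1^*<\frac{p-1}{p}<x_2^*<1$. The critical point belongs to the curve, so "off the curve" excludes it. *)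

theory Defs
  imports "HOL-Analysis.Analysis"
begin

definition digraphs :: "nat \<Rightarrow> (nat \<Rightarrow> nat \<Rightarrow> real) set" where
  "digraphs n = {1..n} \<rightarrow>\<^sub>E ({1..n} \<rightarrow>\<^sub>E {0, 1})"

definition edge_density :: "nat \<Rightarrow> (nat \<Rightarrow> nat \<Rightarrow> real) \<Rightarrow> real" where
  "edge_density n X = (\<Sum>i\<in>{1..n}. \<Sum>j\<in>{1..n}. X i j) / real n ^ 2"

definition star_density :: "nat \<Rightarrow> nat \<Rightarrow> (nat \<Rightarrow> nat \<Rightarrow> real) \<Rightarrow> real" where
  "star_density p n X =
     (\<Sum>i\<in>{1..n}. \<Sum>j\<in>{1..p} \<rightarrow>\<^sub>E {1..n}. \<Prod>k\<in>{1..p}. X i (j k)) / real n ^ (p + 1)"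

definition partition_function :: "nat \<Rightarrow> nat \<Rightarrow> real \<Rightarrow> real \<Rightarrow> real" where
  "partition_function p n \<beta>\<^sub>1 \<beta>\<^sub>2 =
     (\<Sum>X\<in>digraphs n. exp (real n ^ 2 * (\<beta>\<^sub>1 * edge_density n X + \<beta>\<^sub>2 * star_density p n X)))"

definition psi :: "nat \<Rightarrow> nat \<Rightarrow> real \<Rightarrow> real \<Rightarrow> real" where
  "psi p n \<beta>\<^sub>1 \<beta>\<^sub>2 = ln (partition_function p n \<beta>\<^sub>1 \<beta>\<^sub>2) / real n ^ 2"

definition psi_lim :: "nat \<Rightarrow> real \<Rightarrow> real \<Rightarrow> real" where
  "psi_lim p \<beta>\<^sub>1 \<beta>\<^sub>2 = lim (\<lambda>n. psi p n \<beta>\<^sub>1 \<beta>\<^sub>2)"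

definition twice_differentiable_at :: "(real \<Rightarrow> real) \<Rightarrow> real \<Rightarrow> bool" where
  "twice_differentiable_at f x \<longleftrightarrow>
     (\<forall>\<^sub>F y in nhds x. f differentiable at y) \<and> deriv f differentiable at x"

text \<open>The convention \<open>0 log 0 = 0\<close> is automatic, since \<open>ln 0 = 0\<close>.\<close>

definition ell :: "nat \<Rightarrow> real \<Rightarrow> real \<Rightarrow> real \<Rightarrow> real" where
  "ell p \<beta>\<^sub>1 \<beta>\<^sub>2 x = \<beta>\<^sub>1 * x + \<beta>\<^sub>2 * x ^ p - x * ln x - (1 - x) * ln (1 - x)"

definition ell'' :: "nat \<Rightarrow> real \<Rightarrow> real \<Rightarrow> real \<Rightarrow> real" where
  "ell'' p \<beta>\<^sub>1 \<beta>\<^sub>2 x = (deriv ^^ 2) (ell p \<beta>\<^sub>1 \<beta>\<^sub>2) x"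

definition maximizers :: "nat \<Rightarrow> real \<Rightarrow> real \<Rightarrow> real set" where
  "maximizers p \<beta>\<^sub>1 \<beta>\<^sub>2 = {x. is_arg_max (ell p \<beta>\<^sub>1 \<beta>\<^sub>2) (\<lambda>x. x \<in> {0..1}) x}"

definition crit1 :: "nat \<Rightarrow> real" where
  "crit1 p = ln (real p - 1) - real p / (real p - 1)"

definition crit2 :: "nat \<Rightarrow> real" where
  "crit2 p = real p ^ (p - 1) / (real p - 1) ^ p"

definition graph_of :: "nat \<Rightarrow> (real \<Rightarrow> real) \<Rightarrow> (real \<times> real) set" where
  "graph_of p q = {(\<beta>\<^sub>1, \<beta>\<^sub>2). \<beta>\<^sub>1 \<le> crit1 p \<and> \<beta>\<^sub>2 = q \<beta>\<^sub>1}"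

text \<open>
  These conditions determine \<open>q\<close> on \<open>{..crit1 p}\<close> uniquely; its values elsewhere are irrelevant.
  That such a \<open>q\<close> exists (Radin and Yin) is proved below as \<open>phase_transition_curve_exists\<close>.
\<close>

definition phase_transition_curve :: "nat \<Rightarrow> (real \<Rightarrow> real) \<Rightarrow> bool" where
  "phase_transition_curve p q \<longleftrightarrow>
     q (crit1 p) = crit2 p \<and>
     (\<forall>\<beta>\<^sub>1 \<beta>\<^sub>2. (\<beta>\<^sub>1, \<beta>\<^sub>2) \<notin> graph_of p q \<or> (\<beta>\<^sub>1, \<beta>\<^sub>2) = (crit1 p, crit2 p) \<longrightarrow>
        (\<exists>x. 0 < x \<and> x < 1 \<and> maximizers p \<beta>\<^sub>1 \<beta>\<^sub>2 = {x})) \<and>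
     (\<forall>\<beta>\<^sub>1 \<beta>\<^sub>2. (\<beta>\<^sub>1, \<beta>\<^sub>2) \<in> graph_of p q \<and> (\<beta>\<^sub>1, \<beta>\<^sub>2) \<noteq> (crit1 p, crit2 p) \<longrightarrow>
        (\<exists>x\<^sub>1 x\<^sub>2. 0 < x\<^sub>1 \<and> x\<^sub>1 < (real p - 1) / real p \<and> (real p - 1) / real p < x\<^sub>2 \<and> x\<^sub>2 < 1 \<and>
           maximizers p \<beta>\<^sub>1 \<beta>\<^sub>2 = {x\<^sub>1, x\<^sub>2}))"

lemma maximizers_iff:
  "x \<in> maximizers p b1 b2 \<longleftrightarrow> 0 \<le> x \<and> x \<le> 1 \<and> (\<forall>y. 0 \<le> y \<and> y \<le> 1 \<longrightarrow> ell p b1 b2 y \<le> ell p b1 b2 x)"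
  by (auto simp: maximizers_def is_arg_max_def not_less)

lemma continuous_on_ell: "continuous_on {0..1} (ell p b1 b2)"
proof -
  have *: "((\<lambda>x::real. x * ln x) \<longlongrightarrow> 0) (at 0 within {0..1})"
  proof (rule tendsto_sandwich[of "\<lambda>x. - 2 * sqrt x" _ _ "\<lambda>_. 0"])
    show "\<forall>\<^sub>F x::real in at 0 within {0..1}. - 2 * sqrt x \<le> x * ln x"
      unfolding eventually_at_filter
    proof (intro always_eventually allI impI)
      fix x :: real assume x: "x \<noteq> 0" "x \<in> {0..1}"
      then have x0: "x > 0" by auto
      have "ln (1 / sqrt x) \<le> 1 / sqrt x"
        using ln_le_minus_one[of "1 / sqrt x"] x0 by auto
      then have "- ln x \<le> 2 / sqrt x"
        using x0 by (simp add: ln_div ln_sqrt)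
      then have "x * (- ln x) \<le> x * (2 / sqrt x)" using x0 by (intro mult_left_mono) auto
      also have "\<dots> = 2 * sqrt x" using x0 by (simp add: field_simps)
      finally show "- 2 * sqrt x \<le> x * ln x" by simp
    qed
    show "\<forall>\<^sub>F x::real in at 0 within {0..1}. x * ln x \<le> 0"
      unfolding eventually_at_filter
      by (intro always_eventually allI impI) (auto intro!: mult_nonneg_nonpos)
    show "((\<lambda>x::real. - 2 * sqrt x) \<longlongrightarrow> 0) (at 0 within {0..1})"
      by (auto intro!: tendsto_eq_intros)
  qed auto
  have c: "continuous_on {0..1} (\<lambda>x::real. x * ln x)"
    unfolding continuous_on_def
  proof
    fix x :: real assume x: "x \<in> {0..1}"
    show "((\<lambda>x. x * ln x) \<longlongrightarrow> x * ln x) (at x within {0..1})"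
      using * x by (cases "x = 0") (auto intro!: tendsto_eq_intros)
  qed
  have "continuous_on {0..1} ((\<lambda>x::real. x * ln x) \<circ> (\<lambda>x. 1 - x))"
    by (intro continuous_on_compose continuous_on_subset[OF c] continuous_intros) auto
  with c show ?thesis
    unfolding ell_def o_def
    by (intro continuous_on_diff continuous_on_add) (assumption | intro continuous_intros)+
qed

lemma maximizers_nonempty: "\<exists>x. x \<in> maximizers p b1 b2"
  using continuous_attains_sup[OF _ _ continuous_on_ell[of p b1 b2]]
  by (auto simp: maximizers_iff)

context
  fixes p :: nat and b1 b2 :: real
  assumes p: "p \<ge> 2"
begin

lemma zero_not_maximizer: "0 \<notin> maximizers p b1 b2"
proof
  assume *: "0 \<in> maximizers p b1 b2"
  define y where "y = exp (- \<bar>b1\<bar> - \<bar>b2\<bar> - 1)"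
  have y: "0 < y" "y < 1" by (auto simp: y_def)
  have "\<bar>b2\<bar> * y ^ p \<le> \<bar>b2\<bar> * y ^ 1"
    using y p by (intro mult_left_mono power_decreasing) auto
  then have 1: "b2 * y ^ p \<ge> - \<bar>b2\<bar> * y"
    using abs_ge_minus_self[of "b2 * y ^ p"] y by (simp add: abs_mult)
  have 2: "b1 * y \<ge> - \<bar>b1\<bar> * y" using y by (intro mult_right_mono) auto
  have 3: "(1 - y) * ln (1 - y) \<le> 0" using y by (intro mult_nonneg_nonpos) auto
  have 4: "y * ln y = - \<bar>b1\<bar> * y - \<bar>b2\<bar> * y - y" by (simp add: y_def algebra_simps)
  have "ell p b1 b2 y \<ge> y" using 1 2 3 4 unfolding ell_def by linarith
  moreover have "ell p b1 b2 0 = 0" using p by (simp add: ell_def)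
  moreover have "ell p b1 b2 y \<le> ell p b1 b2 0" using * y unfolding maximizers_iff by auto
  ultimately show False using y by simp
qed

lemma one_not_maximizer: "1 \<notin> maximizers p b1 b2"
proof
  assume *: "1 \<in> maximizers p b1 b2"
  define t where "t = exp (- \<bar>b1\<bar> - \<bar>b2\<bar> * p - 1)"
  have t: "0 < t" "t < 1"
    using mult_nonneg_nonneg[of "\<bar>b2\<bar>" "real p"] unfolding t_def by (auto simp del: mult_nonneg_nonneg)
  have "1 + real p * (- t) \<le> (1 + - t) ^ p" using t by (intro Bernoulli_inequality) auto
  moreover have "(1 - t) ^ p \<le> 1" using t by (intro power_le_one) auto
  ultimately have "\<bar>(1 - t) ^ p - 1\<bar> \<le> p * t" by auto
  then have "\<bar>b2\<bar> * \<bar>(1 - t) ^ p - 1\<bar> \<le> \<bar>b2\<bar> * (p * t)" by (intro mult_left_mono) auto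
  then have 1: "b2 * ((1 - t) ^ p - 1) \<ge> - \<bar>b2\<bar> * p * t"
    using abs_ge_minus_self[of "b2 * ((1 - t) ^ p - 1)"] by (simp add: abs_mult)
  have 2: "- b1 * t \<ge> - \<bar>b1\<bar> * t" using t by (intro mult_right_mono) auto
  have 3: "(1 - t) * ln (1 - t) \<le> 0" using t by (intro mult_nonneg_nonpos) auto
  have 4: "t * ln t = - \<bar>b1\<bar> * t - \<bar>b2\<bar> * p * t - t" by (simp add: t_def algebra_simps)
  have "ell p b1 b2 (1 - t) - ell p b1 b2 1 =
      - b1 * t + b2 * ((1 - t) ^ p - 1) - (1 - t) * ln (1 - t) - t * ln t"
    by (simp add: ell_def algebra_simps)
  then have "ell p b1 b2 (1 - t) - ell p b1 b2 1 \<ge> t" using 1 2 3 4 by linarith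
  moreover have "ell p b1 b2 (1 - t) \<le> ell p b1 b2 1" using * t unfolding maximizers_iff by auto
  ultimately show False using t by simp
qed

lemma maximizers_interior:
  assumes "x \<in> maximizers p b1 b2"
  shows "0 < x" "x < 1"
  using assms zero_not_maximizer one_not_maximizer
  by (metis maximizers_iff order_le_less)+

definition ell_d1 :: "real \<Rightarrow> real" where
  "ell_d1 x = b1 + b2 * (real p * x ^ (p - 1)) - ln x + ln (1 - x)"

definition ell_d2 :: "real \<Rightarrow> real" where
  "ell_d2 x = b2 * (real p * (real p - 1) * x ^ (p - 2)) - 1 / x - 1 / (1 - x)"

definition star_weight :: "real \<Rightarrow> real" where "star_weight x = x ^ (p - 1) * (1 - x)"

lemma ell_deriv: "0 < x \<Longrightarrow> x < 1 \<Longrightarrow> (ell p b1 b2 has_real_derivative ell_d1 x) (at x)"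
  unfolding ell_def ell_d1_def
  by (auto intro!: derivative_eq_intros simp: divide_simps)

lemma ell_d1_deriv:
  assumes x: "0 < x" "x < 1"
  shows "(ell_d1 has_real_derivative ell_d2 x) (at x)"
proof -
  obtain k where k: "p = Suc (Suc k)" using p by (cases p; cases "p - 1") auto
  have ln1: "((\<lambda>x. ln (1 - x)) has_real_derivative - (1 / (1 - x))) (at x)"
    using x by (auto intro!: derivative_eq_intros)
  have "((\<lambda>x. b1 + b2 * (real p * x ^ Suc k) - ln x + ln (1 - x)) has_real_derivative
      0 + b2 * (real p * ((1 + real k) * (1 * x ^ k))) - 1 / x + - (1 / (1 - x))) (at x)"
    by (intro DERIV_add DERIV_diff DERIV_cmult DERIV_power_Suc DERIV_ident DERIV_const
        DERIV_ln_divide ln1 x)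
  moreover have "0 + b2 * (real p * ((1 + real k) * (1 * x ^ k))) - 1 / x + - (1 / (1 - x)) = ell_d2 x"
    unfolding ell_d2_def by (simp add: k)
  moreover have "ell_d1 = (\<lambda>x. b1 + b2 * (real p * x ^ Suc k) - ln x + ln (1 - x))"
    unfolding ell_d1_def[abs_def] by (simp add: k)
  ultimately show ?thesis by simp
qed

lemma ell_d2_weight: "0 < x \<Longrightarrow> x < 1 \<Longrightarrow> x * (1 - x) * ell_d2 x = b2 * (real p * (real p - 1)) * star_weight x - 1"
proof -
  assume x: "0 < x" "x < 1"
  obtain k where k: "p = Suc (Suc k)" using p by (cases p; cases "p - 1") auto
  then show ?thesis using x unfolding ell_d2_def star_weight_def by (simp add: field_simps)
qed

abbreviation xc :: real where "xc \<equiv> (real p - 1) / real p"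

lemma xc: "0 < xc" "xc < 1" "1 - xc = 1 / p"
  using p by (auto simp: field_simps)

lemma star_weight_deriv:
  "(star_weight has_real_derivative x ^ (p - 2) * (real p - 1 - real p * x)) (at x)" for x :: real
proof -
  obtain k where k: "p = Suc (Suc k)" using p by (cases p; cases "p - 1") auto
  have "((\<lambda>x. x ^ Suc k * (1 - x)) has_real_derivative
      (1 + real k) * (1 * x ^ k) * (1 - x) + (0 - 1) * x ^ Suc k) (at x)"
    by (intro DERIV_mult DERIV_power_Suc DERIV_diff DERIV_ident DERIV_const)
  moreover have "(1 + real k) * (1 * x ^ k) * (1 - x) + (0 - 1) * x ^ Suc k =
      x ^ (p - 2) * (real p - 1 - real p * x)"
    by (simp add: k) (simp add: algebra_simps)
  ultimately show ?thesis unfolding star_weight_def[abs_def] by (simp add: k)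
qed

lemma star_weight_continuous: "continuous_on S star_weight"
  unfolding star_weight_def[abs_def] by (intro continuous_intros)

lemma star_weight_incr:
  assumes "0 < x" "x < y" "y \<le> xc"
  shows "star_weight x < star_weight y"
proof (rule DERIV_pos_imp_increasing_open[OF assms(2) _ star_weight_continuous])
  fix z assume z: "x < z" "z < y"
  have "z < xc" using z assms(3) by linarith
  then have "real p * z < real p - 1" using p by (simp add: field_simps)
  then have "0 < z ^ (p - 2) * (real p - 1 - real p * z)"
    using z(1) assms(1) by (intro mult_pos_pos zero_less_power) linarith+
  with star_weight_deriv show "\<exists>d. (star_weight has_real_derivative d) (at z) \<and> 0 < d"
    by blast
qed

lemma star_weight_decr:
  assumes "xc \<le> x" "x < y"
  shows "star_weight y < star_weight x"
proof (rule DERIV_neg_imp_decreasing_open[OF assms(2) _ star_weight_continuous])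
  fix z assume z: "x < z" "z < y"
  have zc: "xc < z" using z assms(1) by linarith
  then have "real p - 1 < real p * z" using p by (simp add: field_simps)
  moreover have "0 < z" using xc(1) zc by linarith
  ultimately have "z ^ (p - 2) * (real p - 1 - real p * z) < 0"
    by (intro mult_pos_neg zero_less_power) linarith+
  with star_weight_deriv show "\<exists>d. (star_weight has_real_derivative d) (at z) \<and> d < 0"
    by blast
qed

lemma maximizers_ell_d1: assumes "x \<in> maximizers p b1 b2" shows "ell_d1 x = 0"
proof (rule DERIV_local_max[OF ell_deriv])
  show x: "0 < x" "x < 1" using maximizers_interior assms by auto
  show "0 < min x (1 - x)" using x by auto
  show "\<forall>y. \<bar>x - y\<bar> < min x (1 - x) \<longrightarrow> ell p b1 b2 y \<le> ell p b1 b2 x"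
  proof (intro allI impI)
    fix y assume "\<bar>x - y\<bar> < min x (1 - x)"
    then have "0 \<le> y" "y \<le> 1" by linarith+
    then show "ell p b1 b2 y \<le> ell p b1 b2 x" using assms unfolding maximizers_iff by blast
  qed
qed

text \<open>Between two maximizers there are, by Rolle's theorem, two zeros of the second derivative.\<close>

lemma maximizers_rolle:
  assumes "x \<in> maximizers p b1 b2" "y \<in> maximizers p b1 b2" "x < y"
  obtains u v where "x < u" "u < v" "v < y" "ell_d2 u = 0" "ell_d2 v = 0"
    "b2 * (real p * (real p - 1)) * star_weight u = 1" "b2 * (real p * (real p - 1)) * star_weight v = 1"
proof -
  note x = maximizers_interior[OF assms(1)]
  note y = maximizers_interior[OF assms(2)]
  have eq: "ell p b1 b2 x = ell p b1 b2 y"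
    using assms unfolding maximizers_iff by (meson order_antisym)
  have "\<exists>z>x. z < y \<and> ell p b1 b2 y - ell p b1 b2 x = (y - x) * ell_d1 z"
    using assms x y by (intro MVT2 ell_deriv) auto
  then obtain z where z: "x < z" "z < y" "ell_d1 z = 0" using eq by auto
  have "\<exists>u>x. u < z \<and> ell_d1 z - ell_d1 x = (z - x) * ell_d2 u"
    using z x y by (intro MVT2 ell_d1_deriv) auto
  then obtain u where u: "x < u" "u < z" "ell_d2 u = 0" using z maximizers_ell_d1[OF assms(1)] by auto
  have "\<exists>v>z. v < y \<and> ell_d1 y - ell_d1 z = (y - z) * ell_d2 v"
    using z x y by (intro MVT2 ell_d1_deriv) auto
  then obtain v where v: "z < v" "v < y" "ell_d2 v = 0" using z maximizers_ell_d1[OF assms(2)] by auto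
  show thesis
    using that[of u v] u v ell_d2_weight[of u] ell_d2_weight[of v] x y by auto
qed

lemma maximizers_straddle:
  assumes "x \<in> maximizers p b1 b2" "y \<in> maximizers p b1 b2" "x < y"
  shows "x < xc" "xc < y" "b1 < crit1 p"
proof -
  note x = maximizers_interior[OF assms(1)]
  note y = maximizers_interior[OF assms(2)]
  obtain u v where uv: "x < u" "u < v" "v < y" "ell_d2 u = 0" "ell_d2 v = 0"
    and wu: "b2 * (real p * (real p - 1)) * star_weight u = 1" and wv: "b2 * (real p * (real p - 1)) * star_weight v = 1"
    using maximizers_rolle[OF assms] .
  have "b2 * (real p * (real p - 1)) \<noteq> 0" using wu by (metis mult_zero_left zero_neq_one)
  then have eq: "star_weight u = star_weight v" using wu wv by (metis mult_left_cancel)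
  have u: "u < xc" using star_weight_decr[of u v] eq uv by force
  have v: "xc < v" using star_weight_incr[of u v] eq uv x by force
  show "x < xc" "xc < y" using u v uv by auto
  have K: "b2 * (real p * (real p - 1)) > 0"
  proof -
    have "star_weight u > 0" using uv x y by (auto simp: star_weight_def)
    then show ?thesis using wu by (metis zero_less_mult_pos2 zero_less_one)
  qed
  have "ell_d1 u < ell_d1 x"
  proof (rule DERIV_neg_imp_decreasing_open[OF uv(1)])
    fix z assume z: "x < z" "z < u"
    then have zz: "0 < z" "z < 1" using x y uv by auto
    have "star_weight z < star_weight u" using z u x by (intro star_weight_incr) auto
    then have "z * (1 - z) * ell_d2 z < 0" using K wu ell_d2_weight[OF zz] by (smt (verit) mult_strict_left_mono)
    then have "ell_d2 z < 0" using zz by (simp add: mult_less_0_iff)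
    then show "\<exists>d. (ell_d1 has_real_derivative d) (at z) \<and> d < 0" using ell_d1_deriv zz by blast
  next
    show "continuous_on {x..u} ell_d1"
      using x y uv by (intro DERIV_atLeastAtMost_imp_continuous_on) (metis ell_d1_deriv less_le_trans le_less_trans less_trans)
  qed
  then have d1u: "ell_d1 u < 0" using maximizers_ell_d1[OF assms(1)] by simp
  define h where "h z = ln z - ln (1 - z) - 1 / ((real p - 1) * (1 - z))" for z :: real
  have uu: "0 < u" "u < 1" using uv x y by auto
  have "b2 * (real p * u ^ (p - 1)) = 1 / ((real p - 1) * (1 - u))"
  proof -
    have "b2 * (real p * u ^ (p - 1)) * ((real p - 1) * (1 - u)) = 1"
      using wu unfolding star_weight_def by (simp add: mult_ac)
    then show ?thesis using uu p by (subst eq_divide_eq) simp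
  qed
  then have "b1 < h u" using d1u unfolding ell_d1_def h_def by simp
  also have "h u < h xc"
  proof (rule DERIV_pos_imp_increasing_open[OF u])
    fix z assume z: "u < z" "z < xc"
    then have zz: "0 < z" "z < 1" using uu xc by auto
    have "(h has_real_derivative (1 / z + 1 / (1 - z) - 1 / ((real p - 1) * (1 - z)\<^sup>2))) (at z)"
    proof -
      have "((\<lambda>z. 1 / ((real p - 1) * (1 - z))) has_real_derivative
          (0 * ((real p - 1) * (1 - z)) - 1 * ((real p - 1) * (0 - 1))) /
          ((real p - 1) * (1 - z) * ((real p - 1) * (1 - z)))) (at z)"
        using zz p by (intro DERIV_divide DERIV_const DERIV_cmult DERIV_diff DERIV_ident) auto
      moreover have "(0 * ((real p - 1) * (1 - z)) - 1 * ((real p - 1) * (0 - 1))) /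
          ((real p - 1) * (1 - z) * ((real p - 1) * (1 - z))) = 1 / ((real p - 1) * (1 - z)\<^sup>2)"
        using zz p by (simp add: power2_eq_square)
      ultimately have inv: "((\<lambda>z. 1 / ((real p - 1) * (1 - z))) has_real_derivative
          1 / ((real p - 1) * (1 - z)\<^sup>2)) (at z)" by simp
      have ln1: "((\<lambda>z. ln (1 - z)) has_real_derivative - (1 / (1 - z))) (at z)"
        using zz by (auto intro!: derivative_eq_intros)
      have "(h has_real_derivative (1 / z - - (1 / (1 - z)) - 1 / ((real p - 1) * (1 - z)\<^sup>2))) (at z)"
        unfolding h_def[abs_def] by (intro DERIV_diff inv ln1 DERIV_ln_divide zz)
      then show ?thesis by simp
    qed
    moreover have "1 / z + 1 / (1 - z) - 1 / ((real p - 1) * (1 - z)\<^sup>2) =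
      (real p - 1 - p * z) / (z * (real p - 1) * (1 - z)\<^sup>2)"
      using zz p by (simp add: divide_simps power2_eq_square) (simp add: algebra_simps)
    moreover have "(real p - 1 - p * z) / (z * (real p - 1) * (1 - z)\<^sup>2) > 0"
    proof (intro divide_pos_pos mult_pos_pos)
      show "0 < real p - 1 - real p * z" using z(2) p by (simp add: field_simps)
    qed (use zz p in auto)
    ultimately show "\<exists>d. (h has_real_derivative d) (at z) \<and> d > 0" by metis
  next
    show "continuous_on {u..xc} h"
      unfolding h_def using uu xc p by (intro continuous_intros) auto
  qed
  also have "h xc = crit1 p"
    unfolding h_def xc(3) crit1_def using p by (simp add: ln_div field_simps)
  finally show "b1 < crit1 p" .
qed

end

lemma maximizers_le:
  assumes "p \<ge> 2" "x \<in> maximizers p b1 b" "x' \<in> maximizers p b1 b'" "b < b'"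
  shows "x \<le> x'"
proof (rule ccontr)
  assume "\<not> x \<le> x'"
  moreover have "x' > 0" using maximizers_interior assms by blast
  ultimately have *: "x' ^ p < x ^ p" using assms(1) by (intro power_strict_mono) auto
  have "ell p b1 b x' \<le> ell p b1 b x" "ell p b1 b' x \<le> ell p b1 b' x'"
    using assms by (auto simp: maximizers_iff)
  then have "(b' - b) * (x ^ p - x' ^ p) \<le> 0" by (simp add: ell_def algebra_simps)
  with * assms(4) show False by (simp add: mult_le_0_iff)
qed

lemma peak_not_maximizer:
  fixes p b1 b2
  defines "m \<equiv> (real p - 1) / real p"
  assumes p: "p \<ge> 2" and b1: "b1 < crit1 p"
  shows "m \<notin> maximizers p b1 b2"
proof
  assume *: "m \<in> maximizers p b1 b2"
  have x: "0 < m" "m < 1" and x1: "1 - m = 1 / p" using xc[OF p] by (auto simp: m_def)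
  have d1: "ell_d1 p b1 b2 m = 0" using maximizers_ell_d1[OF p *] .
  have "ln m - ln (1 - m) = ln (real p - 1)"
    unfolding x1 using p by (simp add: m_def ln_div)
  then have "b2 * (real p * m ^ (p - 1)) > real p / (real p - 1)"
    using d1 b1 unfolding ell_d1_def[OF p] crit1_def by simp
  then have "b2 * (real p * m ^ (p - 1)) * (real p - 1) > real p"
    using p by (simp add: field_simps)
  moreover have "b2 * (real p * (real p - 1)) * star_weight p m =
      b2 * (real p * m ^ (p - 1)) * (real p - 1) / real p"
    by (simp add: star_weight_def[OF p] x1)
  moreover have "b2 * (real p * m ^ (p - 1)) * (real p - 1) / real p > 1"
    using calculation(1) p by (simp only: less_divide_eq) simp
  ultimately have "b2 * (real p * (real p - 1)) * star_weight p m > 1" by linarith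
  then have "m * (1 - m) * ell_d2 p b2 m > 0" using ell_d2_weight[OF p x] by simp
  then have "ell_d2 p b2 m > 0" using x by (meson diff_gt_0_iff_gt mult_pos_pos zero_less_mult_pos)
  from DERIV_pos_inc_right[OF ell_d1_deriv[OF p x, of b1] this] obtain d where
    d: "d > 0" "\<And>h. 0 < h \<Longrightarrow> h < d \<Longrightarrow> 0 < ell_d1 p b1 b2 (m + h)"
    using d1 by auto
  define e where "e = min d (1 - m) / 2"
  have "2 * e \<le> d" "2 * e \<le> 1 - m" "0 < e" using d(1) x by (auto simp: e_def)
  then have e: "0 < e" "e < d" "m + e < 1" by linarith+
  have "\<exists>z>m. z < m + e \<and> ell p b1 b2 (m + e) - ell p b1 b2 m = (m + e - m) * ell_d1 p b1 b2 z"
    using e x by (intro MVT2 ell_deriv p) auto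
  then obtain z where z: "m < z" "z < m + e"
    "ell p b1 b2 (m + e) - ell p b1 b2 m = e * ell_d1 p b1 b2 z" by auto
  have "ell_d1 p b1 b2 z > 0" using d(2)[of "z - m"] z e by simp
  then have "ell p b1 b2 (m + e) > ell p b1 b2 m" using z(3) e by (smt (verit) mult_pos_pos)
  moreover have "ell p b1 b2 (m + e) \<le> ell p b1 b2 m"
    using * e x by (auto simp: maximizers_iff)
  ultimately show False by simp
qed

lemma continuous_on_Sup_ell:
  assumes S: "S \<subseteq> {0..1}" "compact S" "S \<noteq> {}"
  shows "continuous_on UNIV (\<lambda>b. Sup (ell p a b ` S))"
    and "\<exists>x\<in>S. ell p a b x = Sup (ell p a b ` S)"
    and "x \<in> S \<Longrightarrow> ell p a b x \<le> Sup (ell p a b ` S)"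
proof -
  have cont: "continuous_on S (ell p a b)" for b
    using continuous_on_ell S(1) by (rule continuous_on_subset)
  have att: "\<exists>x\<in>S. ell p a b x = Sup (ell p a b ` S)" for b
  proof -
    obtain x where x: "x \<in> S" "\<And>y. y \<in> S \<Longrightarrow> ell p a b y \<le> ell p a b x"
      using continuous_attains_sup[OF S(2,3) cont] by blast
    then have "Sup (ell p a b ` S) = ell p a b x"
      by (intro cSup_eq_maximum) auto
    with x show ?thesis by metis
  qed
  then show "\<exists>x\<in>S. ell p a b x = Sup (ell p a b ` S)" .
  have le: "ell p a b x \<le> Sup (ell p a b ` S)" if "x \<in> S" for x b
    using that compact_imp_bounded[OF compact_continuous_image[OF cont S(2)]]
    by (intro cSup_upper) (auto intro: bounded_imp_bdd_above)
  then show "x \<in> S \<Longrightarrow> ell p a b x \<le> Sup (ell p a b ` S)" .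
  have one: "Sup (ell p a b ` S) - Sup (ell p a b' ` S) \<le> \<bar>b - b'\<bar>" for b b'
  proof -
    obtain x where x: "x \<in> S" "ell p a b x = Sup (ell p a b ` S)" using att by blast
    have "0 \<le> x ^ p" "x ^ p \<le> 1" using x(1) S(1) by (auto intro!: power_le_one)
    then have "(b - b') * x ^ p \<le> \<bar>b - b'\<bar> * 1" by (intro mult_mono) auto
    moreover have "ell p a b x - ell p a b' x = (b - b') * x ^ p" by (simp add: ell_def algebra_simps)
    ultimately have "ell p a b x \<le> ell p a b' x + \<bar>b - b'\<bar>" by simp
    then show ?thesis using x(2) le[OF x(1), of b'] by simp
  qed
  have "1-lipschitz_on UNIV (\<lambda>b. Sup (ell p a b ` S))"
  proof (rule lipschitz_onI)
    fix b b' :: real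
    show "dist (Sup (ell p a b ` S)) (Sup (ell p a b' ` S)) \<le> 1 * dist b b'"
      using one[of b b'] one[of b' b] by (simp add: dist_real_def abs_le_iff)
  qed simp
  then show "continuous_on UNIV (\<lambda>b. Sup (ell p a b ` S))"
    by (rule lipschitz_on_continuous_on)
qed

text \<open>
  Below \<open>crit1 p\<close>, the intermediate value theorem produces a \<open>b2\<close> for which the maxima over the
  intervals to the left and to the right of \<open>(p - 1) / p\<close> agree.
\<close>

lemma two_maximizers_exist:
  assumes p: "p \<ge> 2" and b1: "b1 < crit1 p"
  shows "\<exists>b2 x y. x \<in> maximizers p b1 b2 \<and> y \<in> maximizers p b1 b2 \<and> x < y"
proof -
  define m where "m = (real p - 1) / real p"
  have x: "0 < m" "m < 1" and x1: "1 - m = 1 / p" using xc[OF p] by (auto simp: m_def)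
  define f where "f b = Sup (ell p b1 b ` {0..m})" for b
  define g where "g b = Sup (ell p b1 b ` {m..1})" for b
  have S: "{0..m} \<subseteq> {0..1}" "compact {0..m}" "{0..m} \<noteq> {}"
    "{m..1} \<subseteq> {0..1}" "compact {m..1}" "{m..1} \<noteq> {}" using x by auto
  note F = continuous_on_Sup_ell[OF S(1-3), where p = p and a = b1, folded f_def]
  note G = continuous_on_Sup_ell[OF S(4-6), where p = p and a = b1, folded g_def]
  have left: "xm \<in> maximizers p b1 b" if "xm \<in> {0..m}" "ell p b1 b xm = f b" "g b \<le> f b" for xm b
    unfolding maximizers_iff
  proof (intro conjI allI impI)
    fix y :: real assume "0 \<le> y \<and> y \<le> 1"
    then show "ell p b1 b y \<le> ell p b1 b xm"
      using F(3)[of y b] G(3)[of y b] that by (cases "y \<le> m") auto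
  qed (use that x in auto)
  have right: "xm \<in> maximizers p b1 b" if "xm \<in> {m..1}" "ell p b1 b xm = g b" "f b \<le> g b" for xm b
    unfolding maximizers_iff
  proof (intro conjI allI impI)
    fix y :: real assume "0 \<le> y \<and> y \<le> 1"
    then show "ell p b1 b y \<le> ell p b1 b xm"
      using F(3)[of y b] G(3)[of y b] that by (cases "y \<le> m") auto
  qed (use that x in auto)
  have 0: "g 0 \<le> f 0"
  proof (rule ccontr)
    assume "\<not> g 0 \<le> f 0"
    then obtain y where y: "y \<in> {m..1}" "y \<in> maximizers p b1 0" using G(2)[of 0] right[of _ 0] by force
    note y01 = maximizers_interior[OF p y(2)]
    have "b1 = ln y - ln (1 - y)"
      using maximizers_ell_d1[OF p y(2)] unfolding ell_d1_def[OF p] by simp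
    moreover have "ln m \<le> ln y" "ln (1 - y) \<le> ln (1 - m)" using y(1) y01 x by auto
    moreover have "ln m - ln (1 - m) = ln (real p - 1)"
      unfolding x1 using p by (simp add: m_def ln_div)
    moreover have "real p / (real p - 1) > 0" using p by (intro divide_pos_pos) auto
    ultimately show False using b1 unfolding crit1_def by linarith
  qed
  define K where "K = (\<bar>b1\<bar> + \<bar>b1\<bar> + 2) / (1 - m ^ p)"
  have xp: "m ^ p < 1" using power_strict_mono[of m 1 p] x p by simp
  have K: "K \<ge> 0" unfolding K_def using xp by auto
  have 1: "f K \<le> g K"
  proof (rule ccontr)
    assume "\<not> f K \<le> g K"
    then obtain y where y: "y \<in> {0..m}" "y \<in> maximizers p b1 K" using F(2)[of K] left[of _ K] by force
    note y01 = maximizers_interior[OF p y(2)]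
    have ent: "- (t * ln t) \<le> 1" if "0 < t" "t < 1" for t :: real
    proof -
      have "- ln t \<le> 1 / t - 1" using ln_le_minus_one[of "1 / t"] that by (simp add: ln_div)
      then have "t * (- ln t) \<le> t * (1 / t - 1)" using that by (intro mult_left_mono) auto
      moreover have "t * (1 / t - 1) = 1 - t" using that by (simp add: right_diff_distrib)
      ultimately show ?thesis using that by simp
    qed
    have "ell p b1 K 1 \<le> ell p b1 K y" using y(2) by (auto simp: maximizers_iff)
    then have "b1 + K \<le> b1 * y + K * y ^ p - y * ln y - (1 - y) * ln (1 - y)"
      by (simp add: ell_def)
    moreover have "K * y ^ p \<le> K * m ^ p" using K y y01 by (intro mult_left_mono power_mono) auto
    moreover have "b1 * y \<le> \<bar>b1\<bar> * 1" using y01 by (intro mult_mono) auto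
    ultimately have le: "K * (1 - m ^ p) \<le> \<bar>b1\<bar> + \<bar>b1\<bar> - y * ln y - (1 - y) * ln (1 - y)"
      by (simp add: algebra_simps)
    have eq: "K * (1 - m ^ p) = \<bar>b1\<bar> + \<bar>b1\<bar> + 2" using xp by (simp add: K_def)
    have "- (y * ln y) \<le> 1" "- ((1 - y) * ln (1 - y)) \<le> 1" using ent y01 by auto
    with le eq have "y * ln y = - 1" by linarith
    then have "- ln y = 1 / y" using y01 by (simp add: field_simps)
    moreover have "- ln y \<le> 1 / y - 1" using ln_le_minus_one[of "1 / y"] y01 by (simp add: ln_div)
    ultimately show False by simp
  qed
  have "\<exists>b\<ge>0. b \<le> K \<and> g b - f b = 0"
    using 0 1 K F(1) G(1)
    by (intro IVT') (auto intro!: continuous_on_diff intro: continuous_on_subset[OF _ subset_UNIV])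
  then obtain b where b: "g b = f b" by auto
  obtain y z where yz: "y \<in> {0..m}" "ell p b1 b y = f b" "z \<in> {m..1}" "ell p b1 b z = g b"
    using F(2) G(2) by blast
  have "y \<in> maximizers p b1 b" "z \<in> maximizers p b1 b" using left right yz b by auto
  moreover from this have "y \<noteq> m" using peak_not_maximizer[OF p b1] by (auto simp: m_def)
  ultimately show ?thesis using yz by (intro exI[of _ b] exI[of _ y] exI[of _ z]) auto
qed

theorem phase_transition_curve_exists:
  assumes p: "p \<ge> 2"
  shows "\<exists>q. phase_transition_curve p q"
proof -
  define two where "two b1 b2 \<longleftrightarrow> (\<exists>x y. x \<in> maximizers p b1 b2 \<and> y \<in> maximizers p b1 b2 \<and> x < y)" for b1 b2
  define q where "q b1 = (if b1 < crit1 p then SOME b2. two b1 b2 else crit2 p)" for b1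
  have q: "two b1 (q b1)" if "b1 < crit1 p" for b1
  proof -
    have "\<exists>b2. two b1 b2" using two_maximizers_exist[OF p that] unfolding two_def .
    then show ?thesis using that unfolding q_def by (simp add: someI_ex)
  qed
  have two_less: "b1 < crit1 p" if "two b1 b2" for b1 b2
    using that maximizers_straddle(3)[OF p] unfolding two_def by blast
  have nless: "\<not> b < b'" if "two b1 b" "two b1 b'" for b1 b b'
    using that maximizers_le[OF p] maximizers_straddle(1,2)[OF p] unfolding two_def
    by (meson less_trans not_less)
  have uniq: "b2 = q b1" if "two b1 b2" for b1 b2
    using nless[OF that q] nless[OF q that] two_less[OF that] by force
  have single: "\<exists>x. 0 < x \<and> x < 1 \<and> maximizers p b1 b2 = {x}" if "\<not> two b1 b2" for b1 b2
  proof -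
    obtain x where x: "x \<in> maximizers p b1 b2" using maximizers_nonempty by blast
    then have "maximizers p b1 b2 = {x}" using that unfolding two_def by (auto, metis linorder_neqE)
    then show ?thesis using maximizers_interior[OF p x] by blast
  qed
  have double: "\<exists>x y. 0 < x \<and> x < (real p - 1) / real p \<and> (real p - 1) / real p < y \<and> y < 1 \<and>
      maximizers p b1 b2 = {x, y}" if t: "two b1 b2" for b1 b2
  proof -
    obtain x y where xy: "x \<in> maximizers p b1 b2" "y \<in> maximizers p b1 b2" "x < y"
      using t unfolding two_def by blast
    note st = maximizers_straddle[OF p]
    have "z = x \<or> z = y" if z: "z \<in> maximizers p b1 b2" for z
      using st(1,2)[OF z xy(1)] st(1,2)[OF z xy(2)] st(1,2)[OF xy(1) z] st(1,2)[OF xy(2) z]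
        st(1,2)[OF xy] by linarith
    then have "maximizers p b1 b2 = {x, y}" using xy by blast
    then show ?thesis using st(1,2)[OF xy] maximizers_interior[OF p] xy by blast
  qed
  have "q (crit1 p) = crit2 p" by (simp add: q_def)
  moreover have "\<not> two b1 b2" if "(b1, b2) \<notin> graph_of p q \<or> (b1, b2) = (crit1 p, crit2 p)" for b1 b2
    using that two_less[of b1 b2] uniq[of b1 b2] by (auto simp: graph_of_def)
  moreover have "two b1 b2" if "(b1, b2) \<in> graph_of p q \<and> (b1, b2) \<noteq> (crit1 p, crit2 p)" for b1 b2
    using that q[of b1] \<open>q (crit1 p) = crit2 p\<close> by (cases "b1 = crit1 p") (auto simp: graph_of_def)
  ultimately have "phase_transition_curve p q"
    unfolding phase_transition_curve_def using single double by blast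
  then show ?thesis by blast
qed

end

theory Submission
  imports Defs "HOL-Real_Asymp.Real_Asymp" "HOL-Probability.Sinc_Integral"
begin

text \<open>
  Grouping the edges by their source node, the partition function is the \<open>n\<close>-th power of
  \<open>z = (\<Sum>k\<le>n. (n choose k) exp (n (\<beta>\<^sub>1 t + \<beta>\<^sub>2 t\<^sup>p)))\<close> with \<open>t = k / n\<close>, so the second derivative of
  \<open>psi\<close> in \<open>\<beta>\<^sub>2\<close> is \<open>n\<close> times the variance of \<open>t\<^sup>p\<close> under the corresponding Gibbs measure on
  \<open>{0, 1/n, \<dots>, 1}\<close>. By Stirling's formula the weight of \<open>t\<close> is, up to a constant,
  \<open>exp (n ell t) / sqrt (n t (1 - t))\<close>. Rescaling by \<open>n powr (1/m)\<close> around a maximizer at which \<open>ell\<close>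
  decreases like \<open>- c (t - x)\<^sup>m\<close> turns sums into Riemann sums of \<open>y\<^sup>j exp (- c y\<^sup>m)\<close>, and dominated
  convergence applies. Here \<open>m = 2\<close> except at the critical point, where \<open>m = 4\<close>. With two
  maximizers the measure converges to a two-point mass, whose variance does not vanish.
\<close>

section \<open>Stirling asymptotics for binomial coefficients\<close>

text \<open>With a single maximizer \<open>x\<close> the order-one terms of the variance cancel,
  since \<open>E (t ^ (2 * p))\<close> and \<open>(E (t ^ p)) ^ 2\<close> both tend to
  \<open>x ^ (2 * p)\<close>. The variance is therefore computed for \<open>t ^ p - x ^ p\<close>,
  which has a factor \<open>t - x\<close>. Its mean vanishes to leading order because
  \<open>y * exp (- c * y ^ m)\<close> is odd, and its second moment has order
  \<open>n powr (- 2 / m)\<close>. Multiplied by \<open>n\<close>, this gives the growth rates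
  \<open>1\<close> for \<open>m = 2\<close> and \<open>sqrt n\<close> for \<open>m = 4\<close>.

  The identity \<open>x * (1 - x) * ell''(x) = K * w(x) - 1\<close> with
  \<open>w(x) = x ^ (p - 1) * (1 - x)\<close> decides \<open>m\<close>. As \<open>w\<close> is
  unimodal with peak at \<open>(p - 1) / p\<close>, a maximizer with \<open>ell'' = 0\<close> must
  sit at the peak, which forces both parameters to be critical.

  The Stirling constant cancels in all ratios of moments. Near 0 and 1, where the Stirling bound
  degenerates, the weight is at most 1 and the gap of \<open>ell\<close> below its maximum suffices.
  Limit and derivative are never interchanged: the second derivative of the limit is computed on its
  own by an envelope argument, and the values agree.\<close>

definition stirling_ratio :: "nat \<Rightarrow> real" where
  "stirling_ratio n = fact n / (sqrt (real n) * (real n / exp 1) ^ n)"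

lemma stirling_ratio_pos: "n > 0 \<Longrightarrow> stirling_ratio n > 0"
  by (simp add: stirling_ratio_def)

lemma fact_stirling_ratio:
  "n > 0 \<Longrightarrow> fact n = stirling_ratio n * (sqrt (real n) * (real n / exp 1) ^ n)"
  by (simp add: stirling_ratio_def)

text \<open>The increments of \<open>ln (stirling_ratio n)\<close> are O(1/n^2), hence summable, and
  the telescoping sum converges. Passing to logarithms is also what makes the limit
  positive.\<close>

lemma stirling_ratio_tendsto: "\<exists>C>0. stirling_ratio \<longlonglongrightarrow> C"
proof -
  \<comment> \<open>The shift by \<open>Suc\<close> skips \<open>n = 0\<close>, where the factor
    \<open>sqrt 0\<close> makes the ratio 0.\<close>
  define d where "d n = ln (stirling_ratio (Suc n))" for n
  have step: "d (Suc n) - d n = 1 - (real n + 3/2) * ln (1 + 1 / (real n + 1))" for n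
  proof -
    have d: "d n = ln (fact (Suc n)) - ln (real (Suc n)) / 2 - real (Suc n) * (ln (real (Suc n)) - 1)" for n
      unfolding d_def stirling_ratio_def
      by (simp add: ln_div ln_mult ln_sqrt ln_realpow algebra_simps del: fact_Suc of_nat_Suc) (simp add: algebra_simps)
    have f: "ln (fact (Suc (Suc n))) = ln (real n + 2) + ln (fact (Suc n) :: real)"
      by (subst fact_Suc) (simp add: ln_mult del: fact_Suc add: of_nat_Suc add_ac)
    have l: "ln (1 + 1 / (real n + 1)) = ln (real n + 2) - ln (real n + 1)"
    proof -
      have "1 + 1 / (real n + 1) = (real n + 2) / (real n + 1)" by (simp add: divide_simps)
      then show ?thesis by (simp add: ln_divide_pos)
    qed
    have e: "real (Suc n) = real n + 1" "real (Suc (Suc n)) = real n + 2" by simp_all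
    have "(a + F - a / 2 - (N + 2) * (a - 1)) - (F - b / 2 - (N + 1) * (b - 1)) =
        1 - (N + 3/2) * (a - b)" for a b F N :: real
      by (simp add: field_simps)
    then show ?thesis unfolding d f l e .
  qed
  have O: "(\<lambda>n. 1 - (real n + 3/2) * ln (1 + 1 / (real n + 1))) \<in> O(\<lambda>n. inverse (real n ^ 2))"
    by real_asymp
  have "summable (\<lambda>n. norm (inverse (real n ^ 2)))"
    using inverse_power_summable[of 2, where 'a = real] by simp
  from summable_comparison_test_bigo[OF this O] have "summable (\<lambda>n. d (Suc n) - d n)"
    unfolding step .
  then have "convergent (\<lambda>n. \<Sum>k<n. d (Suc k) - d k)"
    by (simp add: summable_iff_convergent)
  then have "convergent (\<lambda>n. d n - d 0)"
    by (simp add: sum_lessThan_telescope)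
  then obtain L where "(\<lambda>n. d n - d 0) \<longlonglongrightarrow> L" by (auto simp: convergent_def)
  from tendsto_add[OF this tendsto_const[of "d 0"]] have "d \<longlonglongrightarrow> L + d 0" by simp
  then have "(\<lambda>n. exp (d n)) \<longlonglongrightarrow> exp (L + d 0)" by (rule tendsto_exp)
  then have "(\<lambda>n. stirling_ratio (Suc n)) \<longlonglongrightarrow> exp (L + d 0)"
    unfolding d_def by (simp add: stirling_ratio_pos)
  then have "stirling_ratio \<longlonglongrightarrow> exp (L + d 0)" by (rule LIMSEQ_imp_Suc)
  then show ?thesis by (intro exI[of _ "exp (L + d 0)"]) auto
qed

lemma stirling_ratio_bounds:
  "\<exists>l u. 0 < l \<and> (\<forall>n>0. l \<le> stirling_ratio n \<and> stirling_ratio n \<le> u)"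
proof -
  obtain C where C: "C > 0" "stirling_ratio \<longlonglongrightarrow> C" using stirling_ratio_tendsto by blast
  obtain N where N: "\<And>n. n \<ge> N \<Longrightarrow> C / 2 < stirling_ratio n"
    using order_tendstoD(1)[OF C(2), of "C / 2"] C(1) unfolding eventually_sequentially by force
  obtain u where u: "\<And>n. norm (stirling_ratio n) \<le> u"
    using convergent_imp_Bseq[OF convergentI[OF C(2)]] unfolding Bseq_def by blast
  define l where "l = Min (insert (C / 2) (stirling_ratio ` {1..N}))"
  have "l > 0" unfolding l_def using C(1) by (subst Min_gr_iff) (auto intro: stirling_ratio_pos)
  moreover have "l \<le> stirling_ratio n" if "n > 0" for n
  proof (cases "n \<le> N")
    case True
    then show ?thesis unfolding l_def using that by (intro Min_le) auto
  next
    case False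
    have "l \<le> C / 2" unfolding l_def by (intro Min_le) auto
    with N[of n] False show ?thesis by simp
  qed
  moreover have "stirling_ratio n \<le> u" for n using u[of n] by simp
  ultimately show ?thesis by blast
qed

text \<open>
  The probability of \<open>k\<close> under the binomial distribution with mean \<open>k\<close>; it equals \<open>n choose k\<close> times
  \<open>exp (- n H (k / n))\<close> for the entropy \<open>H\<close>.
\<close>

definition modal_prob :: "nat \<Rightarrow> nat \<Rightarrow> real" where
  "modal_prob n k = real (n choose k) * (real k / real n) ^ k * (1 - real k / real n) ^ (n - k)"

lemma modal_prob_nonneg: "k \<le> n \<Longrightarrow> 0 \<le> modal_prob n k"
  by (cases "n = 0") (auto simp: modal_prob_def)

text \<open>This is one term of the binomial expansion of \<open>(t + (1 - t)) ^ n = 1\<close>. It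
  holds up to the endpoints \<open>k = 0\<close> and \<open>k = n\<close>, so it can control the
  terms far from the maximizers.\<close>

lemma modal_prob_le_1:
  assumes "k \<le> n"
  shows "modal_prob n k \<le> 1"
proof -
  define t where "t = real k / real n"
  have t: "0 \<le> t" "t \<le> 1" using assms by (auto simp: t_def divide_simps)
  have "modal_prob n k = real (n choose k) * t ^ k * (1 - t) ^ (n - k)"
    by (simp add: modal_prob_def t_def)
  also have "\<dots> \<le> (\<Sum>j\<le>n. real (n choose j) * t ^ j * (1 - t) ^ (n - j))"
    using t assms by (intro member_le_sum[where f = "\<lambda>j. real (n choose j) * t ^ j * (1 - t) ^ (n - j)"]) auto
  also have "\<dots> = 1" using binomial_ring[of t "1 - t" n] by simp
  finally show ?thesis .
qed

text \<open>An identity, not an asymptotic: the powers \<open>(n / e) ^ n\<close> of the factorials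
  cancel exactly against \<open>t ^ k * (1 - t) ^ (n - k)\<close>, leaving the three correction
  ratios and the square roots.\<close>

lemma modal_prob_stirling:
  assumes "0 < k" "k < n"
  shows "sqrt n * modal_prob n k =
    stirling_ratio n / (stirling_ratio k * stirling_ratio (n - k)) /
      sqrt (real k / real n * (1 - real k / real n))"
proof -
  obtain m where n: "n = k + m" "m > 0" using assms by (metis less_imp_add_positive)
  let ?e = "exp 1 :: real"
  have m: "1 - real k / real n = real m / real n" using assms by (simp add: n field_simps)
  have "real (n choose k) = fact n / (fact k * fact m)"
    using binomial_fact[of k n, where 'a = real] assms by (simp add: n)
  also have "\<dots> = stirling_ratio n / (stirling_ratio k * stirling_ratio m) *
     (sqrt n * (real n / ?e) ^ n) / (sqrt k * (real k / ?e) ^ k * (sqrt m * (real m / ?e) ^ m))"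
    using assms n fact_stirling_ratio[of n] fact_stirling_ratio[of k] fact_stirling_ratio[of m] by simp
  finally have c: "real (n choose k) = stirling_ratio n / (stirling_ratio k * stirling_ratio m) *
     (sqrt n * (real n / ?e) ^ n) / (sqrt k * (real k / ?e) ^ k * (sqrt m * (real m / ?e) ^ m))" .
  have p: "(real n / ?e) ^ n = (real n ^ k / ?e ^ k) * (real n ^ m / ?e ^ m)"
    by (simp add: n power_add power_divide)
  have s: "sqrt (real k / real n * (real m / real n)) = sqrt k * sqrt m / n"
    using assms by (simp add: real_sqrt_mult real_sqrt_divide)
  have "sqrt n * modal_prob n k = stirling_ratio n / (stirling_ratio k * stirling_ratio m) *
     (sqrt n * sqrt n) / (sqrt k * sqrt m)"
  proof -
    have *: "sn * (r * (sn * (A / E * (B / F))) / (sk * (K / E) * (sm * (M / F))) * (K / A) * (M / B)) =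
        r * (sn * sn) / (sk * sm)" if "E > 0" "F > 0" "A > 0" "B > 0" "K > 0" "M > 0"
      for r sn sk sm A B E F K M :: real
      using that by (simp add: field_simps)
    have nk: "n - k = m" by (simp add: n)
    show ?thesis
      unfolding modal_prob_def c p m nk power_divide[of "real k"] power_divide[of "real m"]
      by (rule *) (use assms n(2) in simp_all)
  qed
  also have "\<dots> = stirling_ratio n / (stirling_ratio k * stirling_ratio m) / sqrt (real k / real n * (real m / real n))"
    unfolding s by simp
  finally show ?thesis unfolding m using n(1) by (metis add_diff_cancel_left')
qed

text \<open>\<open>C\<close> is chosen before \<open>x\<close> and \<open>\<kappa>\<close>, so one
  constant serves all maximizers and the weights of two of them can be compared. It is the
  reciprocal of the limit of \<open>stirling_ratio\<close>.\<close>

lemma modal_prob_asymp: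
  "\<exists>C>0. \<forall>x \<kappa>. 0 < x \<and> x < 1 \<and> (\<lambda>n. real (\<kappa> n) / real n) \<longlonglongrightarrow> x \<longrightarrow>
     (\<lambda>n. sqrt n * modal_prob n (\<kappa> n)) \<longlonglongrightarrow> C / sqrt (x * (1 - x))"
proof -
  obtain C where C: "C > 0" "stirling_ratio \<longlonglongrightarrow> C" using stirling_ratio_tendsto by blast
  have "(\<lambda>n. sqrt n * modal_prob n (\<kappa> n)) \<longlonglongrightarrow> 1 / C / sqrt (x * (1 - x))"
    if x: "0 < x" "x < 1" and lim: "(\<lambda>n. real (\<kappa> n) / real n) \<longlonglongrightarrow> x" for x and \<kappa> :: "nat \<Rightarrow> nat"
  proof -
    have lim1: "(\<lambda>n. 1 - real (\<kappa> n) / real n) \<longlonglongrightarrow> 1 - x" by (intro tendsto_intros lim)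
    have ev: "\<forall>\<^sub>F n in sequentially. 0 < \<kappa> n \<and> \<kappa> n < n"
      using order_tendstoD(1)[OF lim x(1)] order_tendstoD(2)[OF lim x(2)] eventually_gt_at_top[of 0]
      by eventually_elim (auto simp: zero_less_divide_iff)
    have inf: "filterlim (\<lambda>n. \<kappa> n) at_top sequentially"
    proof -
      have "filterlim (\<lambda>n. real (\<kappa> n) / real n * real n) at_top sequentially"
        by (rule filterlim_tendsto_pos_mult_at_top[OF lim x(1) filterlim_real_sequentially])
      moreover have "\<forall>\<^sub>F n in sequentially. real (\<kappa> n) / real n * real n = real (\<kappa> n)"
        using ev by eventually_elim auto
      ultimately have "filterlim (\<lambda>n. real (\<kappa> n)) at_top sequentially"
        using filterlim_cong[OF refl refl] by fast
      then show ?thesis by (simp add: filterlim_sequentially_iff_filterlim_real)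
    qed
    have inf1: "filterlim (\<lambda>n. n - \<kappa> n) at_top sequentially"
    proof -
      have "filterlim (\<lambda>n. (1 - real (\<kappa> n) / real n) * real n) at_top sequentially"
        using x by (intro filterlim_tendsto_pos_mult_at_top[OF lim1 _ filterlim_real_sequentially]) auto
      moreover have "\<forall>\<^sub>F n in sequentially. (1 - real (\<kappa> n) / real n) * real n = real (n - \<kappa> n)"
        using ev by eventually_elim (auto simp: field_simps of_nat_diff)
      ultimately have "filterlim (\<lambda>n. real (n - \<kappa> n)) at_top sequentially"
        using filterlim_cong[OF refl refl] by fast
      then show ?thesis by (simp add: filterlim_sequentially_iff_filterlim_real)
    qed
    have "(\<lambda>n. stirling_ratio n / (stirling_ratio (\<kappa> n) * stirling_ratio (n - \<kappa> n)) /
      sqrt (real (\<kappa> n) / real n * (1 - real (\<kappa> n) / real n))) \<longlonglongrightarrow> C / (C * C) / sqrt (x * (1 - x))"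
      using C(1) x
      by (intro tendsto_intros lim C(2) filterlim_compose[OF C(2) inf] filterlim_compose[OF C(2) inf1]) auto
    moreover have "\<forall>\<^sub>F n in sequentially. stirling_ratio n / (stirling_ratio (\<kappa> n) * stirling_ratio (n - \<kappa> n)) /
      sqrt (real (\<kappa> n) / real n * (1 - real (\<kappa> n) / real n)) = sqrt n * modal_prob n (\<kappa> n)"
      using ev by eventually_elim (simp add: modal_prob_stirling)
    ultimately have "(\<lambda>n. sqrt n * modal_prob n (\<kappa> n)) \<longlonglongrightarrow> C / (C * C) / sqrt (x * (1 - x))"
      by (rule Lim_transform_eventually)
    then show ?thesis using C by simp
  qed
  then show ?thesis using C by (intro exI[of _ "1 / C"]) auto
qed

text \<open>Supplies the uniform factor for dominated convergence. The margin \<open>a\<close> keeps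
  \<open>k / n\<close> off both endpoints, where \<open>1 / sqrt (t * (1 - t))\<close> blows
  up.\<close>

lemma modal_prob_bound:
  assumes "0 < a"
  shows "\<exists>D. \<forall>n k. n > 0 \<longrightarrow> a \<le> real k / n \<longrightarrow> a \<le> 1 - real k / n \<longrightarrow> sqrt n * modal_prob n k \<le> D"
proof -
  obtain l u where lu: "0 < l" "\<And>n. n > 0 \<Longrightarrow> l \<le> stirling_ratio n" "\<And>n. n > 0 \<Longrightarrow> stirling_ratio n \<le> u"
    using stirling_ratio_bounds by blast
  have "sqrt n * modal_prob n k \<le> u / (l * l) / a"
    if n: "n > 0" "a \<le> real k / n" "a \<le> 1 - real k / n" for n k
  proof -
    have k': "real k / n > 0" "real k / n < 1" using that assms by linarith+
    then have k: "0 < k" "k < n" using n(1) by (auto simp: zero_less_divide_iff)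
    have "a * a \<le> real k / real n * (1 - real k / real n)"
      using n(2,3) assms k' by (intro mult_mono) linarith+
    then have a: "a \<le> sqrt (real k / real n * (1 - real k / real n))"
      by (intro real_le_rsqrt) (simp add: power2_eq_square)
    have "stirling_ratio n / (stirling_ratio k * stirling_ratio (n - k)) \<le> u / (l * l)"
      using k lu(1) lu(2)[of k] lu(2)[of "n - k"] lu(3)[of n] n(1) stirling_ratio_pos[of n]
      by (intro frac_le mult_mono) auto
    moreover have "0 \<le> u / (l * l)" using lu(1) lu(2)[OF n(1)] lu(3)[OF n(1)] by simp
    ultimately show ?thesis
      unfolding modal_prob_stirling[OF k] using a assms by (rule_tac frac_le)
  qed
  then show ?thesis by (intro exI[of _ "u / (l * l) / a"]) simp
qed

section \<open>Laplace's method for sums\<close>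

text \<open>For \<open>u = 1 + Y\<^sup>2\<close> one has \<open>|Y| <= u\<close> and
  \<open>Y ^ m >= u - 2\<close>, and one term of the exponential series bounds
  \<open>u ^ (j + 1) * exp (- a * u)\<close>; the spare power of \<open>u\<close> becomes the
  denominator. The 2 takes care of \<open>|Y| < 1\<close> and costs the factor
  \<open>exp (2 * a)\<close> in \<open>K\<close>.\<close>

lemma power_times_exp_neg_power_le:
  fixes a :: real
  assumes "a > 0" "even m" "m \<ge> 2"
  shows "\<exists>K\<ge>0. \<forall>Y. \<bar>Y\<bar> ^ j * exp (- (a * Y ^ m)) \<le> K / (1 + Y\<^sup>2)"
proof -
  define K where "K = exp (2 * a) * (fact (Suc j) / a ^ Suc j)"
  have "\<bar>Y\<bar> ^ j * exp (- (a * Y ^ m)) \<le> K / (1 + Y\<^sup>2)" for Y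
  proof -
    define u where "u = 1 + Y\<^sup>2"
    have u: "u \<ge> 1" by (simp add: u_def)
    have "\<bar>Y\<bar> \<le> 1 \<or> \<bar>Y\<bar> \<ge> 1" by linarith
    then have Yu: "\<bar>Y\<bar> \<le> u"
    proof
      assume "\<bar>Y\<bar> \<ge> 1"
      then have "\<bar>Y\<bar> \<le> \<bar>Y\<bar>\<^sup>2" by (rule self_le_power) simp
      then show ?thesis by (simp add: u_def)
    qed (use u in simp)
    have Ym: "u - 2 \<le> Y ^ m"
    proof (cases "\<bar>Y\<bar> \<ge> 1")
      case True
      then have "\<bar>Y\<bar>\<^sup>2 \<le> \<bar>Y\<bar> ^ m" by (intro power_increasing assms)
      then show ?thesis using assms by (simp add: u_def power_even_abs)
    next
      case False
      then have "\<bar>Y\<bar>\<^sup>2 \<le> 1" by (intro power_le_one) auto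
      then show ?thesis using zero_le_even_power[OF assms(2), of Y] unfolding u_def by simp
    qed
    have "(a * u) ^ Suc j / fact (Suc j) \<le> exp (a * u)"
    proof -
      have "(\<Sum>i\<in>{Suc j}. (a * u) ^ i /\<^sub>R fact i) \<le> (\<Sum>i. (a * u) ^ i /\<^sub>R fact i)"
        using assms u by (intro sum_le_suminf summable_exp_generic) auto
      then show ?thesis by (simp add: exp_def divide_inverse mult.commute del: fact_Suc power_Suc)
    qed
    then have *: "u ^ Suc j * exp (- (a * u)) \<le> fact (Suc j) / a ^ Suc j"
      using assms by (simp add: exp_minus power_mult_distrib field_simps del: fact_Suc power_Suc)
    have "\<bar>Y\<bar> ^ j * exp (- (a * Y ^ m)) \<le> u ^ j * exp (- (a * (u - 2)))"
      using Yu Ym assms u by (intro mult_mono power_mono) auto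
    also have "\<dots> = exp (2 * a) * (u ^ Suc j * exp (- (a * u))) / u"
      using u by (simp add: exp_diff exp_minus field_simps)
    also have "\<dots> \<le> K / u"
      using * u unfolding K_def by (intro divide_right_mono mult_left_mono) auto
    finally show ?thesis by (simp add: u_def)
  qed
  moreover have "K \<ge> 0" unfolding K_def using assms by (intro mult_nonneg_nonneg divide_nonneg_nonneg) auto
  ultimately show ?thesis by blast
qed

lemma integrable_divide_1_plus_square: "integrable lborel (\<lambda>y::real. K / (1 + y\<^sup>2))"
  using Sinc_Integral.integrable_inverse_1_plus_square by (simp add: divide_inverse set_integrable_def)

lemma integrable_power_exp_neg_power:
  fixes c :: real
  assumes "c > 0" "even m" "m \<ge> 2"
  shows "integrable lborel (\<lambda>y. y ^ j * exp (- (c * y ^ m)))"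
proof -
  obtain K where "K \<ge> 0" "\<And>Y. \<bar>Y\<bar> ^ j * exp (- (c * Y ^ m)) \<le> K / (1 + Y\<^sup>2)"
    using power_times_exp_neg_power_le[OF assms] by blast
  then show ?thesis
    by (intro Bochner_Integration.integrable_bound[OF integrable_divide_1_plus_square[of K]])
      (auto simp: abs_mult power_abs)
qed

lemma integral_power_exp_neg_power_odd:
  fixes c :: real
  assumes "even m" "odd j"
  shows "(\<integral>y. y ^ j * exp (- (c * y ^ m)) \<partial>lborel) = 0"
  using lborel_integral_real_affine[of "-1" "\<lambda>y. y ^ j * exp (- (c * y ^ m))" 0] assms by simp

text \<open>The substitution \<open>u = c * y ^ m\<close> on the positive half line produces the
  Gamma integral with parameter \<open>s = (j + 1) / m\<close>; evenness doubles it.\<close>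

lemma integral_power_exp_neg_power_even:
  fixes c :: real
  assumes c: "c > 0" and m: "even m" "m \<ge> 2" and j: "even j"
  shows "(\<integral>y. y ^ j * exp (- (c * y ^ m)) \<partial>lborel) =
    2 / m * c powr (- (real (j + 1) / m)) * Gamma (real (j + 1) / m)"
proof -
  define s where "s = real (j + 1) / m"
  have s: "s > 0" using m by (simp add: s_def)
  let ?F = "\<lambda>y. y ^ j * exp (- (c * y ^ m))"
  let ?f = "\<lambda>u. u powr (s - 1) / exp u"
  have int: "integrable lborel ?F" using integrable_power_exp_neg_power[OF c m] .
  have e: "einterval 0 \<infinity> = {0<..}" by (auto simp: einterval_def zero_ereal_def)
  have sint: "set_integrable lborel {0<..} ?F"
    unfolding set_integrable_def using integrable_mult_indicator[OF _ int, of "{0<..}"] by simp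
  have eq: "?f (c * y ^ m) * (c * (m * y ^ (m - 1))) = m * c powr s * ?F y" if "y > 0" for y :: real
  proof -
    have "(c * y ^ m) powr (s - 1) = c powr (s - 1) * y powr (m * (s - 1))"
      using that c by (simp add: powr_mult powr_realpow[symmetric] powr_powr)
    moreover have "m * (s - 1) = real j + 1 - m" using m by (simp add: s_def field_simps)
    moreover have "y ^ (m - 1) = y powr (real m - 1)" using that m by (simp add: powr_realpow[symmetric] of_nat_diff)
    moreover have "c powr (s - 1) * c = c powr s" using c by (simp add: powr_diff)
    moreover have "y powr (real j + 1 - m) * y powr (real m - 1) = y ^ j"
      using that by (simp add: powr_add[symmetric] powr_realpow[symmetric])
    ultimately show ?thesis by (simp add: exp_minus field_simps)
  qed
  have g: "((\<lambda>y. c * y ^ m) has_real_derivative c * (real m * y ^ (m - 1))) (at y)" for y :: real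
    by (auto intro!: derivative_eq_intros)
  have sint2: "set_integrable lborel (einterval 0 \<infinity>) (\<lambda>y. ?f (c * y ^ m) * (c * (m * y ^ (m - 1))))"
    unfolding e using set_integrable_mult_right[OF sint, of "m * c powr s"]
    by (subst set_integrable_cong[OF refl refl]) (simp_all only: eq greaterThan_iff mult.assoc)
  have lim0: "((ereal \<circ> (\<lambda>y. c * y ^ m) \<circ> real_of_ereal) \<longlongrightarrow> 0) (at_right 0)"
  proof -
    have "((\<lambda>y. c * y ^ m) \<longlongrightarrow> c * 0 ^ m) (at_right (0::real))" by (intro tendsto_intros)
    then have "((\<lambda>y. ereal (c * y ^ m)) \<longlongrightarrow> ereal 0) (at_right (0::real))" using m by (simp add: power_0_left)
    then show ?thesis
      unfolding zero_ereal_def ereal_tendsto_simps by (simp add: comp_def)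
  qed
  have limi: "((ereal \<circ> (\<lambda>y. c * y ^ m) \<circ> real_of_ereal) \<longlongrightarrow> \<infinity>) (at_left \<infinity>)"
  proof -
    have "filterlim (\<lambda>y. c * y ^ m) at_top at_top"
      using c m by (intro filterlim_tendsto_pos_mult_at_top[OF tendsto_const c] filterlim_pow_at_top filterlim_ident) auto
    then show ?thesis
      unfolding ereal_tendsto_simps by (simp add: comp_def)
  qed
  note sub = interval_integral_substitution_nonneg[where f = ?f and g = "\<lambda>y. c * y ^ m" and g' = "\<lambda>y. c * (m * y ^ (m - 1))",
      OF _ g _ _ _ _ lim0 limi sint2]
  have fint: "set_integrable lborel {0<..} ?f"
    using sub(1) c m s unfolding e by (force simp: zero_ereal_def intro!: continuous_intros)
  have "(LBINT u=0..\<infinity>. ?f u) = (LBINT y=0..\<infinity>. ?f (c * y ^ m) * (c * (m * y ^ (m - 1))))"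
    using sub(2) c m s by (force simp: zero_ereal_def intro!: continuous_intros)
  then have "(LBINT u:{0<..}. ?f u) = (LBINT y:{0<..}. ?f (c * y ^ m) * (c * (m * y ^ (m - 1))))"
    by (simp add: interval_lebesgue_integral_def e)
  also have "\<dots> = (LBINT y:{0<..}. m * c powr s * ?F y)"
    by (rule set_lebesgue_integral_cong) (use eq in auto)
  also have "\<dots> = m * c powr s * (LBINT y:{0<..}. ?F y)" by simp
  finally have 1: "(LBINT u:{0<..}. ?f u) = m * c powr s * (LBINT y:{0<..}. ?F y)" .
  have "(?f has_integral Gamma s) {0<..}"
    using Gamma_integral_real[OF s]
    by (rule has_integral_spike_set_eq[THEN iffD1, rotated -1]) (auto intro: negligible_subset[of "{0}"])
  then have "(LBINT u:{0<..}. ?f u) = Gamma s"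
    using set_borel_integral_eq_integral(2)[OF fint] by (simp add: integral_unique)
  with 1 have half: "(LBINT y:{0<..}. ?F y) = Gamma s / (m * c powr s)"
    using c m by (simp add: field_simps)
  \<comment> \<open>The line is cut at 0 and the negative half reflected. For \<open>j = 0\<close>
    the two integrands differ at \<open>y = 0\<close>, hence equality only almost
    everywhere.\<close>
  have "(\<integral>y. ?F y \<partial>lborel) = (\<integral>y. indicator {0<..} y * ?F y + indicator {0<..} (- y) * ?F (- y) \<partial>lborel)"
  proof (rule integral_cong_AE)
    show "AE y in lborel. ?F y = indicator {0<..} y * ?F y + indicator {0<..} (- y) * ?F (- y)"
      using AE_lborel_singleton[of "0::real"] by eventually_elim (use m j in \<open>auto split: split_indicator\<close>)
  qed auto
  also have "\<dots> = (\<integral>y. indicator {0<..} y * ?F y \<partial>lborel) + (\<integral>y. indicator {0<..} (- y) * ?F (- y) \<partial>lborel)"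
    using sint lborel_integrable_real_affine[OF sint[unfolded set_integrable_def], of "-1" 0]
    by (intro Bochner_Integration.integral_add) (auto simp: set_integrable_def)
  also have "(\<integral>y. indicator {0<..} (- y) * ?F (- y) \<partial>lborel) = (\<integral>y. indicator {0<..} y * ?F y \<partial>lborel)"
    using lborel_integral_real_affine[of "-1" "\<lambda>y. indicator {0<..} y * ?F y" 0] by simp
  also have "(\<integral>y. indicator {0<..} y * ?F y \<partial>lborel) = (LBINT y:{0<..}. ?F y)"
    by (simp add: set_lebesgue_integral_def)
  finally show ?thesis unfolding half by (simp add: s_def powr_minus field_simps)
qed

section \<open>From sums to integrals\<close>

text \<open>Each index \<open>k\<close> owns a cell of length \<open>1 / r\<close>. The hypothesis
  \<open>F 0 = 0\<close> is there because \<open>nat\<close> sends every negative floor to 0, so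
  index 0 really owns a half line.\<close>

lemma has_bochner_integral_step_function:
  fixes F :: "nat \<Rightarrow> real" and \<alpha> r :: real
  assumes r: "r > 0" and F0: "F 0 = 0" and FN: "\<And>k. k > N \<Longrightarrow> F k = 0"
  shows "has_bochner_integral lborel (\<lambda>y. F (nat \<lfloor>\<alpha> + r * y\<rfloor>)) ((\<Sum>k\<le>N. F k) / r)"
proof -
  define I where "I k = {(real k - \<alpha>) / r ..< (real (Suc k) - \<alpha>) / r}" for k
  have mem: "y \<in> I k \<longleftrightarrow> real k \<le> \<alpha> + r * y \<and> \<alpha> + r * y < real k + 1" for y k
    using r by (auto simp: I_def field_simps)
  have "F (nat \<lfloor>\<alpha> + r * y\<rfloor>) = (\<Sum>k\<le>N. indicator (I k) y *\<^sub>R F k)" for y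
  proof -
    define \<kappa> where "\<kappa> = nat \<lfloor>\<alpha> + r * y\<rfloor>"
    have ind: "indicator (I k) y *\<^sub>R F k = (if k = \<kappa> then F k else 0)" for k
    proof (cases "k = 0")
      case False
      have "real k \<le> \<alpha> + r * y \<and> \<alpha> + r * y < real k + 1 \<longleftrightarrow> \<lfloor>\<alpha> + r * y\<rfloor> = int k"
        by (subst floor_eq_iff) simp
      also have "\<dots> \<longleftrightarrow> k = \<kappa>" using False unfolding \<kappa>_def by linarith
      finally show ?thesis unfolding indicator_def mem by simp
    qed (simp add: F0)
    show ?thesis using FN[of \<kappa>] unfolding ind \<kappa>_def[symmetric] by (simp add: not_le)
  qed
  moreover have "has_bochner_integral lborel (\<lambda>y. \<Sum>k\<le>N. indicator (I k) y *\<^sub>R F k) (\<Sum>k\<le>N. (1 / r) *\<^sub>R F k)"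
  proof (intro has_bochner_integral_sum)
    fix k assume "k \<in> {..N}"
    have "measure lborel (I k) = 1 / r"
      unfolding I_def using r by (simp add: divide_right_mono diff_divide_distrib[symmetric])
    moreover have "has_bochner_integral lborel (\<lambda>y. indicator (I k) y *\<^sub>R F k) (measure lborel (I k) *\<^sub>R F k)"
      by (rule has_bochner_integral_indicator) (use r in \<open>auto simp: I_def divide_right_mono\<close>)
    ultimately show "has_bochner_integral lborel (\<lambda>y. indicator (I k) y *\<^sub>R F k) ((1 / r) *\<^sub>R F k)" by simp
  qed
  ultimately show ?thesis by (simp add: sum_divide_distrib)
qed

text \<open>Put \<open>s = n powr (1 / m)\<close> and \<open>Y = s * (t - x)\<close>. The exponent
  becomes \<open>- (Y ^ m * \<eta> t)\<close>, the grid spacing in \<open>Y\<close> is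
  \<open>s / n\<close>, and turning \<open>(t - x) ^ j\<close> into \<open>Y ^ j\<close> needs
  \<open>s ^ j\<close>; with the factor \<open>sqrt n\<close> that normalizes
  \<open>\<beta>\<close>, this is the prefactor \<open>s ^ (j + 1) / sqrt n\<close>. The hypotheses
  on \<open>\<beta>\<close> abstract from \<open>modal_prob\<close>, those on \<open>\<eta>\<close>
  from the local decay of \<open>ell\<close>.\<close>

lemma laplace_sum:
  fixes \<beta> :: "nat \<Rightarrow> nat \<Rightarrow> real" and \<eta> \<psi> :: "real \<Rightarrow> real" and x c B D \<Psi> \<epsilon> :: real
  assumes m: "even m" "m \<ge> 2" and \<epsilon>: "0 < \<epsilon>" "\<epsilon> \<le> x" "\<epsilon> \<le> 1 - x" and c: "c > 0"
    and \<beta>: "\<And>n k. k \<le> n \<Longrightarrow> 0 \<le> \<beta> n k" "\<And>n k. n > 0 \<Longrightarrow> \<bar>real k / n - x\<bar> < \<epsilon> \<Longrightarrow> sqrt n * \<beta> n k \<le> D"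
    and \<beta>_lim: "\<And>\<kappa>. (\<lambda>n. real (\<kappa> n) / n) \<longlonglongrightarrow> x \<Longrightarrow> (\<lambda>n. sqrt n * \<beta> n (\<kappa> n)) \<longlonglongrightarrow> B"
    and \<eta>: "isCont \<eta> x" "\<eta> x = c" "\<And>t. \<bar>t - x\<bar> < \<epsilon> \<Longrightarrow> c / 2 \<le> \<eta> t"
    and \<psi>: "isCont \<psi> x" "\<And>t. \<bar>t - x\<bar> < \<epsilon> \<Longrightarrow> \<bar>\<psi> t\<bar> \<le> \<Psi>"
  shows "(\<lambda>n. (real n powr (1 / m)) ^ (j + 1) / sqrt n *
      (\<Sum>k | k \<le> n \<and> \<bar>real k / n - x\<bar> < \<epsilon>.
        \<beta> n k * exp (- (n * ((real k / n - x) ^ m * \<eta> (real k / n)))) * ((real k / n - x) ^ j * \<psi> (real k / n))))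
    \<longlonglongrightarrow> B * \<psi> x * (\<integral>y. y ^ j * exp (- (c * y ^ m)) \<partial>lborel)"
proof -
  define s where "s n = real n powr (1 / m)" for n :: nat
  have s_pos: "s n > 0" if "n > 0" for n using that by (simp add: s_def)
  have s_pow: "s n ^ m = n" if "n > 0" for n
    using that m by (simp add: s_def powr_realpow[symmetric] powr_powr)
  have s_lim: "(\<lambda>n. 1 / s n) \<longlonglongrightarrow> 0"
  proof -
    have "(\<lambda>n. real n powr (- (1 / m))) \<longlonglongrightarrow> 0"
      using m by (intro tendsto_neg_powr filterlim_real_sequentially) auto
    then show ?thesis by (simp add: s_def powr_minus divide_inverse)
  qed
  have s_lim': "(\<lambda>n. s n / n) \<longlonglongrightarrow> 0"
  proof -
    have "(\<lambda>n. real n powr (1 / m - 1)) \<longlonglongrightarrow> 0"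
      using m by (intro tendsto_neg_powr filterlim_real_sequentially) auto
    then show ?thesis by (simp add: s_def powr_diff)
  qed
  have s_le: "s n / n \<le> 1" if "n > 0" for n
  proof -
    have "s n \<le> real n powr 1" unfolding s_def using that m by (intro powr_mono) auto
    then show ?thesis using that by simp
  qed
  define F where "F n k = (if \<bar>real k / n - x\<bar> < \<epsilon> then
      sqrt n * \<beta> n k * exp (- ((s n * (real k / n - x)) ^ m * \<eta> (real k / n))) *
        ((s n * (real k / n - x)) ^ j * \<psi> (real k / n)) else 0)" for n k
  \<comment> \<open>Negative arguments are truncated to the index 0, where \<open>F\<close> vanishes.\<close>
  define \<kappa> where "\<kappa> y n = nat \<lfloor>n * x + n / s n * y\<rfloor>" for y and n :: nat
  define f where "f y = B * \<psi> x * (y ^ j * exp (- (c * y ^ m)))" for y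
  \<comment> \<open>\<open>\<epsilon> \<le> x\<close> puts \<open>k = 0\<close> outside the open
    window, and \<open>\<epsilon> \<le> 1 - x\<close> does the same for every \<open>k > n\<close>.
    For \<open>n = 0\<close> the quotient is \<open>k / 0 = 0\<close>, which lies outside
    too.\<close>
  have F_zero: "F n 0 = 0" for n using \<epsilon> by (simp add: F_def)
  have F_zero': "F 0 k = 0" for k using \<epsilon> by (simp add: F_def)
  have F_large: "F n k = 0" if "k > n" for n k
  proof -
    have "real k / n \<ge> 1 \<or> n = 0" using that by (auto simp: divide_simps)
    then show ?thesis using \<epsilon> F_zero' by (auto simp: F_def)
  qed
  have int: "has_bochner_integral lborel (\<lambda>y. F n (\<kappa> y n)) ((\<Sum>k\<le>n. F n k) / (n / s n))" if "n > 0" for n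
    unfolding \<kappa>_def using that s_pos[of n] F_large
    by (intro has_bochner_integral_step_function F_zero) auto
  \<comment> \<open>Rounding \<open>y\<close> down to the grid moves it by at most one spacing
    \<open>s n / n\<close>.\<close>
  have near: "s n * (real (\<kappa> y n) / n - x) \<le> y \<and> y - s n / n \<le> s n * (real (\<kappa> y n) / n - x)"
    if "n > 0" "n * x + n / s n * y \<ge> 0" for n y
  proof -
    have k: "real (\<kappa> y n) = \<lfloor>n * x + n / s n * y\<rfloor>" using that by (simp add: \<kappa>_def)
    have a: "real (\<kappa> y n) \<le> n * x + n / s n * y" "n * x + n / s n * y - 1 \<le> real (\<kappa> y n)"
      unfolding k by linarith+
    have Y: "s n * (u / n - x) = s n / n * (u - n * x)" for u using that(1) by (simp add: field_simps)
    have sn: "s n / n > 0" using s_pos[OF that(1)] that(1) by simp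
    have "s n / n * (real (\<kappa> y n) - n * x) \<le> s n / n * (n / s n * y)"
      using a(1) sn by (intro mult_left_mono) auto
    moreover have "s n / n * (n / s n * y - 1) \<le> s n / n * (real (\<kappa> y n) - n * x)"
      using a(2) sn by (intro mult_left_mono) auto
    ultimately show ?thesis unfolding Y using that(1) s_pos[OF that(1)] by (simp add: right_diff_distrib)
  qed
  have lim: "(\<lambda>n. F n (\<kappa> y n)) \<longlonglongrightarrow> f y" for y
  proof -
    have pos: "\<forall>\<^sub>F n in sequentially. 0 < n \<and> 0 \<le> n * x + n / s n * y"
    proof -
      have "(\<lambda>n. x + 1 / s n * y) \<longlonglongrightarrow> x + 0 * y" by (intro tendsto_intros s_lim)
      from order_tendstoD(1)[OF this, of 0] have "\<forall>\<^sub>F n in sequentially. 0 < x + 1 / s n * y"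
        using \<epsilon> by simp
      then show ?thesis using eventually_gt_at_top[of 0]
      proof eventually_elim
        case (elim n)
        then have "0 \<le> n * (x + 1 / s n * y)" by (intro mult_nonneg_nonneg) auto
        then show ?case using elim by (simp add: distrib_left)
      qed
    qed
    have Ylim: "(\<lambda>n. s n * (real (\<kappa> y n) / n - x)) \<longlonglongrightarrow> y"
    proof (rule tendsto_sandwich[where h = "\<lambda>_. y"])
      show "(\<lambda>n. y - s n / n) \<longlonglongrightarrow> y" using tendsto_diff[OF tendsto_const[of y] s_lim'] by simp
    qed (use near in \<open>auto intro!: eventually_mono[OF pos]\<close>)
    have "(\<lambda>n. x + 1 / s n * (s n * (real (\<kappa> y n) / n - x))) \<longlonglongrightarrow> x + 0 * y"
      by (intro tendsto_intros s_lim Ylim)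
    then have "(\<lambda>n. x + 1 / s n * (s n * (real (\<kappa> y n) / n - x))) \<longlonglongrightarrow> x" by simp
    moreover have "\<forall>\<^sub>F n in sequentially. x + 1 / s n * (s n * (real (\<kappa> y n) / n - x)) = real (\<kappa> y n) / n"
      using eventually_gt_at_top[of 0]
    proof eventually_elim
      case (elim n)
      then show ?case using s_pos[OF elim] by simp
    qed
    ultimately have tlim: "(\<lambda>n. real (\<kappa> y n) / n) \<longlonglongrightarrow> x"
      by (rule Lim_transform_eventually)
    have "(\<lambda>n. sqrt n * \<beta> n (\<kappa> y n) * exp (- ((s n * (real (\<kappa> y n) / n - x)) ^ m * \<eta> (real (\<kappa> y n) / n))) *
        ((s n * (real (\<kappa> y n) / n - x)) ^ j * \<psi> (real (\<kappa> y n) / n))) \<longlonglongrightarrow>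
        B * exp (- (y ^ m * \<eta> x)) * (y ^ j * \<psi> x)"
      by (intro tendsto_intros \<beta>_lim Ylim tlim isCont_tendsto_compose[OF \<eta>(1)] isCont_tendsto_compose[OF \<psi>(1)])
    moreover have "\<forall>\<^sub>F n in sequentially. \<bar>real (\<kappa> y n) / n - x\<bar> < \<epsilon>"
      using tendstoD[OF tlim \<epsilon>(1)] by (simp add: dist_real_def)
    then have "\<forall>\<^sub>F n in sequentially. sqrt n * \<beta> n (\<kappa> y n) * exp (- ((s n * (real (\<kappa> y n) / n - x)) ^ m * \<eta> (real (\<kappa> y n) / n))) *
        ((s n * (real (\<kappa> y n) / n - x)) ^ j * \<psi> (real (\<kappa> y n) / n)) = F n (\<kappa> y n)"
      by eventually_elim (simp add: F_def)
    ultimately have "(\<lambda>n. F n (\<kappa> y n)) \<longlonglongrightarrow> B * exp (- (y ^ m * \<eta> x)) * (y ^ j * \<psi> x)"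
      by (rule Lim_transform_eventually)
    then show ?thesis by (simp add: f_def \<eta>(2) mult_ac)
  qed
  obtain K where K: "K \<ge> 0" "\<And>Y. \<bar>Y\<bar> ^ j * exp (- (c / 2 * Y ^ m)) \<le> K / (1 + Y\<^sup>2)"
    using power_times_exp_neg_power_le[of "c / 2" m j] c m by auto
  have \<Psi>: "\<Psi> \<ge> 0" using \<psi>(2)[of x] \<epsilon> by simp
  define D' where "D' = \<bar>D\<bar>"
  \<comment> \<open>The majorant must depend on \<open>y\<close>, while the decay estimate is in
    terms of the rounded point \<open>Y\<close>. From \<open>y - 1 <= Y <= y\<close> follows
    \<open>1 + y\<^sup>2 <= 3 * (1 + Y\<^sup>2)\<close>, the source of the 3.\<close>
  have bound: "\<bar>F n (\<kappa> y n)\<bar> \<le> 3 * D' * \<Psi> * K / (1 + y\<^sup>2)" for n y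
  proof (cases "n > 0 \<and> \<bar>real (\<kappa> y n) / n - x\<bar> < \<epsilon>")
    case True
    define t where "t = real (\<kappa> y n) / n"
    define Y where "Y = s n * (t - x)"
    have n: "n > 0" and t: "\<bar>t - x\<bar> < \<epsilon>" using True by (auto simp: t_def)
    then have "t > 0" "t < 1" using \<epsilon> by linarith+
    then have kn: "\<kappa> y n > 0" "\<kappa> y n \<le> n" using n by (auto simp: t_def zero_less_divide_iff)
    then have "n * x + n / s n * y \<ge> 0" unfolding \<kappa>_def by linarith
    from near[OF n this] s_le[OF n] have Y1: "Y \<le> y" "y - 1 \<le> Y" unfolding Y_def t_def by auto
    then have "\<bar>y\<bar>\<^sup>2 \<le> (\<bar>Y\<bar> + 1)\<^sup>2" by (intro power_mono) auto
    then have 1: "y\<^sup>2 \<le> Y\<^sup>2 + 1 + 2 * \<bar>Y\<bar>" by (simp add: power2_sum)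
    have 2: "2 * \<bar>Y\<bar> \<le> Y\<^sup>2 + 1" using sum_squares_bound[of "\<bar>Y\<bar>" 1] by simp
    have "1 + a \<le> 3 * (1 + b)" if "a \<le> b + 1 + u" "u \<le> b + 1" "0 \<le> b" for a b u :: real
      using that by simp
    from this[OF 1 2] have sq: "1 + y\<^sup>2 \<le> 3 * (1 + Y\<^sup>2)" by simp
    have "\<bar>F n (\<kappa> y n)\<bar> = sqrt n * \<beta> n (\<kappa> y n) * exp (- (Y ^ m * \<eta> t)) * (\<bar>Y\<bar> ^ j * \<bar>\<psi> t\<bar>)"
      using True \<beta>(1)[OF kn(2)] by (simp add: F_def Y_def t_def abs_mult power_abs)
    also have "\<dots> \<le> D' * exp (- (c / 2 * Y ^ m)) * (\<bar>Y\<bar> ^ j * \<Psi>)"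
    proof (intro mult_mono mult_nonneg_nonneg)
      show "sqrt n * \<beta> n (\<kappa> y n) \<le> D'" using \<beta>(2)[of n "\<kappa> y n"] True by (auto simp: D'_def)
      have "c / 2 * Y ^ m \<le> \<eta> t * Y ^ m"
        using \<eta>(3)[OF t] m by (intro mult_right_mono zero_le_even_power)
      then show "exp (- (Y ^ m * \<eta> t)) \<le> exp (- (c / 2 * Y ^ m))" by (simp add: mult.commute)
    qed (use \<psi>(2)[OF t] \<Psi> \<beta>(1)[OF kn(2)] in \<open>auto simp: D'_def\<close>)
    also have "\<dots> = D' * \<Psi> * (\<bar>Y\<bar> ^ j * exp (- (c / 2 * Y ^ m)))" by simp
    also have "\<dots> \<le> D' * \<Psi> * (K / (1 + Y\<^sup>2))"
      using \<Psi> by (intro mult_left_mono K) (auto simp: D'_def)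
    also have "\<dots> \<le> D' * \<Psi> * (3 * K / (1 + y\<^sup>2))"
    proof -
      have "K / (1 + Y\<^sup>2) = 3 * K / (3 * (1 + Y\<^sup>2))" by (subst mult_divide_mult_cancel_left) auto
      also have "\<dots> \<le> 3 * K / (1 + y\<^sup>2)"
        using sq K(1) by (intro divide_left_mono) (auto intro!: mult_pos_pos add_pos_nonneg)
      finally show ?thesis using \<Psi> by (intro mult_left_mono) (auto simp: D'_def)
    qed
    finally show ?thesis by (simp add: mult_ac)
  next
    case False
    then have "F n (\<kappa> y n) = 0" using F_zero' by (auto simp: F_def)
    then show ?thesis using K \<Psi> by (simp add: D'_def)
  qed
  have "(\<lambda>n. \<integral>y. F n (\<kappa> y n) \<partial>lborel) \<longlonglongrightarrow> (\<integral>y. f y \<partial>lborel)"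
  proof (rule integral_dominated_convergence)
    show "integrable lborel (\<lambda>y. 3 * D' * \<Psi> * K / (1 + y\<^sup>2))" by (rule integrable_divide_1_plus_square)
    show "(\<lambda>y. F n (\<kappa> y n)) \<in> borel_measurable lborel" for n
      using int[of n] F_zero' by (cases "n = 0") (simp_all add: borel_measurable_has_bochner_integral)
    show "f \<in> borel_measurable lborel" unfolding f_def by simp
    show "AE y in lborel. (\<lambda>n. F n (\<kappa> y n)) \<longlonglongrightarrow> f y" by (rule AE_I2) (rule lim)
    show "AE y in lborel. norm (F n (\<kappa> y n)) \<le> 3 * D' * \<Psi> * K / (1 + y\<^sup>2)" for n
      by (rule AE_I2) (simp only: real_norm_def bound)
  qed
  moreover have "(\<integral>y. F n (\<kappa> y n) \<partial>lborel) = s n ^ (j + 1) / sqrt n * (\<Sum>k | k \<le> n \<and> \<bar>real k / n - x\<bar> < \<epsilon>.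
        \<beta> n k * exp (- (n * ((real k / n - x) ^ m * \<eta> (real k / n)))) * ((real k / n - x) ^ j * \<psi> (real k / n)))"
    for n
  proof (cases "n = 0")
    case False
    then have n: "n > 0" by simp
    have sq: "sqrt n / n = 1 / sqrt n" using n by (simp add: real_div_sqrt field_simps)
    have "(\<integral>y. F n (\<kappa> y n) \<partial>lborel) = (\<Sum>k\<le>n. F n k) / (n / s n)"
      using int[OF n] by (rule has_bochner_integral_integral_eq)
    also have "(\<Sum>k\<le>n. F n k) = (\<Sum>k | k \<le> n \<and> \<bar>real k / n - x\<bar> < \<epsilon>. F n k)"
      by (intro sum.mono_neutral_right) (auto simp: F_def)
    also have "\<dots> / (n / s n) = (\<Sum>k | k \<le> n \<and> \<bar>real k / n - x\<bar> < \<epsilon>. s n ^ (j + 1) / sqrt n *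
        (\<beta> n k * exp (- (n * ((real k / n - x) ^ m * \<eta> (real k / n)))) * ((real k / n - x) ^ j * \<psi> (real k / n))))"
      unfolding sum_divide_distrib
    proof (rule sum.cong[OF refl])
      fix k assume k: "k \<in> {k. k \<le> n \<and> \<bar>real k / n - x\<bar> < \<epsilon>}"
      define t where "t = real k / n"
      have "F n k / (n / s n) = s n * s n ^ j * (sqrt n / n) *
          (\<beta> n k * exp (- (s n ^ m * (t - x) ^ m * \<eta> t)) * ((t - x) ^ j * \<psi> t))"
        using k by (simp add: F_def t_def power_mult_distrib)
      then show "F n k / (n / s n) = s n ^ (j + 1) / sqrt n *
        (\<beta> n k * exp (- (n * ((real k / n - x) ^ m * \<eta> (real k / n)))) * ((real k / n - x) ^ j * \<psi> (real k / n)))"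
        unfolding sq s_pow[OF n] t_def by (simp add: mult_ac)
    qed
    finally show ?thesis by (simp add: sum_distrib_left)
  qed (simp add: F_zero' s_def)
  ultimately show ?thesis unfolding s_def by (simp add: f_def)
qed

section \<open>Reduction to a one-dimensional Gibbs measure\<close>

text \<open>A 0-1 row is the indicator of the set of its ones; grouping these sets by cardinality
  produces the binomial coefficients.\<close>

lemma sum_01_PiE:
  fixes f :: "real \<Rightarrow> real"
  assumes "finite A"
  shows "(\<Sum>r\<in>A \<rightarrow>\<^sub>E {0, 1}. f (\<Sum>j\<in>A. r j)) = (\<Sum>k\<le>card A. real (card A choose k) * f (real k))"
proof -
  define R :: "'a set \<Rightarrow> 'a \<Rightarrow> real" where "R S = restrict (indicator S) A" for S
  have "(\<Sum>r\<in>A \<rightarrow>\<^sub>E {0, 1}. f (\<Sum>j\<in>A. r j)) = (\<Sum>S\<in>Pow A. f (real (card S)))"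
  proof (rule sum.reindex_bij_witness[of _ R "\<lambda>r. {j \<in> A. r j = 1}"])
    fix r assume r: "r \<in> A \<rightarrow>\<^sub>E {0, 1::real}"
    show "R {j \<in> A. r j = 1} = r"
    proof
      fix j show "R {j \<in> A. r j = 1} j = r j"
        using PiE_mem[OF r, of j] PiE_arb[OF r, of j] by (cases "j \<in> A") (auto simp: R_def)
    qed
    have "(\<Sum>j\<in>A. r j) = (\<Sum>j\<in>A. indicator {j \<in> A. r j = 1} j)"
      using r by (intro sum.cong) (auto simp: indicator_def)
    also have "\<dots> = real (card {j \<in> A. r j = 1})"
      using assms by (simp add: indicator_def sum.If_cases Int_def)
    finally show "f (real (card {j \<in> A. r j = 1})) = f (\<Sum>j\<in>A. r j)" by simp
  next
    fix S assume "S \<in> Pow A"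
    then show "{j \<in> A. R S j = 1} = S" "R S \<in> A \<rightarrow>\<^sub>E {0, 1}"
      by (auto simp: R_def indicator_def split: if_splits)
  qed auto
  also have "\<dots> = (\<Sum>k\<le>card A. \<Sum>S\<in>{S \<in> Pow A. card S = k}. f (real (card S)))"
    using assms by (intro sum.group[symmetric]) (auto intro: card_mono)
  also have "\<dots> = (\<Sum>k\<le>card A. real (card A choose k) * f (real k))"
    using n_subsets[OF assms] by (simp add: Pow_def)
  finally show ?thesis .
qed

text \<open>An unnormalized Gibbs expectation: \<open>f\<close> is evaluated at the fraction of
  nodes to which a single node points. Taking \<open>f\<close> constantly 1 gives the partition
  function of one row of the adjacency matrix.\<close>

definition row_moment :: "nat \<Rightarrow> nat \<Rightarrow> real \<Rightarrow> real \<Rightarrow> (real \<Rightarrow> real) \<Rightarrow> real" where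
  "row_moment p n b1 b2 f =
     (\<Sum>k\<le>n. real (n choose k) * exp (real n * (b1 * (real k / n) + b2 * (real k / n) ^ p)) * f (real k / n))"

lemma partition_function_eq:
  assumes n: "n > 0"
  shows "partition_function p n b1 b2 = row_moment p n b1 b2 (\<lambda>_. 1) ^ n"
proof -
  define G where "G d = exp (real n * (b1 * (d / n) + b2 * (d / n) ^ p))" for d :: real
  let ?row = "{1..n} \<rightarrow>\<^sub>E {0, 1::real}"
  have 1: "exp (real n ^ 2 * (b1 * edge_density n X + b2 * star_density p n X)) = (\<Prod>i\<in>{1..n}. G (\<Sum>j\<in>{1..n}. X i j))" for X
  proof -
    \<comment> \<open>The \<open>p\<close> endpoints of a star range independently, repetitions
      included, so the stars centred at \<open>i\<close> add up to the \<open>p\<close>-th power of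
      the out-degree of \<open>i\<close>, and the energy splits over the rows.\<close>
    have "(\<Sum>j\<in>{1..p} \<rightarrow>\<^sub>E {1..n}. \<Prod>k\<in>{1..p}. X i (j k)) = (\<Sum>j\<in>{1..n}. X i j) ^ p" for i
      using prod_sum_PiE[of "{1..p}" "\<lambda>_. {1..n}" "\<lambda>_ j. X i j"] by simp
    then have "real n ^ 2 * (b1 * edge_density n X + b2 * star_density p n X) =
      b1 * (\<Sum>i\<in>{1..n}. \<Sum>j\<in>{1..n}. X i j) + b2 * real n * (\<Sum>i\<in>{1..n}. (\<Sum>j\<in>{1..n}. X i j) ^ p / real n ^ p)"
      using n unfolding edge_density_def star_density_def
      by (simp add: distrib_left power2_eq_square sum_divide_distrib[symmetric])
    also have "\<dots> = (\<Sum>i\<in>{1..n}. real n * (b1 * ((\<Sum>j\<in>{1..n}. X i j) / n) + b2 * ((\<Sum>j\<in>{1..n}. X i j) / n) ^ p))"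
    proof -
      have "real n * (b1 * (d / n) + b2 * (d / n) ^ p) = b1 * d + b2 * real n * (d ^ p / real n ^ p)" for d
        using n by (simp add: power_divide distrib_left)
      then show ?thesis by (simp only: sum_distrib_left sum.distrib)
    qed
    finally show ?thesis unfolding G_def by (simp add: exp_sum)
  qed
  have "partition_function p n b1 b2 = (\<Sum>X\<in>{1..n} \<rightarrow>\<^sub>E ?row. \<Prod>i\<in>{1..n}. G (\<Sum>j\<in>{1..n}. X i j))"
    unfolding partition_function_def digraphs_def 1 ..
  also have "\<dots> = (\<Prod>i\<in>{1..n}. \<Sum>r\<in>?row. G (\<Sum>j\<in>{1..n}. r j))"
    by (rule prod_sum_PiE[symmetric]) (auto intro: finite_PiE)
  also have "\<dots> = (\<Sum>k\<le>n. real (n choose k) * G k) ^ n"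
    using sum_01_PiE[of "{1..n}" G] by simp
  finally show ?thesis by (simp add: row_moment_def G_def)
qed

lemma row_moment_pos: "row_moment p n b1 b2 (\<lambda>_. 1) > 0"
  unfolding row_moment_def by (intro sum_pos) auto

lemma psi_eq: "n > 0 \<Longrightarrow> psi p n b1 b2 = ln (row_moment p n b1 b2 (\<lambda>_. 1)) / n"
  using row_moment_pos[of p n b1 b2]
  by (simp add: psi_def partition_function_eq ln_realpow power2_eq_square)

lemma row_moment_deriv:
  "((\<lambda>b. row_moment p n b1 b f) has_real_derivative n * row_moment p n b1 b2 (\<lambda>t. t ^ p * f t)) (at b2)"
  unfolding row_moment_def sum_distrib_left
  by (rule DERIV_sum) (auto intro!: derivative_eq_intros simp: mult_ac)

lemma psi_second_deriv:
  fixes p n :: nat and b1 b2 :: real and E :: "(real \<Rightarrow> real) \<Rightarrow> real"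
  assumes n: "n > 0"
  defines "E \<equiv> \<lambda>f. row_moment p n b1 b2 f / row_moment p n b1 b2 (\<lambda>_. 1)"
  shows "(deriv ^^ 2) (\<lambda>b. psi p n b1 b) b2 = n * (E (\<lambda>t. t ^ p * t ^ p) - E (\<lambda>t. t ^ p) ^ 2)"
proof -
  let ?M = "\<lambda>b f. row_moment p n b1 b f"
  have psi: "(\<lambda>b. psi p n b1 b) = (\<lambda>b. ln (?M b (\<lambda>_. 1)) / n)" using psi_eq[OF n] by auto
  have d1: "((\<lambda>b. psi p n b1 b) has_real_derivative ?M b (\<lambda>t. t ^ p) / ?M b (\<lambda>_. 1)) (at b)" for b
    unfolding psi
    using DERIV_cdivide[OF DERIV_chain'[OF row_moment_deriv[of p n b1 "\<lambda>_. 1" b] DERIV_ln_divide[OF row_moment_pos]], of n] n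
    by simp
  then have "deriv (\<lambda>b. psi p n b1 b) = (\<lambda>b. ?M b (\<lambda>t. t ^ p) / ?M b (\<lambda>_. 1))"
    using DERIV_imp_deriv by blast
  moreover have "((\<lambda>b. ?M b (\<lambda>t. t ^ p) / ?M b (\<lambda>_. 1)) has_real_derivative
      n * (E (\<lambda>t. t ^ p * t ^ p) - E (\<lambda>t. t ^ p) ^ 2)) (at b2)"
  proof -
    have pos: "?M b2 (\<lambda>_. 1) \<noteq> 0" using row_moment_pos[of p n b1 b2] by simp
    have "((\<lambda>b. ?M b (\<lambda>t. t ^ p) / ?M b (\<lambda>_. 1)) has_real_derivative
      (n * ?M b2 (\<lambda>t. t ^ p * t ^ p) * ?M b2 (\<lambda>_. 1) - ?M b2 (\<lambda>t. t ^ p) * (n * ?M b2 (\<lambda>t. t ^ p * 1))) / (?M b2 (\<lambda>_. 1) * ?M b2 (\<lambda>_. 1))) (at b2)"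
      by (intro DERIV_divide row_moment_deriv pos)
    moreover have "(n * u * w - v * (n * v)) / (w * w) = n * (u / w - (v / w) ^ 2)" if "w \<noteq> 0" for u v w :: real
      using that by (simp add: field_simps power2_eq_square)
    ultimately show ?thesis using pos by (simp add: E_def)
  qed
  ultimately show ?thesis by (simp add: numeral_2_eq_2 DERIV_imp_deriv)
qed

lemma row_moment_linear:
  "row_moment p n b1 b2 (\<lambda>t. f t + g t) = row_moment p n b1 b2 f + row_moment p n b1 b2 g"
  "row_moment p n b1 b2 (\<lambda>t. c * f t) = c * row_moment p n b1 b2 f"
  by (simp_all add: row_moment_def sum.distrib[symmetric] sum_distrib_left algebra_simps)

text \<open>A variance does not change under a shift. With \<open>a = x ^ p\<close> the shifted
  function vanishes at the maximizer, so the order-one terms that would have to cancel never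
  arise.\<close>

lemma psi_second_deriv_shift:
  fixes p n :: nat and b1 b2 :: real and E :: "(real \<Rightarrow> real) \<Rightarrow> real"
  assumes n: "n > 0"
  defines "E \<equiv> \<lambda>f. row_moment p n b1 b2 f / row_moment p n b1 b2 (\<lambda>_. 1)"
  shows "(deriv ^^ 2) (\<lambda>b. psi p n b1 b) b2 = n * (E (\<lambda>t. (t ^ p - a)\<^sup>2) - E (\<lambda>t. t ^ p - a) ^ 2)"
proof -
  have E1: "E (\<lambda>_. 1) = 1" using row_moment_pos[of p n b1 b2] by (simp add: E_def)
  have lin: "E (\<lambda>t. f t + g t) = E f + E g" "E (\<lambda>t. c * f t) = c * E f" for f g c
    by (simp_all add: E_def row_moment_linear add_divide_distrib)
  have "E (\<lambda>t. t ^ p - a) = E (\<lambda>t. t ^ p + (- a) * 1)" by simp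
  also have "\<dots> = E (\<lambda>t. t ^ p) - a" by (simp only: lin E1)
  finally have 1: "E (\<lambda>t. t ^ p - a) = E (\<lambda>t. t ^ p) - a" .
  have "E (\<lambda>t. (t ^ p - a)\<^sup>2) = E (\<lambda>t. t ^ p * t ^ p + ((- 2 * a) * t ^ p + a\<^sup>2 * 1))"
    by (rule arg_cong[of _ _ E]) (auto simp: power2_eq_square algebra_simps)
  also have "\<dots> = E (\<lambda>t. t ^ p * t ^ p) - 2 * a * E (\<lambda>t. t ^ p) + a\<^sup>2" by (simp only: lin E1)
  finally have 2: "E (\<lambda>t. (t ^ p - a)\<^sup>2) = E (\<lambda>t. t ^ p * t ^ p) - 2 * a * E (\<lambda>t. t ^ p) + a\<^sup>2" .
  have "(deriv ^^ 2) (\<lambda>b. psi p n b1 b) b2 = n * (E (\<lambda>t. t ^ p * t ^ p) - E (\<lambda>t. t ^ p) ^ 2)"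
    unfolding E_def by (rule psi_second_deriv[OF n])
  also have "\<dots> = n * (E (\<lambda>t. (t ^ p - a)\<^sup>2) - E (\<lambda>t. t ^ p - a) ^ 2)"
    unfolding 1 2 by (simp add: power2_diff)
  finally show ?thesis .
qed

section \<open>Expansion of \<open>ell\<close> at its maximizers\<close>

lemma ell''_eq:
  assumes p: "p \<ge> 2" and x: "0 < x" "x < 1"
  shows "ell'' p b1 b2 x = ell_d2 p b2 x"
proof -
  have "\<forall>\<^sub>F t in nhds x. 0 < t \<and> t < 1"
    using eventually_nhds_in_open[of "{0<..<1}" x] x by simp
  then have "\<forall>\<^sub>F t in nhds x. deriv (ell p b1 b2) t = ell_d1 p b1 b2 t"
    by eventually_elim (simp add: DERIV_imp_deriv ell_deriv[OF p])
  then have "deriv (deriv (ell p b1 b2)) x = deriv (ell_d1 p b1 b2) x"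
    by (rule deriv_cong_ev) simp
  also have "\<dots> = ell_d2 p b2 x" by (rule DERIV_imp_deriv[OF ell_d1_deriv[OF p x]])
  finally show ?thesis by (simp add: ell''_def numeral_2_eq_2)
qed

lemma isCont_ell_d2:
  assumes p: "p \<ge> 2" and x: "0 < x" "x < 1"
  shows "isCont (ell_d2 p b2) x"
  unfolding ell_d2_def[OF p, abs_def] using x by (intro continuous_intros) auto

section \<open>Where a maximizer can be degenerate\<close>

text \<open>Since \<open>ell_d1\<close> vanishes at \<open>x\<close>, positive \<open>ell_d2\<close>
  on the interval would make \<open>ell\<close> exceed its maximum at \<open>y\<close>, by two
  applications of the mean value theorem.\<close>

lemma maximizer_not_convex_right:
  assumes p: "p \<ge> 2" and x: "x \<in> maximizers p b1 b2" and y: "x < y" "y < 1"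
    and pos: "\<And>z. x < z \<Longrightarrow> z < y \<Longrightarrow> ell_d2 p b2 z > 0"
  shows False
proof -
  note x01 = maximizers_interior[OF p x]
  have "\<exists>z>x. z < y \<and> ell p b1 b2 y - ell p b1 b2 x = (y - x) * ell_d1 p b1 b2 z"
    using x01 y by (intro MVT2 ell_deriv p) auto
  then obtain z where z: "x < z" "z < y" "ell p b1 b2 y - ell p b1 b2 x = (y - x) * ell_d1 p b1 b2 z" by blast
  have "\<exists>w>x. w < z \<and> ell_d1 p b1 b2 z - ell_d1 p b1 b2 x = (z - x) * ell_d2 p b2 w"
    using x01 y z by (intro MVT2 ell_d1_deriv p) auto
  then obtain w where w: "x < w" "w < z" "ell_d1 p b1 b2 z = (z - x) * ell_d2 p b2 w"
    using maximizers_ell_d1[OF p x] by auto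
  have "ell p b1 b2 y - ell p b1 b2 x > 0"
    unfolding z(3) w(3) using z w y pos[of w] by (intro mult_pos_pos) auto
  moreover have "ell p b1 b2 y \<le> ell p b1 b2 x" using x x01 y by (auto simp: maximizers_iff)
  ultimately show False by simp
qed

lemma maximizer_not_convex_left:
  assumes p: "p \<ge> 2" and x: "x \<in> maximizers p b1 b2" and y: "y < x" "0 < y"
    and pos: "\<And>z. y < z \<Longrightarrow> z < x \<Longrightarrow> ell_d2 p b2 z > 0"
  shows False
proof -
  note x01 = maximizers_interior[OF p x]
  have "\<exists>z>y. z < x \<and> ell p b1 b2 x - ell p b1 b2 y = (x - y) * ell_d1 p b1 b2 z"
    using x01 y by (intro MVT2 ell_deriv p) auto
  then obtain z where z: "y < z" "z < x" "ell p b1 b2 x - ell p b1 b2 y = (x - y) * ell_d1 p b1 b2 z" by blast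
  have "\<exists>w>z. w < x \<and> ell_d1 p b1 b2 x - ell_d1 p b1 b2 z = (x - z) * ell_d2 p b2 w"
    using x01 y z by (intro MVT2 ell_d1_deriv p) auto
  then obtain w where w: "z < w" "w < x" "- ell_d1 p b1 b2 z = (x - z) * ell_d2 p b2 w"
    using maximizers_ell_d1[OF p x] by auto
  have "(x - z) * ell_d2 p b2 w > 0" using z w pos[of w] by (intro mult_pos_pos) auto
  then have "(x - y) * ell_d1 p b1 b2 z < 0" using w(3) y by (intro mult_pos_neg) auto
  moreover have "ell p b1 b2 y \<le> ell p b1 b2 x" using x x01 y by (auto simp: maximizers_iff)
  ultimately show False using z(3) by simp
qed

lemma ell_d2_pos_iff:
  assumes p: "p \<ge> 2" and x: "0 < x" "x < 1"
  shows "ell_d2 p b2 x > 0 \<longleftrightarrow> b2 * (real p * (real p - 1)) * star_weight p x > 1"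
proof -
  have "x * (1 - x) > 0" using x by simp
  then show ?thesis using ell_d2_weight[OF p x, of b2] by (metis diff_gt_0_iff_gt zero_less_mult_pos mult_pos_pos)
qed

text \<open>If \<open>ell_d2\<close> is positive at \<open>x\<close>, it is positive nearby and
  \<open>x\<close> is no maximizer. If it is 0, then \<open>K * star_weight p x = 1\<close>. Were
  \<open>x\<close> not the peak of \<open>star_weight\<close>, the weight would be larger on the
  side facing the peak, so \<open>ell\<close> would be strictly convex next to \<open>x\<close>,
  again impossible. At the peak, \<open>K * star_weight p x = 1\<close> determines
  \<open>b2\<close>, and \<open>ell_d1 = 0\<close> then determines \<open>b1\<close>.\<close>

lemma maximizer_degenerate:
  assumes p: "p \<ge> 2" and x: "x \<in> maximizers p b1 b2" and d2: "ell_d2 p b2 x \<ge> 0"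
  shows "x = (real p - 1) / real p" "b1 = crit1 p" "b2 = crit2 p"
proof -
  note x01 = maximizers_interior[OF p x]
  have "\<not> ell_d2 p b2 x > 0"
  proof
    assume "ell_d2 p b2 x > 0"
    then have "\<forall>\<^sub>F t in at x. ell_d2 p b2 t > 0"
      using isCont_ell_d2[OF p x01] by (intro order_tendstoD(1)) (auto simp: isCont_def)
    then obtain d where d: "d > 0" "\<And>t. t \<noteq> x \<Longrightarrow> dist t x < d \<Longrightarrow> ell_d2 p b2 t > 0"
      unfolding eventually_at by blast
    define y where "y = x + min d (1 - x) / 2"
    have y: "x < y" "y < 1" "y \<le> x + d"
      using d(1) x01 by (auto simp: y_def min_def field_simps)
    show False
      by (rule maximizer_not_convex_right[OF p x y(1,2)]) (use y d in \<open>auto simp: dist_real_def\<close>)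
  qed
  then have d0: "ell_d2 p b2 x = 0" using d2 by simp
  define K where "K = b2 * (real p * (real p - 1))"
  have K1: "K * star_weight p x = 1" using ell_d2_weight[OF p x01, of b2] d0 by (simp add: K_def)
  moreover have "star_weight p x > 0" using x01 by (simp add: star_weight_def[OF p])
  ultimately have K: "K > 0" by (metis zero_less_mult_pos2 zero_less_one)
  note xc = xc[OF p]
  define m where "m = (real p - 1) / real p"
  have pos: "ell_d2 p b2 z > 0" if "0 < z" "z < 1" "star_weight p x < star_weight p z" for z
  proof -
    have "K * star_weight p x < K * star_weight p z" using K that(3) by simp
    then show ?thesis using K1 unfolding ell_d2_pos_iff[OF p that(1,2)] K_def by linarith
  qed
  show xm: "x = (real p - 1) / real p"
  proof (rule ccontr)
    assume "\<not> ?thesis"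
    then consider "x < m" | "m < x" by (fastforce simp: m_def)
    then show False
    proof cases
      case 1
      show False
        by (rule maximizer_not_convex_right[OF p x 1])
          (use 1 x01 xc in \<open>auto simp: m_def intro!: pos star_weight_incr[OF p]\<close>)
    next
      case 2
      show False
        by (rule maximizer_not_convex_left[OF p x 2])
          (use 2 x01 xc in \<open>auto simp: m_def intro!: pos star_weight_decr[OF p]\<close>)
    qed
  qed
  have p0: "real p > 0" "real p - 1 > 0" using p by auto
  have sw: "star_weight p x = (real p - 1) ^ (p - 1) / real p ^ p"
  proof -
    have "real p ^ p = real p ^ (p - 1) * real p" using p by (simp add: power_eq_if)
    then show ?thesis unfolding star_weight_def[OF p] xm xc(3) by (simp add: power_divide)
  qed
  have pp: "real p ^ p = real p * real p ^ (p - 1)" "(real p - 1) ^ p = (real p - 1) * (real p - 1) ^ (p - 1)"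
    using p by (simp_all add: power_eq_if)
  have b2_eq: "b2 * (real p * (real p - 1)) * ((real p - 1) ^ (p - 1) / (real p * real p ^ (p - 1))) = 1"
    using K1 unfolding K_def sw pp(1) .
  \<comment> \<open>\<open>A\<close> and \<open>B\<close> stand for \<open>p ^ (p - 1)\<close> and
    \<open>(p - 1) ^ (p - 1)\<close>, so that the equation is solved for \<open>b2\<close> with the
    powers treated as atoms.\<close>
  have gen: "b = A / (Q * B)" if "b * (P * Q) * (B / (P * A)) = 1" "P > 0" "Q > 0" "A > 0" "B > 0"
    for b P Q A B :: real
  proof -
    have "b * (P * Q) * (B / (P * A)) = b * (Q * B) / A" using that(2-) by simp
    then have "b * (Q * B) = A" using that by simp
    then show ?thesis using that(2-) by (simp add: eq_divide_eq)
  qed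
  show b2: "b2 = crit2 p"
    unfolding crit2_def pp(2) by (rule gen[OF b2_eq]) (use p0 in simp_all)
  have "ell_d1 p b1 b2 x = 0" by (rule maximizers_ell_d1[OF p x])
  moreover have "b2 * (real p * x ^ (p - 1)) = real p / (real p - 1)"
  proof -
    have gen: "A / (Q * B) * (P * (B / A)) = P / Q" if "A > 0" "B > 0" for P Q A B :: real
      using that by simp
    show ?thesis
      unfolding b2 xm crit2_def pp(2) power_divide by (rule gen) (use p0 in simp_all)
  qed
  moreover have "ln x - ln (1 - x) = ln (real p - 1)"
    unfolding xm xc(3) using p0 by (simp add: ln_divide_pos)
  ultimately show "b1 = crit1 p" unfolding ell_d1_def[OF p] crit1_def by simp
qed

section \<open>Order of decay at a maximizer\<close>

text \<open>L'Hopital's rule, twice: differentiating \<open>(t - x) ^ m\<close> two times yields the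
  factor \<open>m * (m - 1)\<close> that appears in the hypothesis. Keeping \<open>m\<close> general
  serves both the quadratic and the quartic case.\<close>

lemma ell_expansion:
  assumes p: "p \<ge> 2" and x: "0 < x" "x < 1" and d1: "ell_d1 p b1 b2 x = 0" and m: "m \<ge> 2"
    and lim: "((\<lambda>t. ell_d2 p b2 t / (t - x) ^ (m - 2)) \<longlongrightarrow> - (c * real m * real (m - 1))) (at x)"
  shows "((\<lambda>t. (ell p b1 b2 x - ell p b1 b2 t) / (t - x) ^ m) \<longlongrightarrow> c) (at x)"
proof -
  have ev: "\<forall>\<^sub>F t in at x. 0 < t \<and> t < 1"
    using eventually_at_in_open'[of "{0<..<1}" x] x by simp
  have nz: "\<forall>\<^sub>F t in at x. (t - x) ^ k \<noteq> 0" for k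
    using eventually_neq_at_within[of x x UNIV] by eventually_elim simp
  have d1_lim: "(ell_d1 p b1 b2 \<longlongrightarrow> 0) (at x)"
    using DERIV_isCont[OF ell_d1_deriv[OF p x, of b1 b2]] d1 by (simp add: isCont_def)
  have pow0: "((\<lambda>t. (t - x) ^ k) \<longlongrightarrow> 0) (at x)" if "k > 0" for k
    using that by (auto intro!: tendsto_eq_intros)
  have dpow: "((\<lambda>t. (t - x) ^ k) has_real_derivative real k * (t - x) ^ (k - 1)) (at t)" for k t
    by (auto intro!: derivative_eq_intros)
  have div: "a / (b * z) = a / z / b" for a b z :: real by simp
  have "((\<lambda>t. ell_d1 p b1 b2 t / (t - x) ^ (m - 1)) \<longlongrightarrow> - (c * m)) (at x)"
  proof (rule lhopital[OF d1_lim pow0 nz _ _ always_eventually[OF allI[OF dpow]]])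
    show "\<forall>\<^sub>F t in at x. real (m - 1) * (t - x) ^ (m - 1 - 1) \<noteq> 0"
      using nz[of "m - 1 - 1"] by eventually_elim (use m in auto)
    show "\<forall>\<^sub>F t in at x. (ell_d1 p b1 b2 has_real_derivative ell_d2 p b2 t) (at t)"
      using ev by eventually_elim (simp add: ell_d1_deriv[OF p])
    have L: "((\<lambda>t. ell_d2 p b2 t / (t - x) ^ (m - 2) / real (m - 1)) \<longlongrightarrow> - (c * real m * real (m - 1)) / real (m - 1)) (at x)"
      using m by (intro tendsto_divide lim tendsto_const) auto
    have 1: "- (c * real m * real (m - 1)) / real (m - 1) = - (c * m)" using m by simp
    have 2: "m - 1 - 1 = m - 2" by simp
    show "((\<lambda>t. ell_d2 p b2 t / (real (m - 1) * (t - x) ^ (m - 1 - 1))) \<longlongrightarrow> - (c * m)) (at x)"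
      unfolding div 2 using L unfolding 1 .
  qed (use m in auto)
  then have "((\<lambda>t. - (ell_d1 p b1 b2 t / (t - x) ^ (m - 1) / real m)) \<longlongrightarrow> - (- (c * m) / real m)) (at x)"
    using m by (intro tendsto_minus tendsto_divide tendsto_const) auto
  moreover have "- (- (c * m) / real m) = c" using m by simp
  moreover have "- (ell_d1 p b1 b2 t / (t - x) ^ (m - 1) / real m) = (0 - ell_d1 p b1 b2 t) / (real m * (t - x) ^ (m - 1))" for t
    unfolding div by simp
  ultimately have lim1: "((\<lambda>t. (0 - ell_d1 p b1 b2 t) / (real m * (t - x) ^ (m - 1))) \<longlongrightarrow> c) (at x)"
    by (simp only:)
  show ?thesis
  proof (rule lhopital[OF _ pow0 nz _ _ always_eventually[OF allI[OF dpow]] lim1])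
    have "(ell p b1 b2 \<longlongrightarrow> ell p b1 b2 x) (at x)"
      using DERIV_isCont[OF ell_deriv[OF p x]] by (simp add: isCont_def)
    then show "((\<lambda>t. ell p b1 b2 x - ell p b1 b2 t) \<longlongrightarrow> 0) (at x)"
      by (auto intro!: tendsto_eq_intros)
    show "\<forall>\<^sub>F t in at x. real m * (t - x) ^ (m - 1) \<noteq> 0"
      using nz[of "m - 1"] by eventually_elim (use m in auto)
    show "\<forall>\<^sub>F t in at x. ((\<lambda>t. ell p b1 b2 x - ell p b1 b2 t) has_real_derivative 0 - ell_d1 p b1 b2 t) (at t)"
      using ev by eventually_elim (intro DERIV_diff DERIV_const ell_deriv[OF p]; simp)
  qed (use m in auto)
qed

text \<open>At the critical \<open>b2\<close> the weight satisfies
  \<open>K * star_weight p x = 1\<close> at its peak \<open>x\<close>, so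
  \<open>t * (1 - t) * ell_d2\<close> vanishes there to second order. One use of L'Hopital's rule
  suffices, as the derivative of \<open>star_weight\<close> is
  \<open>- p * t ^ (p - 2) * (t - x)\<close>. The constant comes from
  \<open>K * x ^ (p - 2) = 1 / (x * (1 - x))\<close> and
  \<open>x * (1 - x) = (p - 1) / p ^ 2\<close>.\<close>

lemma ell_d2_critical:
  fixes p :: nat
  assumes p: "p \<ge> 2"
  defines "x \<equiv> (real p - 1) / real p"
  shows "ell_d2 p (crit2 p) x = 0"
    and "((\<lambda>t. ell_d2 p (crit2 p) t / (t - x) ^ 2) \<longlongrightarrow> - (real p ^ 5 / (2 * (real p - 1) ^ 2))) (at x)"
proof -
  have x: "0 < x" "x < 1" and x1: "1 - x = 1 / real p" unfolding x_def by (rule xc[OF p])+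
  define K where "K = crit2 p * (real p * (real p - 1))"
  have p0: "real p > 0" "real p - 1 > 0" using p by auto
  obtain k where k: "p = Suc (Suc k)" using p by (cases p; cases "p - 1") auto
  have pp: "z ^ p = z * z ^ (p - 1)" "x ^ (p - 1) = x * x ^ (p - 2)" for z :: real
    by (simp_all add: k)
  have K1: "K * star_weight p x = 1"
  proof -
    have gen: "A / (Q * B) * (P * Q) * (B / A * (1 / P)) = 1" if "P > 0" "Q > 0" "A > 0" "B > 0" for P Q A B :: real
      using that by simp
    show ?thesis
      unfolding K_def star_weight_def[OF p] x1 unfolding crit2_def x_def pp(1)[of "real p - 1"] power_divide
      by (rule gen) (use p0 in simp_all)
  qed
  have "x * (1 - x) * ell_d2 p (crit2 p) x = 0" unfolding ell_d2_weight[OF p x] K_def[symmetric] K1 by simp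
  then show "ell_d2 p (crit2 p) x = 0" using x by simp
  have ev: "\<forall>\<^sub>F t in at x. 0 < t \<and> t < 1 \<and> t \<noteq> x"
  proof -
    have "\<forall>\<^sub>F t in at x. t \<in> {0<..<1}" using x by (intro eventually_at_in_open') auto
    then show ?thesis using eventually_neq_at_within[of x x UNIV] by eventually_elim simp
  qed
  have "((\<lambda>t. (K * star_weight p t - 1) / (t - x) ^ 2) \<longlongrightarrow> - (K * real p * x ^ (p - 2) / 2)) (at x)"
  proof (rule lhopital)
    have "((\<lambda>t. K * star_weight p t - 1) \<longlongrightarrow> K * star_weight p x - 1) (at x)"
      using DERIV_isCont[OF star_weight_deriv[OF p, of x]] by (intro tendsto_intros) (simp add: isCont_def)
    then show "((\<lambda>t. K * star_weight p t - 1) \<longlongrightarrow> 0) (at x)" by (simp add: K1)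
    show "((\<lambda>t. (t - x) ^ 2) \<longlongrightarrow> 0) (at x)" by (auto intro!: tendsto_eq_intros)
    show "\<forall>\<^sub>F t in at x. (t - x) ^ 2 \<noteq> 0" using ev by eventually_elim simp
    show "\<forall>\<^sub>F t in at x. 2 * (t - x) \<noteq> 0" using ev by eventually_elim simp
    show "\<forall>\<^sub>F t in at x. ((\<lambda>t. K * star_weight p t - 1) has_real_derivative K * (t ^ (p - 2) * (real p - 1 - real p * t)) - 0) (at t)"
      by (intro always_eventually allI DERIV_diff DERIV_cmult star_weight_deriv[OF p] DERIV_const)
    show "\<forall>\<^sub>F t in at x. ((\<lambda>t. (t - x) ^ 2) has_real_derivative 2 * (t - x)) (at t)"
      by (intro always_eventually allI) (auto intro!: derivative_eq_intros)
    have "((\<lambda>t. - (K * real p * t ^ (p - 2) / 2)) \<longlongrightarrow> - (K * real p * x ^ (p - 2) / 2)) (at x)"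
      by (intro tendsto_intros) simp
    then show "((\<lambda>t. (K * (t ^ (p - 2) * (real p - 1 - real p * t)) - 0) / (2 * (t - x))) \<longlongrightarrow> - (K * real p * x ^ (p - 2) / 2)) (at x)"
    proof (rule Lim_transform_eventually)
      show "\<forall>\<^sub>F t in at x. - (K * real p * t ^ (p - 2) / 2) = (K * (t ^ (p - 2) * (real p - 1 - real p * t)) - 0) / (2 * (t - x))"
        using ev
      proof eventually_elim
        case (elim t)
        have 1: "real p - 1 - real p * t = - (real p * (t - x))" using p0 by (simp add: x_def field_simps)
        have 2: "K * (a * - (P * d)) / (2 * d) = - (K * P * a / 2)" if "d \<noteq> 0" for a d P :: real
          using that by simp
        show ?case unfolding 1 diff_zero using elim by (subst 2) auto
      qed
    qed
  qed
  then have lim: "((\<lambda>t. (K * star_weight p t - 1) / (t - x) ^ 2 / (t * (1 - t))) \<longlongrightarrow> - (K * real p * x ^ (p - 2) / 2) / (x * (1 - x))) (at x)"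
    using x by (intro tendsto_intros) auto
  have eq: "- (K * real p * x ^ (p - 2) / 2) / (x * (1 - x)) = - (real p ^ 5 / (2 * (real p - 1) ^ 2))"
  proof -
    have "K * (x * x ^ (p - 2) * (1 - x)) = 1" using K1 unfolding star_weight_def[OF p] pp(2) .
    then have "K * x ^ (p - 2) = 1 / (x * (1 - x))" using x by (subst eq_divide_eq) (simp add: mult_ac)
    moreover have "- (K * P * z / 2) / u = - (P / (2 * u ^ 2))" if "K * z = 1 / u" for P z u :: real
    proof -
      have "- (K * P * z / 2) / u = - (P * (K * z) / 2) / u" by simp
      then show ?thesis unfolding that by (simp add: power2_eq_square)
    qed
    ultimately have "- (K * real p * x ^ (p - 2) / 2) / (x * (1 - x)) = - (real p / (2 * (x * (1 - x)) ^ 2))" by blast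
    also have "\<dots> = - (real p / (2 * ((real p - 1) / real p ^ 2) ^ 2))"
      unfolding x1 by (simp add: x_def power2_eq_square)
    also have "- (real p / (2 * ((real p - 1) / real p ^ 2) ^ 2)) = - (real p ^ 5 / (2 * (real p - 1) ^ 2))"
    proof -
      have "P / (2 * (Q / P ^ 2) ^ 2) = P ^ 5 / (2 * Q ^ 2)" if "P > 0" "Q > 0" for P Q :: real
        using that by (simp add: power_divide eval_nat_numeral)
      then show ?thesis using p0 by simp
    qed
    finally show ?thesis .
  qed
  have ev2: "\<forall>\<^sub>F t in at x. (K * star_weight p t - 1) / (t - x) ^ 2 / (t * (1 - t)) = ell_d2 p (crit2 p) t / (t - x) ^ 2"
    using ev
  proof eventually_elim
    case (elim t)
    then have "K * star_weight p t - 1 = t * (1 - t) * ell_d2 p (crit2 p) t"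
      using ell_d2_weight[OF p, of t "crit2 p"] by (simp add: K_def)
    then show ?case using elim by simp
  qed
  from Lim_transform_eventually[OF lim ev2] show "((\<lambda>t. ell_d2 p (crit2 p) t / (t - x) ^ 2) \<longlongrightarrow> - (real p ^ 5 / (2 * (real p - 1) ^ 2))) (at x)"
    unfolding eq .
qed

section \<open>Concentration at the maximizers\<close>

text \<open>The points at distance at least \<open>\<delta>\<close> from all maximizers form a
  compact set; if it is nonempty, \<open>ell\<close> attains on it a largest value, which is below
  the global maximum.\<close>

lemma gap_away_from_maximizers:
  assumes x: "x \<in> maximizers p b1 b2" and \<delta>: "\<delta> > 0"
  shows "\<exists>\<gamma>>0. \<forall>t. 0 \<le> t \<and> t \<le> 1 \<and> (\<forall>x'\<in>maximizers p b1 b2. \<delta> \<le> \<bar>t - x'\<bar>) \<longrightarrow>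
    ell p b1 b2 t \<le> ell p b1 b2 x - \<gamma>"
proof -
  define T where "T = {0..1} \<inter> (\<Inter>x'\<in>maximizers p b1 b2. {t. \<delta> \<le> \<bar>t - x'\<bar>})"
  have "closed (\<Inter>x'\<in>maximizers p b1 b2. {t. \<delta> \<le> \<bar>t - x'\<bar>})"
    by (intro closed_INT ballI closed_Collect_le continuous_intros)
  then have T: "compact T" unfolding T_def by (rule compact_Int_closed[OF compact_Icc])
  show ?thesis
  proof (cases "T = {}")
    case True
    then show ?thesis by (intro exI[of _ 1]) (auto simp: T_def)
  next
    case False
    have "continuous_on T (ell p b1 b2)"
      using continuous_on_ell by (rule continuous_on_subset) (auto simp: T_def)
    then obtain t0 where t0: "t0 \<in> T" "\<And>t. t \<in> T \<Longrightarrow> ell p b1 b2 t \<le> ell p b1 b2 t0"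
      using continuous_attains_sup[OF T False] by blast
    have "t0 \<notin> maximizers p b1 b2" using t0(1) \<delta> by (auto simp: T_def)
    moreover have "ell p b1 b2 t0 \<le> ell p b1 b2 x" using t0(1) x by (auto simp: T_def maximizers_iff)
    ultimately have "ell p b1 b2 t0 < ell p b1 b2 x"
      using t0(1) x by (force simp: T_def maximizers_iff)
    then show ?thesis
      using t0(2) by (intro exI[of _ "ell p b1 b2 x - ell p b1 b2 t0"]) (auto simp: T_def)
  qed
qed

lemma binomial_exp_eq_modal_prob:
  assumes n: "n > 0" and k: "k \<le> n"
  shows "real (n choose k) * exp (real n * (b1 * (real k / n) + b2 * (real k / n) ^ p)) =
    modal_prob n k * exp (real n * ell p b1 b2 (real k / n))"
proof -
  define t where "t = real k / n"
  \<comment> \<open>The alternative \<open>i = 0\<close> covers the endpoints \<open>k = 0\<close>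
    and \<open>k = n\<close>, where one base is 0 and \<open>0 ^ 0 = 1\<close>.\<close>
  have power_self: "z ^ i * exp (- (real i * ln z)) = 1" if "z > 0 \<or> i = 0" for z :: real and i
    using that by (auto simp: exp_minus exp_of_nat_mult)
  have nt: "real n * t = real k" "real n * (1 - t) = real (n - k)"
    using n k by (simp_all add: t_def right_diff_distrib)
  have pos: "t > 0 \<or> k = 0" "1 - t > 0 \<or> n - k = 0" using n k by (auto simp: t_def)
  have "real n * ell p b1 b2 t =
      real n * (b1 * t + b2 * t ^ p) - (real n * t) * ln t - (real n * (1 - t)) * ln (1 - t)"
    by (simp add: ell_def algebra_simps)
  then have "exp (real n * ell p b1 b2 t) = exp (real n * (b1 * t + b2 * t ^ p)) *
      (exp (- (real k * ln t)) * exp (- (real (n - k) * ln (1 - t))))"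
    unfolding nt by (simp add: exp_add[symmetric])
  then have "modal_prob n k * exp (real n * ell p b1 b2 t) = real (n choose k) * exp (real n * (b1 * t + b2 * t ^ p)) *
      ((t ^ k * exp (- (real k * ln t))) * ((1 - t) ^ (n - k) * exp (- (real (n - k) * ln (1 - t)))))"
    unfolding modal_prob_def t_def[symmetric] by simp
  also have "\<dots> = real (n choose k) * exp (real n * (b1 * t + b2 * t ^ p))"
    unfolding power_self[OF pos(1)] power_self[OF pos(2)] by simp
  finally show ?thesis unfolding t_def ..
qed

lemma row_moment_eq_modal_prob:
  assumes n: "n > 0"
  shows "row_moment p n b1 b2 f = exp (real n * M) *
    (\<Sum>k\<le>n. modal_prob n k * exp (real n * (ell p b1 b2 (real k / n) - M)) * f (real k / n))"
proof -
  have "real (n choose k) * exp (real n * (b1 * (real k / n) + b2 * (real k / n) ^ p)) * f (real k / n) =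
    exp (real n * M) * (modal_prob n k * exp (real n * (ell p b1 b2 (real k / n) - M)) * f (real k / n))" if "k \<le> n" for k
    unfolding binomial_exp_eq_modal_prob[OF n that] by (simp add: exp_diff right_diff_distrib)
  then show ?thesis unfolding row_moment_def sum_distrib_left by (intro sum.cong) auto
qed

text \<open>By Stirling's formula this is \<open>1 / sqrt (2 * pi)\<close>. Naming it once makes
  visible that it cancels between moments and between maximizers.\<close>

definition modal_const :: real where
  "modal_const = (SOME C. C > 0 \<and> (\<forall>x \<kappa>. 0 < x \<and> x < 1 \<and> (\<lambda>n. real (\<kappa> n) / real n) \<longlonglongrightarrow> x \<longrightarrow>
     (\<lambda>n. sqrt n * modal_prob n (\<kappa> n)) \<longlonglongrightarrow> C / sqrt (x * (1 - x))))"

lemma modal_const: "modal_const > 0"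
  "0 < x \<Longrightarrow> x < 1 \<Longrightarrow> (\<lambda>n. real (\<kappa> n) / real n) \<longlonglongrightarrow> x \<Longrightarrow>
    (\<lambda>n. sqrt n * modal_prob n (\<kappa> n)) \<longlonglongrightarrow> modal_const / sqrt (x * (1 - x))"
  using someI_ex[OF modal_prob_asymp] unfolding modal_const_def[symmetric] by blast+

text \<open>The share of \<open>row_moment p n b1 b2 f / exp (n * M)\<close> that comes from
  densities satisfying \<open>P\<close>. In all uses \<open>M\<close> is the maximum of
  \<open>ell\<close>, which makes the exponents nonpositive.\<close>

definition gibbs_window :: "nat \<Rightarrow> real \<Rightarrow> real \<Rightarrow> real \<Rightarrow> (real \<Rightarrow> bool) \<Rightarrow> (real \<Rightarrow> real) \<Rightarrow> nat \<Rightarrow> real" where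
  "gibbs_window p b1 b2 M P f n = (\<Sum>k | k \<le> n \<and> P (real k / n).
     modal_prob n k * exp (real n * (ell p b1 b2 (real k / n) - M)) * f (real k / n))"

text \<open>Writes \<open>ell\<close> near \<open>x\<close> as its maximum minus
  \<open>(t - x) ^ m * \<eta> t\<close>, where \<open>\<eta>\<close> is made continuous by the value
  \<open>c\<close> at \<open>x\<close>, and applies \<open>laplace_sum\<close>. The limit is the
  same for every small window, so that two maximizers can later share one
  \<open>\<epsilon>\<close>.\<close>

lemma gibbs_window_tendsto:
  assumes p: "p \<ge> 2" and x: "x \<in> maximizers p b1 b2" and m: "even m" "m \<ge> 2" and c: "c > 0"
    and lim: "((\<lambda>t. (ell p b1 b2 x - ell p b1 b2 t) / (t - x) ^ m) \<longlongrightarrow> c) (at x)"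
    and \<psi>: "isCont \<psi> x"
  shows "\<exists>\<epsilon>\<^sub>0>0. \<forall>\<epsilon>. 0 < \<epsilon> \<and> \<epsilon> < \<epsilon>\<^sub>0 \<longrightarrow>
    (\<lambda>n. (real n powr (1 / m)) ^ (j + 1) / sqrt n *
      gibbs_window p b1 b2 (ell p b1 b2 x) (\<lambda>t. \<bar>t - x\<bar> < \<epsilon>) (\<lambda>t. (t - x) ^ j * \<psi> t) n)
    \<longlonglongrightarrow> modal_const / sqrt (x * (1 - x)) * \<psi> x * (\<integral>y. y ^ j * exp (- (c * y ^ m)) \<partial>lborel)"
proof -
  note x01 = maximizers_interior[OF p x]
  define \<eta> where "\<eta> t = (if t = x then c else (ell p b1 b2 x - ell p b1 b2 t) / (t - x) ^ m)" for t
  have \<eta>x: "\<eta> x = c" by (simp add: \<eta>_def)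
  have "(\<eta> \<longlongrightarrow> c) (at x)"
    using lim by (rule Lim_transform_eventually) (auto simp: \<eta>_def eventually_at_filter)
  then have \<eta>: "isCont \<eta> x" unfolding isCont_def \<eta>x .
  have \<eta>_eq: "n * (ell p b1 b2 t - ell p b1 b2 x) = - (n * ((t - x) ^ m * \<eta> t))" for n t
  proof (cases "t = x")
    case False
    then have "(t - x) ^ m \<noteq> 0" by simp
    then have "(t - x) ^ m * \<eta> t = ell p b1 b2 x - ell p b1 b2 t" using False by (simp add: \<eta>_def)
    then show ?thesis by (simp add: right_diff_distrib)
  qed (use m in simp)
  \<comment> \<open>With \<open>2 * a\<close> at most the distance of \<open>x\<close> to either
    endpoint, every \<open>t\<close> within \<open>a\<close> of \<open>x\<close> stays at least
    \<open>a\<close> away from 0 and 1, as the Stirling bound requires.\<close>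
  define a where "a = min x (1 - x) / 2"
  have a: "a > 0" "2 * a \<le> x" "2 * a \<le> 1 - x" using x01 by (auto simp: a_def)
  obtain D where D: "\<And>n k. n > 0 \<Longrightarrow> a \<le> real k / n \<Longrightarrow> a \<le> 1 - real k / n \<Longrightarrow> sqrt n * modal_prob n k \<le> D"
    using modal_prob_bound[OF a(1)] by blast
  have "(\<eta> \<longlongrightarrow> \<eta> x) (nhds x)" "(\<psi> \<longlongrightarrow> \<psi> x) (nhds x)"
    using \<eta> \<psi> by (simp_all add: isCont_def tendsto_at_iff_tendsto_nhds)
  from order_tendstoD(1)[OF this(1), of "c / 2"] tendstoD[OF this(2), of 1]
  have "\<forall>\<^sub>F t in nhds x. c / 2 < \<eta> t" "\<forall>\<^sub>F t in nhds x. dist (\<psi> t) (\<psi> x) < 1"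
    using c \<eta>x by simp_all
  then have "\<forall>\<^sub>F t in nhds x. c / 2 < \<eta> t \<and> dist (\<psi> t) (\<psi> x) < 1" by (rule eventually_conj)
  then obtain d where d: "d > 0" "\<And>t. dist t x < d \<Longrightarrow> c / 2 < \<eta> t \<and> dist (\<psi> t) (\<psi> x) < 1"
    unfolding eventually_nhds_metric by blast
  have "(\<lambda>n. (real n powr (1 / m)) ^ (j + 1) / sqrt n *
      gibbs_window p b1 b2 (ell p b1 b2 x) (\<lambda>t. \<bar>t - x\<bar> < \<epsilon>) (\<lambda>t. (t - x) ^ j * \<psi> t) n)
    \<longlonglongrightarrow> modal_const / sqrt (x * (1 - x)) * \<psi> x * (\<integral>y. y ^ j * exp (- (c * y ^ m)) \<partial>lborel)"
    if \<epsilon>: "0 < \<epsilon>" "\<epsilon> < min a d" for \<epsilon>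
    unfolding gibbs_window_def \<eta>_eq
  proof (rule laplace_sum[where D = D and \<Psi> = "\<bar>\<psi> x\<bar> + 1"])
    fix n k :: nat assume "n > 0" "\<bar>real k / n - x\<bar> < \<epsilon>"
    then show "sqrt n * modal_prob n k \<le> D" using a \<epsilon> by (intro D) auto
  next
    fix \<kappa> :: "nat \<Rightarrow> nat" assume "(\<lambda>n. real (\<kappa> n) / n) \<longlonglongrightarrow> x"
    then show "(\<lambda>n. sqrt n * modal_prob n (\<kappa> n)) \<longlonglongrightarrow> modal_const / sqrt (x * (1 - x))"
      by (rule modal_const(2)[OF x01])
  next
    fix t assume "\<bar>t - x\<bar> < \<epsilon>"
    then have "dist t x < d" using \<epsilon> by (simp add: dist_real_def)
    from d(2)[OF this] show "c / 2 \<le> \<eta> t" "\<bar>\<psi> t\<bar> \<le> \<bar>\<psi> x\<bar> + 1" by (auto simp: dist_real_def)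
  qed (use m \<epsilon> a c \<eta> \<eta>x \<psi> modal_prob_nonneg in auto)
  then show ?thesis using a d by (intro exI[of _ "min a d"]) auto
qed

text \<open>There are at most \<open>n + 1\<close> terms, each of size at most
  \<open>exp (- \<gamma> * n) * F\<close>, which beats every power \<open>n ^ r\<close>. The free
  exponent \<open>r\<close> absorbs whatever normalization the windows near the maximizers
  use.\<close>

lemma gibbs_window_far:
  assumes x: "x \<in> maximizers p b1 b2" and \<epsilon>: "\<epsilon> > 0" and F: "\<And>t. 0 \<le> t \<Longrightarrow> t \<le> 1 \<Longrightarrow> \<bar>f t\<bar> \<le> F"
  shows "(\<lambda>n. real n ^ r * gibbs_window p b1 b2 (ell p b1 b2 x)
    (\<lambda>t. \<forall>x'\<in>maximizers p b1 b2. \<epsilon> \<le> \<bar>t - x'\<bar>) f n) \<longlonglongrightarrow> 0"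
proof -
  obtain \<gamma> where \<gamma>: "\<gamma> > 0" "\<And>t. 0 \<le> t \<Longrightarrow> t \<le> 1 \<Longrightarrow> \<forall>x'\<in>maximizers p b1 b2. \<epsilon> \<le> \<bar>t - x'\<bar> \<Longrightarrow>
    ell p b1 b2 t \<le> ell p b1 b2 x - \<gamma>"
    using gap_away_from_maximizers[OF x \<epsilon>] by blast
  have F0: "F \<ge> 0" using F[of 0] by simp
  let ?P = "\<lambda>t. \<forall>x'\<in>maximizers p b1 b2. \<epsilon> \<le> \<bar>t - x'\<bar>"
  let ?W = "\<lambda>n. gibbs_window p b1 b2 (ell p b1 b2 x) ?P f n"
  have bound: "\<bar>?W n\<bar> \<le> (real n + 1) * (exp (- (\<gamma> * n)) * F)" if n: "n > 0" for n
  proof -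
    have "\<bar>?W n\<bar> \<le> (\<Sum>k | k \<le> n \<and> ?P (real k / n). exp (- (\<gamma> * n)) * F)"
      unfolding gibbs_window_def
    proof (rule order_trans[OF sum_abs sum_mono])
      fix k assume k: "k \<in> {k. k \<le> n \<and> ?P (real k / n)}"
      define t where "t = real k / n"
      have t: "0 \<le> t" "t \<le> 1" "?P t" using k n by (auto simp: t_def)
      have "real n * (ell p b1 b2 t - ell p b1 b2 x) \<le> real n * (- \<gamma>)"
        using \<gamma>(2)[OF t] by (intro mult_left_mono) auto
      then have e: "exp (real n * (ell p b1 b2 t - ell p b1 b2 x)) \<le> exp (- (\<gamma> * n))" by (simp add: mult.commute)
      have "\<bar>modal_prob n k * exp (real n * (ell p b1 b2 t - ell p b1 b2 x)) * f t\<bar> =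
          modal_prob n k * exp (real n * (ell p b1 b2 t - ell p b1 b2 x)) * \<bar>f t\<bar>"
        using modal_prob_nonneg[of k n] k by (simp add: abs_mult)
      also have "\<dots> \<le> 1 * exp (- (\<gamma> * n)) * F"
        using modal_prob_nonneg[of k n] modal_prob_le_1[of k n] k e F[OF t(1,2)] by (intro mult_mono mult_nonneg_nonneg) auto
      finally show "\<bar>modal_prob n k * exp (real n * (ell p b1 b2 (real k / n) - ell p b1 b2 x)) * f (real k / n)\<bar>
          \<le> exp (- (\<gamma> * n)) * F" by (simp add: t_def)
    qed
    also have "\<dots> \<le> (\<Sum>k\<le>n. exp (- (\<gamma> * n)) * F)"
      using F0 by (intro sum_mono2) auto
    finally show ?thesis by (simp add: add.commute)
  qed
  \<comment> \<open>The 2 comes from \<open>n + 1 <= 2 * n\<close>; the powers of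
    \<open>\<gamma>\<close> rewrite the bound in the variable \<open>\<gamma> * n\<close>, to which
    the limit of \<open>y ^ k / exp y\<close> applies.\<close>
  have lim: "(\<lambda>n. 2 * F / \<gamma> ^ (r + 1) * ((\<gamma> * real n) ^ (r + 1) / exp (\<gamma> * real n))) \<longlonglongrightarrow> 2 * F / \<gamma> ^ (r + 1) * 0"
    by (intro tendsto_mult_left filterlim_compose[OF tendsto_power_div_exp_0]
        filterlim_tendsto_pos_mult_at_top[OF tendsto_const \<gamma>(1) filterlim_real_sequentially])
  show ?thesis
  proof (rule tendsto_rabs_zero_cancel, rule tendsto_sandwich[OF _ _ tendsto_const])
    show "(\<lambda>n. 2 * F / \<gamma> ^ (r + 1) * ((\<gamma> * real n) ^ (r + 1) / exp (\<gamma> * real n))) \<longlonglongrightarrow> 0"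
      using lim by simp
    show "\<forall>\<^sub>F n in sequentially. \<bar>real n ^ r * ?W n\<bar> \<le> 2 * F / \<gamma> ^ (r + 1) * ((\<gamma> * real n) ^ (r + 1) / exp (\<gamma> * real n))"
      using eventually_gt_at_top[of 0]
    proof eventually_elim
      case (elim n)
      have "\<bar>real n ^ r * ?W n\<bar> = real n ^ r * \<bar>?W n\<bar>" by (simp add: abs_mult)
      also have "\<dots> \<le> real n ^ r * ((real n + 1) * (exp (- (\<gamma> * n)) * F))"
        using bound[OF elim] by (intro mult_left_mono) auto
      also have "\<dots> \<le> real n ^ r * ((2 * real n) * (exp (- (\<gamma> * n)) * F))"
        using elim F0 by (intro mult_left_mono mult_right_mono) auto
      also have "\<dots> = 2 * F / \<gamma> ^ (r + 1) * ((\<gamma> * real n) ^ (r + 1) / exp (\<gamma> * real n))"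
      proof -
        have gen: "N * ((2 * n') * (e * F)) = 2 * F / g * ((g * (N * n')) * e)" if "g \<noteq> 0" for N n' e g :: real
          using that by simp
        have "(\<gamma> * real n) ^ (r + 1) / exp (\<gamma> * real n) = (\<gamma> ^ (r + 1) * (real n ^ r * real n)) * exp (- (\<gamma> * n))"
          by (simp add: exp_minus power_mult_distrib divide_inverse)
        then show ?thesis using gen[of "\<gamma> ^ (r + 1)"] \<gamma>(1) by simp
      qed
      finally show ?case .
    qed
  qed auto
qed

text \<open>The sum over all \<open>k\<close> splits into the window around the only maximizer,
  which gives the limit, and the rest, which is negligible.\<close>

lemma row_moment_single:
  assumes p: "p \<ge> 2" and x: "maximizers p b1 b2 = {x}" and m: "even m" "m \<ge> 2" and c: "c > 0"
    and lim: "((\<lambda>t. (ell p b1 b2 x - ell p b1 b2 t) / (t - x) ^ m) \<longlongrightarrow> c) (at x)"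
    and \<psi>: "continuous_on UNIV \<psi>"
  shows "(\<lambda>n. (real n powr (1 / m)) ^ (j + 1) / sqrt n *
      (row_moment p n b1 b2 (\<lambda>t. (t - x) ^ j * \<psi> t) / exp (real n * ell p b1 b2 x)))
    \<longlonglongrightarrow> modal_const / sqrt (x * (1 - x)) * \<psi> x * (\<integral>y. y ^ j * exp (- (c * y ^ m)) \<partial>lborel)"
    (is "_ \<longlonglongrightarrow> ?L")
proof -
  have xm: "x \<in> maximizers p b1 b2" using x by simp
  let ?f = "\<lambda>t. (t - x) ^ j * \<psi> t"
  let ?W = "\<lambda>P n. gibbs_window p b1 b2 (ell p b1 b2 x) P ?f n"
  let ?s = "\<lambda>n. (real n powr (1 / m)) ^ (j + 1) / sqrt n"
  have "isCont \<psi> x" using \<psi> by (simp add: continuous_on_eq_continuous_at)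
  from gibbs_window_tendsto[OF p xm m c lim this]
  obtain \<epsilon>0 where \<epsilon>0: "\<epsilon>0 > 0" "\<And>\<epsilon>. 0 < \<epsilon> \<Longrightarrow> \<epsilon> < \<epsilon>0 \<Longrightarrow> (\<lambda>n. ?s n * ?W (\<lambda>t. \<bar>t - x\<bar> < \<epsilon>) n) \<longlonglongrightarrow> ?L"
    by blast
  define \<epsilon> where "\<epsilon> = \<epsilon>0 / 2"
  have \<epsilon>: "0 < \<epsilon>" "\<epsilon> < \<epsilon>0" using \<epsilon>0(1) by (auto simp: \<epsilon>_def)
  have "continuous_on {0..1} ?f" by (intro continuous_intros continuous_on_subset[OF \<psi>]) auto
  then have "bounded (?f ` {0..1})" by (intro compact_imp_bounded compact_continuous_image) auto
  then obtain F where "\<forall>t\<in>{0..1}. \<bar>?f t\<bar> \<le> F" unfolding bounded_iff by auto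
  then have F: "\<And>t. 0 \<le> t \<Longrightarrow> t \<le> 1 \<Longrightarrow> \<bar>?f t\<bar> \<le> F" by simp
  have far: "(\<lambda>n. real n ^ (j + 1) * ?W (\<lambda>t. \<epsilon> \<le> \<bar>t - x\<bar>) n) \<longlonglongrightarrow> 0"
    using gibbs_window_far[where r = "j + 1", OF xm \<epsilon>(1) F] by (simp add: x)
  \<comment> \<open>For \<open>n > 0\<close> the normalization is at most
    \<open>n ^ (j + 1)\<close>, because \<open>n powr (1 / m) <= n\<close> and
    \<open>sqrt n >= 1\<close>.\<close>
  have far': "(\<lambda>n. ?s n * ?W (\<lambda>t. \<epsilon> \<le> \<bar>t - x\<bar>) n) \<longlonglongrightarrow> 0"
  proof (rule Lim_null_comparison[OF _ tendsto_rabs_zero[OF far]])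
    show "\<forall>\<^sub>F n in sequentially. norm (?s n * ?W (\<lambda>t. \<epsilon> \<le> \<bar>t - x\<bar>) n) \<le> \<bar>real n ^ (j + 1) * ?W (\<lambda>t. \<epsilon> \<le> \<bar>t - x\<bar>) n\<bar>"
      using eventually_gt_at_top[of 0]
    proof eventually_elim
      case (elim n)
      have "real n powr (1 / m) \<le> real n powr 1" using elim m by (intro powr_mono) auto
      then have "(real n powr (1 / m)) ^ (j + 1) \<le> real n ^ (j + 1)" using elim by (intro power_mono) auto
      then have "?s n \<le> real n ^ (j + 1) / 1" using elim by (intro frac_le) auto
      then have "?s n * \<bar>?W (\<lambda>t. \<epsilon> \<le> \<bar>t - x\<bar>) n\<bar> \<le> real n ^ (j + 1) * \<bar>?W (\<lambda>t. \<epsilon> \<le> \<bar>t - x\<bar>) n\<bar>"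
        by (intro mult_right_mono) auto
      moreover have "?s n \<ge> 0" by simp
      ultimately show ?case by (simp only: real_norm_def abs_mult abs_of_nonneg zero_le_power of_nat_0_le_iff)
    qed
  qed
  have split: "?W (\<lambda>t. \<bar>t - x\<bar> < \<epsilon>) n + ?W (\<lambda>t. \<epsilon> \<le> \<bar>t - x\<bar>) n =
      row_moment p n b1 b2 ?f / exp (real n * ell p b1 b2 x)" if "n > 0" for n
  proof -
    have "?W (\<lambda>t. \<bar>t - x\<bar> < \<epsilon>) n + ?W (\<lambda>t. \<epsilon> \<le> \<bar>t - x\<bar>) n =
        (\<Sum>k\<in>{k. k \<le> n \<and> \<bar>real k / n - x\<bar> < \<epsilon>} \<union> {k. k \<le> n \<and> \<epsilon> \<le> \<bar>real k / n - x\<bar>}.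
          modal_prob n k * exp (real n * (ell p b1 b2 (real k / n) - ell p b1 b2 x)) * ?f (real k / n))"
      unfolding gibbs_window_def by (rule sum.union_disjoint[symmetric]) auto
    also have "{k. k \<le> n \<and> \<bar>real k / n - x\<bar> < \<epsilon>} \<union> {k. k \<le> n \<and> \<epsilon> \<le> \<bar>real k / n - x\<bar>} = {..n}" by auto
    finally show ?thesis unfolding row_moment_eq_modal_prob[OF that, where M = "ell p b1 b2 x"] by simp
  qed
  have "(\<lambda>n. ?s n * ?W (\<lambda>t. \<bar>t - x\<bar> < \<epsilon>) n + ?s n * ?W (\<lambda>t. \<epsilon> \<le> \<bar>t - x\<bar>) n) \<longlonglongrightarrow> ?L + 0"
    by (intro tendsto_add \<epsilon>0(2) \<epsilon> far')
  then have "(\<lambda>n. ?s n * ?W (\<lambda>t. \<bar>t - x\<bar> < \<epsilon>) n + ?s n * ?W (\<lambda>t. \<epsilon> \<le> \<bar>t - x\<bar>) n) \<longlonglongrightarrow> ?L"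
    by (simp only: add_0_right)
  then show ?thesis
  proof (rule Lim_transform_eventually)
    show "\<forall>\<^sub>F n in sequentially. ?s n * ?W (\<lambda>t. \<bar>t - x\<bar> < \<epsilon>) n + ?s n * ?W (\<lambda>t. \<epsilon> \<le> \<bar>t - x\<bar>) n =
      ?s n * (row_moment p n b1 b2 ?f / exp (real n * ell p b1 b2 x))"
      using eventually_gt_at_top[of 0] by eventually_elim (simp only: distrib_left[symmetric] split)
  qed
qed

section \<open>Limits of the variance of \<open>t ^ p\<close>\<close>

text \<open>The polynomial \<open>(t ^ p - x ^ p) / (t - x)\<close> in \<open>t\<close>, written so
  that it is continuous also at \<open>t = x\<close>, where it takes the value of the
  derivative.\<close>

definition difference_quotient :: "nat \<Rightarrow> real \<Rightarrow> real \<Rightarrow> real" where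
  "difference_quotient p x t = (\<Sum>i<p. t ^ (p - Suc i) * x ^ i)"

lemma difference_quotient: "t ^ p - x ^ p = (t - x) * difference_quotient p x t"
  using power_diff_sumr2[of x p t] by (simp add: difference_quotient_def algebra_simps)

lemma difference_quotient_self: "difference_quotient p x x = real p * x ^ (p - 1)"
proof -
  have "difference_quotient p x x = (\<Sum>i<p. x ^ (p - 1))"
    unfolding difference_quotient_def by (intro sum.cong) (auto simp: power_add[symmetric])
  then show ?thesis by simp
qed

lemma continuous_on_difference_quotient: "continuous_on A (difference_quotient p x)"
  unfolding difference_quotient_def[abs_def] by (intro continuous_intros)

text \<open>With \<open>t ^ p - x ^ p = (t - x) * d t\<close>, the rescaled moments
  \<open>a 0\<close>, \<open>a 1\<close>, \<open>a 2\<close> converge to multiples of the integrals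
  \<open>I 0\<close>, \<open>I 1\<close>, \<open>I 2\<close>. As \<open>I 1 = 0\<close> by oddness,
  the variance times \<open>s n ^ 2\<close> tends to \<open>(d x) ^ 2 * I 2 / I 0\<close>, and the
  ratio of integrals is a ratio of Gamma values. The powers of \<open>sqrt n\<close>, the
  exponentials and \<open>modal_const\<close> cancel in the quotients.\<close>

lemma variance_single:
  assumes p: "p \<ge> 2" and x: "maximizers p b1 b2 = {x}" and m: "even m" "m \<ge> 2" and c: "c > 0"
    and lim: "((\<lambda>t. (ell p b1 b2 x - ell p b1 b2 t) / (t - x) ^ m) \<longlongrightarrow> c) (at x)"
  shows "(\<lambda>n. (real n powr (1 / m))\<^sup>2 / n * (deriv ^^ 2) (\<lambda>b. psi p n b1 b) b2)
    \<longlonglongrightarrow> (real p * x ^ (p - 1))\<^sup>2 * (c powr (- (2 / m)) * Gamma (3 / m) / Gamma (1 / m))"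
proof -
  note x01 = maximizers_interior[OF p, of x b1 b2, unfolded x, simplified]
  define s where "s n = real n powr (1 / m)" for n :: nat
  define I where "I j = (\<integral>y. y ^ j * exp (- (c * y ^ m)) \<partial>lborel)" for j :: nat
  define A where "A = modal_const / sqrt (x * (1 - x))"
  define d where "d = difference_quotient p x"
  define a where "a j n = s n ^ (j + 1) / sqrt n * (row_moment p n b1 b2 (\<lambda>t. (t - x) ^ j * d t ^ j) / exp (real n * ell p b1 b2 x))" for j n
  have d: "continuous_on UNIV (\<lambda>t. d t ^ j)" for j
    unfolding d_def by (intro continuous_intros continuous_on_difference_quotient)
  have a: "(\<lambda>n. a j n) \<longlonglongrightarrow> A * d x ^ j * I j" for j
    unfolding a_def s_def A_def I_def by (rule row_moment_single[OF p x m c lim d])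
  have A: "A > 0" using x01 modal_const(1) by (simp add: A_def)
  have I: "I j = 2 / m * c powr (- (real (j + 1) / m)) * Gamma (real (j + 1) / m)" if "even j" for j
    unfolding I_def by (rule integral_power_exp_neg_power_even[OF c m that])
  have I0: "I 0 > 0" unfolding I[OF even_zero] using m c by (simp add: Gamma_real_pos)
  have I1: "I 1 = 0" unfolding I_def by (rule integral_power_exp_neg_power_odd[OF m(1)]) simp
  have Ir: "I 2 / I 0 = c powr (- (2 / m)) * Gamma (3 / m) / Gamma (1 / m)"
  proof -
    have "- (3 / real m) = - (2 / m) + - (1 / m)" using m by (simp add: field_simps)
    then have 1: "c powr - (3 / real m) = c powr - (2 / m) * c powr - (1 / m)" by (simp add: powr_add[symmetric])
    have gen: "(q * (u * v) * g3) / (q * v * g1) = u * g3 / g1" if "q > 0" "v > 0" for q u v g1 g3 :: real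
      using that by simp
    have "I 2 = 2 / m * (c powr - (2 / m) * c powr - (1 / m)) * Gamma (3 / m)" "I 0 = 2 / m * c powr - (1 / m) * Gamma (1 / m)"
      using I[of 2] I[of 0] 1 by simp_all
    then show ?thesis using gen[of "2 / m" "c powr - (1 / m)"] m c by simp
  qed
  have "(\<lambda>n. a 2 n / a 0 n - (a 1 n / a 0 n)\<^sup>2) \<longlonglongrightarrow> (A * d x ^ 2 * I 2) / (A * d x ^ 0 * I 0) - ((A * d x ^ 1 * I 1) / (A * d x ^ 0 * I 0))\<^sup>2"
    using A I0 by (intro tendsto_intros a) auto
  also have "(A * d x ^ 2 * I 2) / (A * d x ^ 0 * I 0) - ((A * d x ^ 1 * I 1) / (A * d x ^ 0 * I 0))\<^sup>2 = (d x)\<^sup>2 * (I 2 / I 0)"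
    using A I1 by simp
  also have "\<dots> = (real p * x ^ (p - 1))\<^sup>2 * (c powr (- (2 / m)) * Gamma (3 / m) / Gamma (1 / m))"
    unfolding Ir d_def difference_quotient_self ..
  finally have L: "(\<lambda>n. a 2 n / a 0 n - (a 1 n / a 0 n)\<^sup>2) \<longlonglongrightarrow> (real p * x ^ (p - 1))\<^sup>2 * (c powr (- (2 / m)) * Gamma (3 / m) / Gamma (1 / m))" .
  then show ?thesis
  proof (rule Lim_transform_eventually)
    show "\<forall>\<^sub>F n in sequentially. a 2 n / a 0 n - (a 1 n / a 0 n)\<^sup>2 = (real n powr (1 / m))\<^sup>2 / n * (deriv ^^ 2) (\<lambda>b. psi p n b1 b) b2"
      using eventually_gt_at_top[of 0]
    proof eventually_elim
      case (elim n)
      let ?R = "row_moment p n b1 b2"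
      have fd: "(t ^ p - x ^ p) = (t - x) ^ 1 * d t ^ 1" "(t ^ p - x ^ p)\<^sup>2 = (t - x) ^ 2 * d t ^ 2" for t
        unfolding difference_quotient d_def by (simp_all add: power_mult_distrib)
      have "(deriv ^^ 2) (\<lambda>b. psi p n b1 b) b2 = n * (?R (\<lambda>t. (t ^ p - x ^ p)\<^sup>2) / ?R (\<lambda>_. 1) - (?R (\<lambda>t. t ^ p - x ^ p) / ?R (\<lambda>_. 1))\<^sup>2)"
        by (rule psi_second_deriv_shift[OF elim])
      also have "\<dots> = n * (?R (\<lambda>t. (t - x) ^ 2 * d t ^ 2) / ?R (\<lambda>_. 1) - (?R (\<lambda>t. (t - x) ^ 1 * d t ^ 1) / ?R (\<lambda>_. 1))\<^sup>2)"
        unfolding fd(2) unfolding fd(1) by (rule refl)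
      finally have psi'': "(deriv ^^ 2) (\<lambda>b. psi p n b1 b) b2 = n * (?R (\<lambda>t. (t - x) ^ 2 * d t ^ 2) / ?R (\<lambda>_. 1) - (?R (\<lambda>t. (t - x) ^ 1 * d t ^ 1) / ?R (\<lambda>_. 1))\<^sup>2)" .
      have sn: "s n > 0" "sqrt n > 0" "exp (real n * ell p b1 b2 x) > 0" using elim by (simp_all add: s_def)
      have gen: "(\<sigma> ^ (2 + 1) / q * (u / e)) / (\<sigma> ^ (0 + 1) / q * (w / e)) - ((\<sigma> ^ (1 + 1) / q * (v / e)) / (\<sigma> ^ (0 + 1) / q * (w / e)))\<^sup>2
          = \<sigma>\<^sup>2 / N * (N * (u / w - (v / w)\<^sup>2))"
        if "\<sigma> > 0" "q > 0" "e > 0" "w > 0" "N > 0" for \<sigma> q e u v w N :: real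
      proof -
        have "(\<sigma> ^ (2 + 1) / q * (u / e)) / (\<sigma> ^ (0 + 1) / q * (w / e)) = \<sigma>\<^sup>2 * (u / w)"
          using that by (simp add: power2_eq_square power3_eq_cube)
        moreover have "(\<sigma> ^ (1 + 1) / q * (v / e)) / (\<sigma> ^ (0 + 1) / q * (w / e)) = \<sigma> * (v / w)"
          using that by (simp add: power2_eq_square)
        moreover have "\<sigma>\<^sup>2 / N * (N * (u / w - (v / w)\<^sup>2)) = \<sigma>\<^sup>2 * (u / w - (v / w)\<^sup>2)" using that by simp
        ultimately show ?thesis by (simp only: power_mult_distrib right_diff_distrib)
      qed
      have R0: "?R (\<lambda>t. (t - x) ^ 0 * d t ^ 0) = ?R (\<lambda>_. 1)" by simp
      show ?case
        unfolding psi'' a_def R0 unfolding s_def[symmetric]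
        by (rule gen[OF sn row_moment_pos]) (use elim in simp)
    qed
  qed
qed

lemma ell_expansion_nondegenerate:
  assumes p: "p \<ge> 2" and x: "x \<in> maximizers p b1 b2"
  shows "((\<lambda>t. (ell p b1 b2 x - ell p b1 b2 t) / (t - x) ^ 2) \<longlongrightarrow> - ell_d2 p b2 x / 2) (at x)"
proof (rule ell_expansion[OF p])
  show x01: "0 < x" "x < 1" using maximizers_interior[OF p x] .
  show "ell_d1 p b1 b2 x = 0" by (rule maximizers_ell_d1[OF p x])
  show "((\<lambda>t. ell_d2 p b2 t / (t - x) ^ (2 - 2)) \<longlongrightarrow> - (- ell_d2 p b2 x / 2 * real 2 * real (2 - 1))) (at x)"
    using isCont_ell_d2[OF p x01] by (simp add: isCont_def)
qed simp

text \<open>Both peaks have the same height, so neither is exponentially suppressed. Each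
  contributes a Gaussian integral \<open>sqrt (pi / c)\<close> with \<open>c = |ell_d2| / 2\<close>
  times the Stirling factor \<open>modal_const / sqrt (x * (1 - x))\<close>; together these are
  \<open>w\<close>.\<close>

lemma row_moment_double:
  assumes p: "p \<ge> 2" and x: "maximizers p b1 b2 = {x1, x2}" "x1 < x2"
    and d2: "ell_d2 p b2 x1 < 0" "ell_d2 p b2 x2 < 0"
    and f: "continuous_on UNIV f"
  defines "w \<equiv> \<lambda>x. modal_const * sqrt (2 * pi) / sqrt (x * (1 - x) * \<bar>ell_d2 p b2 x\<bar>)"
  shows "(\<lambda>n. row_moment p n b1 b2 f / exp (real n * ell p b1 b2 x1)) \<longlonglongrightarrow> w x1 * f x1 + w x2 * f x2"
proof -
  have xm: "x1 \<in> maximizers p b1 b2" "x2 \<in> maximizers p b1 b2" using x by auto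
  have M: "ell p b1 b2 x2 = ell p b1 b2 x1" using xm unfolding maximizers_iff by (meson order_antisym)
  let ?M = "ell p b1 b2 x1"
  let ?W = "\<lambda>P n. gibbs_window p b1 b2 ?M P f n"
  have near: "\<exists>\<epsilon>0>0. \<forall>\<epsilon>. 0 < \<epsilon> \<and> \<epsilon> < \<epsilon>0 \<longrightarrow> (\<lambda>n. ?W (\<lambda>t. \<bar>t - y\<bar> < \<epsilon>) n) \<longlonglongrightarrow> w y * f y"
    if y: "y \<in> maximizers p b1 b2" and yd: "ell_d2 p b2 y < 0" and My: "ell p b1 b2 y = ?M" for y
  proof -
    define c where "c = - ell_d2 p b2 y / 2"
    have c: "c > 0" using yd by (simp add: c_def)
    have fy: "isCont f y" using f by (simp add: continuous_on_eq_continuous_at)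
    let ?L = "modal_const / sqrt (y * (1 - y)) * f y * (\<integral>y. y ^ 0 * exp (- (c * y ^ 2)) \<partial>lborel)"
    have "(\<integral>y. y ^ 0 * exp (- (c * y ^ 2)) \<partial>lborel) = 2 / real 2 * c powr (- (real (0 + 1) / real 2)) * Gamma (real (0 + 1) / real 2)"
      by (rule integral_power_exp_neg_power_even[OF c]) simp_all
    also have "\<dots> = sqrt pi / sqrt c"
    proof -
      have "c powr - (1 / 2) = 1 / sqrt c" using c by (simp add: powr_minus powr_half_sqrt inverse_eq_divide)
      then show ?thesis by (simp add: Gamma_one_half_real)
    qed
    finally have I: "(\<integral>y. y ^ 0 * exp (- (c * y ^ 2)) \<partial>lborel) = sqrt pi / sqrt c" .
    have "c = \<bar>ell_d2 p b2 y\<bar> / 2" using yd by (simp add: c_def)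
    then have sqrt_c: "sqrt c = sqrt \<bar>ell_d2 p b2 y\<bar> / sqrt 2" by (simp only: real_sqrt_divide)
    have gen: "m / a * z * (q / (d / r)) = m * (r * q) / (a * d) * z" for m a z q d r :: real
      by (simp only: divide_inverse inverse_mult_distrib inverse_inverse_eq mult_ac)
    have L: "?L = w y * f y"
      unfolding I w_def sqrt_c real_sqrt_mult by (rule gen)
    have s1: "(real n powr (1 / 2)) ^ (0 + 1) / sqrt (real n) = 1" if "n > 0" for n
      using that by (simp add: powr_half_sqrt)
    have "even (2::nat)" "2 \<le> (2::nat)" by simp_all
    from gibbs_window_tendsto[where j = 0, OF p y this c ell_expansion_nondegenerate[OF p y, folded c_def] fy, unfolded of_nat_numeral]
    obtain \<epsilon>0 where \<epsilon>0: "\<epsilon>0 > 0" "\<forall>\<epsilon>. 0 < \<epsilon> \<and> \<epsilon> < \<epsilon>0 \<longrightarrow> (\<lambda>n. (real n powr (1 / 2)) ^ (0 + 1) / sqrt (real n) *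
        gibbs_window p b1 b2 (ell p b1 b2 y) (\<lambda>t. \<bar>t - y\<bar> < \<epsilon>) (\<lambda>t. (t - y) ^ 0 * f t) n) \<longlonglongrightarrow> ?L"
      by (elim exE conjE)
    have "(\<lambda>n. ?W (\<lambda>t. \<bar>t - y\<bar> < \<epsilon>) n) \<longlonglongrightarrow> ?L" if "0 < \<epsilon>" "\<epsilon> < \<epsilon>0" for \<epsilon>
    proof (rule Lim_transform_eventually[OF \<epsilon>0(2)[rule_format, OF conjI[OF that]]])
      show "\<forall>\<^sub>F n in sequentially. (real n powr (1 / 2)) ^ (0 + 1) / sqrt (real n) *
        gibbs_window p b1 b2 (ell p b1 b2 y) (\<lambda>t. \<bar>t - y\<bar> < \<epsilon>) (\<lambda>t. (t - y) ^ 0 * f t) n = ?W (\<lambda>t. \<bar>t - y\<bar> < \<epsilon>) n"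
        using eventually_gt_at_top[of 0] by eventually_elim (simp only: s1 My power_0 mult_1)
    qed
    then show ?thesis unfolding L using \<epsilon>0(1) by (intro exI[of _ \<epsilon>0]) simp
  qed
  from near[OF xm(1) d2(1) refl] obtain \<epsilon>1 where \<epsilon>1: "\<epsilon>1 > 0"
      "\<forall>\<epsilon>. 0 < \<epsilon> \<and> \<epsilon> < \<epsilon>1 \<longrightarrow> (\<lambda>n. ?W (\<lambda>t. \<bar>t - x1\<bar> < \<epsilon>) n) \<longlonglongrightarrow> w x1 * f x1"
    by (elim exE conjE)
  from near[OF xm(2) d2(2) M] obtain \<epsilon>2 where \<epsilon>2: "\<epsilon>2 > 0"
      "\<forall>\<epsilon>. 0 < \<epsilon> \<and> \<epsilon> < \<epsilon>2 \<longrightarrow> (\<lambda>n. ?W (\<lambda>t. \<bar>t - x2\<bar> < \<epsilon>) n) \<longlonglongrightarrow> w x2 * f x2"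
    by (elim exE conjE)
  define \<mu> where "\<mu> = min (min \<epsilon>1 \<epsilon>2) (x2 - x1)"
  have \<mu>: "0 < \<mu>" "\<mu> \<le> \<epsilon>1" "\<mu> \<le> \<epsilon>2" "\<mu> \<le> x2 - x1"
    using \<epsilon>1(1) \<epsilon>2(1) x(2) by (simp_all add: \<mu>_def)
  \<comment> \<open>Half of the minimum, so that the window is strictly smaller than both thresholds
    and the two windows are disjoint.\<close>
  define \<epsilon> where "\<epsilon> = \<mu> / 2"
  have \<epsilon>: "0 < \<epsilon>" "\<epsilon> < \<epsilon>1" "\<epsilon> < \<epsilon>2" "2 * \<epsilon> \<le> x2 - x1"
    unfolding \<epsilon>_def using \<mu> by linarith+
  let ?far = "\<lambda>t. \<forall>x'\<in>maximizers p b1 b2. \<epsilon> \<le> \<bar>t - x'\<bar>"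
  have "continuous_on {0..1} f" by (intro continuous_on_subset[OF f]) auto
  then have "bounded (f ` {0..1})" by (intro compact_imp_bounded compact_continuous_image) auto
  then obtain F where "\<forall>t\<in>{0..1}. \<bar>f t\<bar> \<le> F" unfolding bounded_iff by auto
  then have F: "\<And>t. 0 \<le> t \<Longrightarrow> t \<le> 1 \<Longrightarrow> \<bar>f t\<bar> \<le> F" by simp
  have far: "(\<lambda>n. ?W ?far n) \<longlonglongrightarrow> 0"
    using gibbs_window_far[where r = 0, OF xm(1) \<epsilon>(1) F] by simp
  have split: "?W (\<lambda>t. \<bar>t - x1\<bar> < \<epsilon>) n + ?W (\<lambda>t. \<bar>t - x2\<bar> < \<epsilon>) n + ?W ?far n =
      row_moment p n b1 b2 f / exp (real n * ?M)" if "n > 0" for n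
  proof -
    let ?S = "\<lambda>P. {k. k \<le> n \<and> P (real k / n)}"
    let ?g = "\<lambda>k. modal_prob n k * exp (real n * (ell p b1 b2 (real k / n) - ?M)) * f (real k / n)"
    have "?W (\<lambda>t. \<bar>t - x1\<bar> < \<epsilon>) n + ?W (\<lambda>t. \<bar>t - x2\<bar> < \<epsilon>) n + ?W ?far n =
        sum ?g (?S (\<lambda>t. \<bar>t - x1\<bar> < \<epsilon>) \<union> ?S (\<lambda>t. \<bar>t - x2\<bar> < \<epsilon>)) + sum ?g (?S ?far)"
      unfolding gibbs_window_def
      by (subst sum.union_disjoint) (use \<epsilon>(4) in auto)
    also have "\<dots> = sum ?g (?S (\<lambda>t. \<bar>t - x1\<bar> < \<epsilon>) \<union> ?S (\<lambda>t. \<bar>t - x2\<bar> < \<epsilon>) \<union> ?S ?far)"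
      by (rule sum.union_disjoint[symmetric]) (auto simp: x)
    also have "?S (\<lambda>t. \<bar>t - x1\<bar> < \<epsilon>) \<union> ?S (\<lambda>t. \<bar>t - x2\<bar> < \<epsilon>) \<union> ?S ?far = {..n}" by (auto simp: x)
    finally show ?thesis unfolding row_moment_eq_modal_prob[OF that, where M = ?M] by simp
  qed
  have "(\<lambda>n. ?W (\<lambda>t. \<bar>t - x1\<bar> < \<epsilon>) n + ?W (\<lambda>t. \<bar>t - x2\<bar> < \<epsilon>) n + ?W ?far n) \<longlonglongrightarrow> w x1 * f x1 + w x2 * f x2 + 0"
    by (intro tendsto_add \<epsilon>1(2)[rule_format] \<epsilon>2(2)[rule_format] conjI \<epsilon> far)
  then have "(\<lambda>n. ?W (\<lambda>t. \<bar>t - x1\<bar> < \<epsilon>) n + ?W (\<lambda>t. \<bar>t - x2\<bar> < \<epsilon>) n + ?W ?far n) \<longlonglongrightarrow> w x1 * f x1 + w x2 * f x2"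
    by (simp only: add_0_right)
  then show ?thesis
    by (rule Lim_transform_eventually) (rule eventually_mono[OF eventually_gt_at_top[of 0] split])
qed

text \<open>The Gibbs measure tends to masses proportional to \<open>1 / s x1\<close> and
  \<open>1 / s x2\<close>, that is \<open>s x2 / (s x1 + s x2)\<close> at \<open>x1\<close> and
  \<open>s x1 / (s x1 + s x2)\<close> at \<open>x2\<close>. A two-point variance is the product of
  the masses times the squared difference of the values. No centring occurs because the order-one
  terms survive.\<close>

lemma variance_double:
  assumes p: "p \<ge> 2" and x: "maximizers p b1 b2 = {x1, x2}" "x1 < x2"
    and d2: "ell_d2 p b2 x1 < 0" "ell_d2 p b2 x2 < 0"
  defines "s \<equiv> \<lambda>x. sqrt (x * (1 - x) * \<bar>ell_d2 p b2 x\<bar>)"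
  shows "(\<lambda>n. 1 / real n * (deriv ^^ 2) (\<lambda>b. psi p n b1 b) b2) \<longlonglongrightarrow> (x1 ^ p - x2 ^ p) ^ 2 * s x1 * s x2 / (s x1 + s x2) ^ 2"
proof -
  have x01: "0 < x" "x < 1" if "x \<in> {x1, x2}" for x
    using maximizers_interior[OF p, of x b1 b2] that unfolding x by auto
  have s: "s x1 > 0" "s x2 > 0"
  proof -
    have "sqrt (y * (1 - y) * \<bar>z\<bar>) > 0" if "0 < y" "y < 1" "z < 0" for y z :: real
    proof -
      have "y * (1 - y) * \<bar>z\<bar> > 0" using that by (intro mult_pos_pos) auto
      then show ?thesis by simp
    qed
    then show "s x1 > 0" "s x2 > 0" unfolding s_def using x01 d2 by simp_all
  qed
  define K where "K = modal_const * sqrt (2 * pi)"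
  have K: "K > 0" using modal_const(1) by (simp add: K_def)
  define A where "A f n = row_moment p n b1 b2 f / exp (real n * ell p b1 b2 x1)" for f and n :: nat
  have A: "A f \<longlonglongrightarrow> K / s x1 * f x1 + K / s x2 * f x2" if "continuous_on UNIV f" for f
    using row_moment_double[OF p x d2 that] unfolding A_def s_def K_def .
  let ?f2 = "\<lambda>t::real. t ^ p * t ^ p" and ?f1 = "\<lambda>t::real. t ^ p" and ?f0 = "\<lambda>t::real. 1::real"
  let ?D = "K / s x1 * 1 + K / s x2 * 1"
  have D: "?D \<noteq> 0" using K s by (intro less_imp_neq[symmetric] add_pos_pos) auto
  have "(\<lambda>n. A ?f2 n / A ?f0 n - (A ?f1 n / A ?f0 n)\<^sup>2) \<longlonglongrightarrow>
      (K / s x1 * (x1 ^ p * x1 ^ p) + K / s x2 * (x2 ^ p * x2 ^ p)) / ?D - ((K / s x1 * x1 ^ p + K / s x2 * x2 ^ p) / ?D)\<^sup>2"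
    by (intro tendsto_diff tendsto_divide tendsto_power A D continuous_intros)
  also have "(K / s x1 * (x1 ^ p * x1 ^ p) + K / s x2 * (x2 ^ p * x2 ^ p)) / ?D - ((K / s x1 * x1 ^ p + K / s x2 * x2 ^ p) / ?D)\<^sup>2
     = (x1 ^ p - x2 ^ p) ^ 2 * s x1 * s x2 / (s x1 + s x2) ^ 2"
  proof -
    have "(K / u * (a * a) + K / v * (b * b)) / (K / u * 1 + K / v * 1) - ((K / u * a + K / v * b) / (K / u * 1 + K / v * 1))\<^sup>2
      = (a - b)\<^sup>2 * u * v / (u + v)\<^sup>2" if "u > 0" "v > 0" for u v a b :: real
    proof -
      define S P Q where "S = u + v" and "P = v * (a * a) + u * (b * b)" and "Q = v * a + u * b"
      have S: "S > 0" using that by (simp add: S_def)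
      have n1: "K / u * c + K / v * d = K * (v * c + u * d) / (u * v)" for c d
        using that by (simp add: distrib_left add_divide_distrib)
      have q: "(K * z / (u * v)) / (K * (v * 1 + u * 1) / (u * v)) = z / S" for z
      proof -
        have "(k * z' / m) / (k * t / m) = z' / t" if "k > 0" "m > 0" for k z' m t :: real using that by simp
        from this[of K "u * v" z "v * 1 + u * 1"] show ?thesis using that K by (simp add: S_def add.commute)
      qed
      have PQ: "P * S - Q\<^sup>2 = (a - b)\<^sup>2 * u * v"
        by (simp add: P_def S_def Q_def power2_eq_square algebra_simps)
      have "(K / u * (a * a) + K / v * (b * b)) / (K / u * 1 + K / v * 1) - ((K / u * a + K / v * b) / (K / u * 1 + K / v * 1))\<^sup>2
          = P / S - (Q / S)\<^sup>2"
        unfolding n1 q P_def Q_def ..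
      also have "P / S = P * S / S\<^sup>2" using S by (simp add: power2_eq_square)
      also have "P * S / S\<^sup>2 - (Q / S)\<^sup>2 = (a - b)\<^sup>2 * u * v / S\<^sup>2"
        unfolding power_divide diff_divide_distrib[symmetric] PQ ..
      finally show ?thesis unfolding S_def .
    qed
    then show ?thesis using s by blast
  qed
  finally show ?thesis
  proof (rule Lim_transform_eventually)
    show "\<forall>\<^sub>F n in sequentially. A ?f2 n / A ?f0 n - (A ?f1 n / A ?f0 n)\<^sup>2 = 1 / real n * (deriv ^^ 2) (\<lambda>b. psi p n b1 b) b2"
      using eventually_gt_at_top[of 0]
    proof eventually_elim
      case (elim n)
      have gen: "(u / e) / (w / e) - ((v / e) / (w / e))\<^sup>2 = 1 / N * (N * (u / w - (v / w)\<^sup>2))"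
        if "e > 0" "N > 0" for e N u v w :: real
      proof -
        have "(u / e) / (w / e) = u / w" "(v / e) / (w / e) = v / w" using that by simp_all
        moreover have "1 / N * (N * z) = z" for z using that by simp
        ultimately show ?thesis by (simp only:)
      qed
      have eq: "(deriv ^^ 2) (\<lambda>b. psi p n b1 b) b2 = n * (row_moment p n b1 b2 ?f2 / row_moment p n b1 b2 ?f0 -
          (row_moment p n b1 b2 ?f1 / row_moment p n b1 b2 ?f0)\<^sup>2)"
        by (rule psi_second_deriv[OF elim])
      show ?case unfolding eq A_def by (rule gen) (use elim in simp_all)
    qed
  qed
qed

section \<open>The limiting free energy\<close>

text \<open>From above, the normalized sum \<open>R n\<close> has \<open>n + 1\<close> terms of size
  at most 1. From below it dominates its single term at \<open>k = \<kappa> n\<close>, the floor of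
  \<open>n * x\<close>. Both differ from the maximum of \<open>ell\<close> only by logarithms
  divided by \<open>n\<close> and by the error of replacing \<open>x\<close> with
  \<open>\<kappa> n / n\<close>.\<close>

lemma psi_tendsto:
  assumes p: "p \<ge> 2" and x: "x \<in> maximizers p b1 b"
  shows "(\<lambda>n. psi p n b1 b) \<longlonglongrightarrow> ell p b1 b x"
proof -
  note x01 = maximizers_interior[OF p x]
  let ?M = "ell p b1 b x"
  define R where "R n = (\<Sum>k\<le>n. modal_prob n k * exp (real n * (ell p b1 b (real k / n) - ?M)))" for n :: nat
  define \<kappa> where "\<kappa> n = nat \<lfloor>real n * x\<rfloor>" for n :: nat
  have \<kappa>: "real n * x - 1 \<le> real (\<kappa> n)" "real (\<kappa> n) \<le> real n * x" for n
  proof -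
    have "\<lfloor>real n * x\<rfloor> \<ge> 0" using x01 by simp
    then have "real (\<kappa> n) = of_int \<lfloor>real n * x\<rfloor>" by (simp add: \<kappa>_def)
    then show "real n * x - 1 \<le> real (\<kappa> n)" "real (\<kappa> n) \<le> real n * x" by linarith+
  qed
  have \<kappa>_le: "\<kappa> n \<le> n" for n
  proof -
    have "real n * x \<le> real n * 1" using x01 by (intro mult_left_mono) auto
    then show ?thesis using \<kappa>(2)[of n] by linarith
  qed
  have tlim: "(\<lambda>n. real (\<kappa> n) / n) \<longlonglongrightarrow> x"
  proof (rule tendsto_sandwich[where h = "\<lambda>_. x"])
    show "(\<lambda>n. x - 1 / real n) \<longlonglongrightarrow> x" by real_asymp
    show "\<forall>\<^sub>F n in sequentially. x - 1 / real n \<le> real (\<kappa> n) / real n"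
      using eventually_gt_at_top[of 0]
    proof eventually_elim
      case (elim n)
      have "(real n * x - 1) / n \<le> real (\<kappa> n) / n" using \<kappa>(1) by (intro divide_right_mono) auto
      then show ?case using elim by (simp add: diff_divide_distrib)
    qed
    show "\<forall>\<^sub>F n in sequentially. real (\<kappa> n) / real n \<le> x"
      using eventually_gt_at_top[of 0]
    proof eventually_elim
      case (elim n)
      have "real (\<kappa> n) / n \<le> (real n * x) / n" using \<kappa>(2) by (intro divide_right_mono) auto
      then show ?case using elim by simp
    qed
  qed simp
  have elim_ell: "(\<lambda>n. ell p b1 b (real (\<kappa> n) / n)) \<longlonglongrightarrow> ?M"
    by (rule isCont_tendsto_compose[OF DERIV_isCont[OF ell_deriv[OF p x01]] tlim])
  define L where "L = modal_const / sqrt (x * (1 - x))"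
  have L: "L > 0" using modal_const(1) x01 by (simp add: L_def)
  have mlim: "(\<lambda>n. sqrt n * modal_prob n (\<kappa> n)) \<longlonglongrightarrow> L"
    unfolding L_def by (rule modal_const(2)[OF x01 tlim])
  have mpos: "\<forall>\<^sub>F n in sequentially. 0 < sqrt n * modal_prob n (\<kappa> n)"
    by (rule order_tendstoD(1)[OF mlim L])
  have psi: "psi p n b1 b = ?M + ln (R n) / n" "R n > 0" if "n > 0" for n
  proof -
    have r: "row_moment p n b1 b (\<lambda>_. 1) = exp (real n * ?M) * R n"
      unfolding row_moment_eq_modal_prob[OF that, where M = ?M] R_def by simp
    then show "R n > 0" using row_moment_pos[of p n b1 b] by (simp add: zero_less_mult_iff)
    then show "psi p n b1 b = ?M + ln (R n) / n"
      unfolding psi_eq[OF that] r using that by (simp add: ln_mult add_divide_distrib)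
  qed
  have lo: "(\<lambda>n. ell p b1 b (real (\<kappa> n) / n) + (ln (sqrt n * modal_prob n (\<kappa> n)) * (1 / n) - ln (sqrt n) / n)) \<longlonglongrightarrow> ?M + (ln L * 0 - 0)"
  proof (intro tendsto_add tendsto_diff tendsto_mult elim_ell tendsto_ln mlim)
    show "(\<lambda>n. 1 / real n) \<longlonglongrightarrow> 0" by real_asymp
    show "(\<lambda>n. ln (sqrt (real n)) / real n) \<longlonglongrightarrow> 0" by real_asymp
  qed (use L in simp)
  have up: "(\<lambda>n. ?M + ln (real n + 1) / n) \<longlonglongrightarrow> ?M + 0"
    by (intro tendsto_add tendsto_const) real_asymp
  show ?thesis
  proof (rule tendsto_sandwich)
    show "(\<lambda>n. ell p b1 b (real (\<kappa> n) / n) + (ln (sqrt n * modal_prob n (\<kappa> n)) * (1 / n) - ln (sqrt n) / n)) \<longlonglongrightarrow> ?M"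
      using lo by simp
    show "(\<lambda>n. ?M + ln (real n + 1) / n) \<longlonglongrightarrow> ?M" using up by simp
    show "\<forall>\<^sub>F n in sequentially. psi p n b1 b \<le> ?M + ln (real n + 1) / n"
      using eventually_gt_at_top[of 0]
    proof eventually_elim
      case (elim n)
      have "R n \<le> (\<Sum>k\<le>n. 1)" unfolding R_def
      proof (rule sum_mono)
        fix k assume k: "k \<in> {..n}"
        have "ell p b1 b (real k / n) \<le> ?M" using x k elim by (auto simp: maximizers_iff)
        then have "real n * (ell p b1 b (real k / n) - ?M) \<le> 0" by (intro mult_nonneg_nonpos) auto
        then have "modal_prob n k * exp (real n * (ell p b1 b (real k / n) - ?M)) \<le> 1 * 1"
          using k modal_prob_le_1[of k n] by (intro mult_mono) auto
        then show "modal_prob n k * exp (real n * (ell p b1 b (real k / n) - ?M)) \<le> 1" by simp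
      qed
      then have "ln (R n) \<le> ln (real n + 1)" using psi(2)[OF elim] by (simp add: add.commute)
      then show ?case unfolding psi(1)[OF elim] using divide_right_mono[of "ln (R n)" "ln (real n + 1)" n] by simp
    qed
    show "\<forall>\<^sub>F n in sequentially. ell p b1 b (real (\<kappa> n) / n) + (ln (sqrt n * modal_prob n (\<kappa> n)) * (1 / n) - ln (sqrt n) / n) \<le> psi p n b1 b"
      using eventually_gt_at_top[of 0] mpos
    proof eventually_elim
      case (elim n)
      have m: "modal_prob n (\<kappa> n) > 0" using elim by (simp add: zero_less_mult_iff)
      let ?e = "real n * (ell p b1 b (real (\<kappa> n) / n) - ?M)"
      have "modal_prob n (\<kappa> n) * exp ?e \<le> R n" unfolding R_def
        using \<kappa>_le[of n] modal_prob_nonneg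
        by (intro member_le_sum[where f = "\<lambda>k. modal_prob n k * exp (real n * (ell p b1 b (real k / n) - ?M))"]) auto
      then have "ln (modal_prob n (\<kappa> n) * exp ?e) \<le> ln (R n)" using m by (intro ln_mono) auto
      moreover have "ln (modal_prob n (\<kappa> n) * exp ?e) = ln (modal_prob n (\<kappa> n)) + ?e" using m by (simp add: ln_mult)
      moreover have "ln (sqrt n * modal_prob n (\<kappa> n)) = ln (sqrt n) + ln (modal_prob n (\<kappa> n))"
        using m elim(1) by (simp add: ln_mult)
      ultimately have "(ln (sqrt n * modal_prob n (\<kappa> n)) - ln (sqrt n) + ?e) / n \<le> ln (R n) / n"
        by (intro divide_right_mono) auto
      then show ?case unfolding psi(1)[OF elim(1)] using elim(1) by (simp add: add_divide_distrib diff_divide_distrib)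
    qed
  qed
qed

lemma psi_lim_eq:
  assumes "p \<ge> 2" "x \<in> maximizers p b1 b"
  shows "psi_lim p b1 b = ell p b1 b x"
  unfolding psi_lim_def by (rule limI[OF psi_tendsto[OF assms]])

section \<open>Dependence of the maximizer on the second parameter\<close>

text \<open>A selection made for every \<open>b\<close>, so that continuity and derivatives in
  \<open>b\<close> make sense; where the maximizer is unique, the choice is forced.\<close>

definition some_maximizer :: "nat \<Rightarrow> real \<Rightarrow> real \<Rightarrow> real" where
  "some_maximizer p b1 b = (SOME x. x \<in> maximizers p b1 b)"

lemma some_maximizer: "some_maximizer p b1 b \<in> maximizers p b1 b"
  unfolding some_maximizer_def by (rule someI_ex[OF maximizers_nonempty])

text \<open>Moving from \<open>b\<close> to \<open>b'\<close> changes \<open>ell\<close> by at most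
  \<open>|b' - b|\<close> on \<open>{0..1}\<close>, since \<open>t ^ p\<close> lies between 0 and 1.
  A maximizer for \<open>b'\<close> at distance \<open>\<delta>\<close> from \<open>x\<close> would
  have to make up the gap \<open>\<gamma>\<close> with two such changes, which is impossible for
  \<open>|b' - b| < \<gamma> / 2\<close>.\<close>

lemma isCont_some_maximizer:
  assumes p: "p \<ge> 2" and x: "maximizers p b1 b = {x}"
  shows "isCont (some_maximizer p b1) b"
proof -
  let ?X = "some_maximizer p b1"
  have Xb: "?X b = x" using some_maximizer[of p b1 b] x by simp
  have xm: "x \<in> maximizers p b1 b" using x by simp
  note x01 = maximizers_interior[OF p xm]
  show ?thesis unfolding isCont_def
  proof (rule tendstoI)
    fix \<delta> :: real assume "\<delta> > 0"
    from gap_away_from_maximizers[OF xm this] obtain \<gamma> where \<gamma>: "\<gamma> > 0"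
      "\<And>t. 0 \<le> t \<Longrightarrow> t \<le> 1 \<Longrightarrow> \<delta> \<le> \<bar>t - x\<bar> \<Longrightarrow> ell p b1 b t \<le> ell p b1 b x - \<gamma>" unfolding x by auto
    have diff: "\<bar>ell p b1 b' t - ell p b1 b t\<bar> \<le> \<bar>b' - b\<bar>" if "0 \<le> t" "t \<le> 1" for b' t
    proof -
      have "ell p b1 b' t - ell p b1 b t = (b' - b) * t ^ p" by (simp add: ell_def algebra_simps)
      moreover have "\<bar>t ^ p\<bar> \<le> 1" using that by (simp add: power_le_one)
      ultimately show ?thesis using mult_left_mono[of "\<bar>t ^ p\<bar>" 1 "\<bar>b' - b\<bar>"] by (simp add: abs_mult)
    qed
    have "dist (?X b') (?X b) < \<delta>" if "dist b' b < \<gamma> / 2" for b'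
    proof (rule ccontr)
      assume "\<not> dist (?X b') (?X b) < \<delta>"
      then have far: "\<delta> \<le> \<bar>?X b' - x\<bar>" unfolding Xb dist_real_def by simp
      have X01: "0 < ?X b'" "?X b' < 1" using maximizers_interior[OF p some_maximizer] .
      have "ell p b1 b' x \<le> ell p b1 b' (?X b')"
        using some_maximizer[of p b1 b'] x01 unfolding maximizers_iff by simp
      moreover have "ell p b1 b (?X b') \<le> ell p b1 b x - \<gamma>" using X01 far by (intro \<gamma>(2)) auto
      moreover have "\<bar>ell p b1 b' x - ell p b1 b x\<bar> \<le> \<bar>b' - b\<bar>" using x01 by (intro diff) auto
      moreover have "\<bar>ell p b1 b' (?X b') - ell p b1 b (?X b')\<bar> \<le> \<bar>b' - b\<bar>" using X01 by (intro diff) auto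
      ultimately show False using that unfolding dist_real_def by linarith
    qed
    then show "\<forall>\<^sub>F b' in at b. dist (?X b') (?X b) < \<delta>"
      unfolding eventually_at using \<gamma>(1) by (intro exI[of _ "\<gamma> / 2"]) simp
  qed
qed

text \<open>Envelope theorem: the displacement of the maximizer does not contribute to first order.\<close>

lemma psi_lim_deriv:
  assumes p: "p \<ge> 2" and x: "maximizers p b1 b = {x}"
  shows "((\<lambda>b. psi_lim p b1 b) has_real_derivative some_maximizer p b1 b ^ p) (at b)"
  unfolding has_field_derivative_iff
proof -
  let ?X = "some_maximizer p b1"
  have X: "psi_lim p b1 b' = ell p b1 b' (?X b')" for b' by (rule psi_lim_eq[OF p some_maximizer])
  \<comment> \<open>\<open>psi_lim\<close> is a maximum of functions affine in \<open>b\<close>, so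
    \<open>?X d ^ p\<close> is a subgradient at \<open>d\<close>. Using this at both
    \<open>b\<close> and \<open>c\<close> traps the difference quotient between
    \<open>?X b ^ p\<close> and \<open>?X c ^ p\<close>.\<close>
  have ineq: "(c - d) * ?X d ^ p \<le> psi_lim p b1 c - psi_lim p b1 d" for c d
  proof -
    have "ell p b1 c (?X d) \<le> ell p b1 c (?X c)"
      using some_maximizer[of p b1 c] some_maximizer[of p b1 d] unfolding maximizers_iff by simp
    moreover have "ell p b1 c (?X d) - ell p b1 d (?X d) = (c - d) * ?X d ^ p"
      by (simp add: ell_def algebra_simps)
    ultimately show ?thesis unfolding X by simp
  qed
  have bound: "\<bar>(psi_lim p b1 c - psi_lim p b1 b) / (c - b) - ?X b ^ p\<bar> \<le> \<bar>?X c ^ p - ?X b ^ p\<bar>" if "c \<noteq> b" for c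
  proof -
    define z where "z = psi_lim p b1 c - psi_lim p b1 b - (c - b) * ?X b ^ p"
    have z: "0 \<le> z" "z \<le> (c - b) * (?X c ^ p - ?X b ^ p)"
      using ineq[of c b] ineq[of b c] by (auto simp: z_def algebra_simps)
    have "(psi_lim p b1 c - psi_lim p b1 b) / (c - b) - ?X b ^ p = z / (c - b)"
      using that by (simp add: z_def diff_divide_distrib)
    moreover have "\<bar>z\<bar> \<le> \<bar>?X c ^ p - ?X b ^ p\<bar> * \<bar>c - b\<bar>"
      using z unfolding abs_mult[symmetric] by (simp add: mult.commute)
    ultimately show ?thesis using that by (simp add: pos_divide_le_eq)
  qed
  have "isCont (\<lambda>c. ?X c ^ p) b" by (intro continuous_intros isCont_some_maximizer[OF p x])
  then have "((\<lambda>c. \<bar>?X c ^ p - ?X b ^ p\<bar>) \<longlongrightarrow> \<bar>?X b ^ p - ?X b ^ p\<bar>) (at b)"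
    unfolding isCont_def by (intro tendsto_rabs tendsto_diff tendsto_const)
  then have "((\<lambda>c. \<bar>?X c ^ p - ?X b ^ p\<bar>) \<longlongrightarrow> 0) (at b)" by simp
  then have "((\<lambda>c. (psi_lim p b1 c - psi_lim p b1 b) / (c - b) - ?X b ^ p) \<longlongrightarrow> 0) (at b)"
    by (rule Lim_null_comparison[rotated]) (use bound in \<open>simp add: eventually_at_filter\<close>)
  then show "((\<lambda>c. (psi_lim p b1 c - psi_lim p b1 b) / (c - b)) \<longlongrightarrow> ?X b ^ p) (at b)"
    by (rule Lim_null[THEN iffD2])
qed

text \<open>
  The equation \<open>ell_d1 x = 0\<close> is linear in \<open>b\<close>; solving it for \<open>b\<close> gives an explicit left inverse of
  \<open>b \<mapsto> x\<close>.
\<close>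

lemma some_maximizer_deriv:
  assumes p: "p \<ge> 2" and x: "maximizers p b1 b = {x}" and d2: "ell_d2 p b x < 0"
  shows "(some_maximizer p b1 has_real_derivative inverse (- ell_d2 p b x / (real p * x ^ (p - 1)))) (at b)"
proof (rule DERIV_inverse_function[where a = "b - 1" and b = "b + 1"])
  let ?X = "some_maximizer p b1"
  let ?B = "\<lambda>t. (ln t - ln (1 - t) - b1) / (real p * t ^ (p - 1))"
  have Xb: "?X b = x" using some_maximizer[of p b1 b] x by simp
  have xm: "x \<in> maximizers p b1 b" using x by simp
  note x01 = maximizers_interior[OF p xm]
  have p0: "real p > 0" using p by simp
  have num: "ln t - ln (1 - t) - b1 = y * (real p * t ^ (p - 1))" if "t \<in> maximizers p b1 y" for t y
    using maximizers_ell_d1[OF p that] unfolding ell_d1_def[OF p] by simp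
  have den: "real p * t ^ (p - 1) > 0" if "t > 0" for t using that p0 by simp
  show "?B (?X y) = y" for y
  proof -
    have "real p * ?X y ^ (p - 1) \<noteq> 0" by (rule less_imp_neq[symmetric, OF den[OF maximizers_interior(1)[OF p some_maximizer[of p b1 y]]]])
    then show ?thesis unfolding num[OF some_maximizer] by simp
  qed
  show "- ell_d2 p b x / (real p * x ^ (p - 1)) \<noteq> 0"
    using divide_pos_pos[of "- ell_d2 p b x", OF _ den[OF x01(1)]] d2 by linarith
  show "isCont ?X b" by (rule isCont_some_maximizer[OF p x])
  obtain k where k: "p = Suc (Suc k)" using p by (cases p; cases "p - 1") auto
  have ln1: "((\<lambda>t. ln (1 - t)) has_real_derivative - (1 / (1 - x))) (at x)"
    using x01 by (auto intro!: derivative_eq_intros)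
  have N': "((\<lambda>t. ln t - ln (1 - t) - b1) has_real_derivative 1 / x - - (1 / (1 - x)) - 0) (at x)"
    by (intro DERIV_diff DERIV_ln_divide ln1 DERIV_const x01)
  have "((\<lambda>t. real p * t ^ Suc k) has_real_derivative real p * ((1 + real k) * (1 * x ^ k))) (at x)"
    by (intro DERIV_cmult DERIV_power_Suc DERIV_ident)
  then have D': "((\<lambda>t. real p * t ^ (p - 1)) has_real_derivative real p * (real p - 1) * x ^ (p - 2)) (at x)"
    by (simp add: k mult.assoc)
  define D where "D = real p * x ^ (p - 1)"
  have D: "D > 0" unfolding D_def by (rule den[OF x01(1)])
  have "(?B has_real_derivative ((1 / x - - (1 / (1 - x)) - 0) * D - (ln x - ln (1 - x) - b1) * (real p * (real p - 1) * x ^ (p - 2))) / (D * D)) (at x)"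
    unfolding D_def by (intro DERIV_divide N' D' less_imp_neq[symmetric, OF D[unfolded D_def]])
  \<comment> \<open>The first-order condition at \<open>x\<close> turns
    \<open>ln x - ln (1 - x) - b1\<close> into \<open>b * D\<close>, which collapses the numerator
    of the quotient rule to \<open>- ell_d2 * D\<close>.\<close>
  also have "(1 / x - - (1 / (1 - x)) - 0) * D - (ln x - ln (1 - x) - b1) * (real p * (real p - 1) * x ^ (p - 2)) = - ell_d2 p b x * D"
    unfolding num[OF xm] D_def[symmetric] ell_d2_def[OF p] by (simp add: algebra_simps)
  also have "- ell_d2 p b x * D / (D * D) = - ell_d2 p b x / (real p * x ^ (p - 1))"
    using D unfolding D_def[symmetric] by simp
  finally show "(?B has_real_derivative - ell_d2 p b x / (real p * x ^ (p - 1))) (at (?X b))" unfolding Xb .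
qed auto

section \<open>The three regimes\<close>

text \<open>\<open>phase_transition_curve\<close> gives uniqueness at the critical point but not the
  location. There \<open>ell_d2\<close> is negative except at the peak \<open>m\<close> of
  \<open>star_weight\<close>, so \<open>ell_d1\<close> has no second zero besides \<open>m\<close>,
  and maximizers are zeros of \<open>ell_d1\<close>.\<close>

lemma critical_maximizer:
  assumes p: "p \<ge> 2" and x: "x \<in> maximizers p (crit1 p) (crit2 p)"
  shows "x = (real p - 1) / real p"
proof (rule ccontr)
  define m where "m = (real p - 1) / real p"
  assume "x \<noteq> (real p - 1) / real p"
  then have xm: "x \<noteq> m" unfolding m_def .
  note x01 = maximizers_interior[OF p x]
  have m: "0 < m" "m < 1" "1 - m = 1 / real p" unfolding m_def by (rule xc[OF p])+
  have p0: "real p > 0" "real p - 1 > 0" using p by auto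
  obtain k where k: "p = Suc (Suc k)" using p by (cases p; cases "p - 1") auto
  have pp: "z ^ p = z * z ^ (p - 1)" for z :: real by (simp add: k)
  have d1m: "ell_d1 p (crit1 p) (crit2 p) m = 0"
  proof -
    have gen: "A / (Q * B) * (P * (B / A)) = P / Q" if "A > 0" "B > 0" for P Q A B :: real
      using that by simp
    have "crit2 p * (real p * m ^ (p - 1)) = real p / (real p - 1)"
      unfolding crit2_def m_def pp[of "real p - 1"] power_divide by (rule gen) (use p0 in simp_all)
    moreover have "ln m - ln (1 - m) = ln (real p - 1)"
      unfolding m(3) unfolding m_def using p0 by (simp add: ln_divide_pos)
    ultimately show ?thesis unfolding ell_d1_def[OF p] crit1_def by simp
  qed
  define K where "K = crit2 p * (real p * (real p - 1))"
  have K: "K > 0" unfolding K_def crit2_def using p0 by (intro mult_pos_pos divide_pos_pos) simp_all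
  have Km: "K * star_weight p m = 1"
    using ell_d2_weight[OF p m(1,2), of "crit2 p"] ell_d2_critical(1)[OF p] by (simp add: K_def m_def)
  have neg: "ell_d2 p (crit2 p) z < 0" if "0 < z" "z < 1" "z \<noteq> m" for z
  proof -
    have "star_weight p z < star_weight p m"
    proof (cases "z < m")
      case True
      then show ?thesis using that m by (intro star_weight_incr[OF p]) (auto simp: m_def)
    next
      case False
      then show ?thesis using that m by (intro star_weight_decr[OF p]) (auto simp: m_def)
    qed
    then have "K * star_weight p z < K * star_weight p m" using K by simp
    then have "z * (1 - z) * ell_d2 p (crit2 p) z < 0"
      unfolding ell_d2_weight[OF p that(1,2)] K_def[symmetric] Km by simp
    moreover have "z * (1 - z) > 0" using that by simp
    ultimately show ?thesis by (metis mult_less_0_iff order.asym)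
  qed
  have d1x: "ell_d1 p (crit1 p) (crit2 p) x = 0" by (rule maximizers_ell_d1[OF p x])
  have no: False if "0 < a" "a < b" "b < 1" "ell_d1 p (crit1 p) (crit2 p) a = 0" "ell_d1 p (crit1 p) (crit2 p) b = 0"
    "m \<notin> {a<..<b}" for a b
  proof -
    have "\<exists>z>a. z < b \<and> ell_d1 p (crit1 p) (crit2 p) b - ell_d1 p (crit1 p) (crit2 p) a = (b - a) * ell_d2 p (crit2 p) z"
      using that by (intro MVT2 ell_d1_deriv p) auto
    then obtain z where z: "a < z" "z < b"
      "ell_d1 p (crit1 p) (crit2 p) b - ell_d1 p (crit1 p) (crit2 p) a = (b - a) * ell_d2 p (crit2 p) z"
      by blast
    have "ell_d2 p (crit2 p) z < 0" using z that by (intro neg) auto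
    then have "(b - a) * ell_d2 p (crit2 p) z < 0" using that(2) by (intro mult_pos_neg) auto
    then show False using z(3) that(4,5) by simp
  qed
  show False
  proof (cases "x < m")
    case True
    then show False using no[of x m] x01 m d1x d1m by simp
  next
    case False
    then show False using no[of m x] x01 m d1x d1m xm by simp
  qed
qed

text \<open>The case \<open>m = 2\<close>, \<open>c = |ell_d2| / 2\<close>: the rate is 1, and
  \<open>Gamma (3 / 2) / Gamma (1 / 2) = 1 / 2\<close> combines with \<open>1 / c\<close> to
  \<open>1 / |ell_d2|\<close>.\<close>

lemma off_curve_second_deriv:
  assumes p: "p \<ge> 2" and x: "maximizers p b1 b2 = {x}" and d2: "ell_d2 p b2 x < 0"
  shows "(\<lambda>n. (deriv ^^ 2) (\<lambda>b. psi p n b1 b) b2) \<longlonglongrightarrow> real p ^ 2 * x ^ (2 * p - 2) / \<bar>ell_d2 p b2 x\<bar>"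
proof -
  have xm: "x \<in> maximizers p b1 b2" using x by simp
  define c where "c = - ell_d2 p b2 x / 2"
  have c: "c > 0" using d2 by (simp add: c_def)
  have e2: "even (2::nat)" "2 \<le> (2::nat)" by simp_all
  have "(\<lambda>n. (real n powr (1 / real 2))\<^sup>2 / n * (deriv ^^ 2) (\<lambda>b. psi p n b1 b) b2)
    \<longlonglongrightarrow> (real p * x ^ (p - 1))\<^sup>2 * (c powr (- (2 / real 2)) * Gamma (3 / real 2) / Gamma (1 / real 2))"
    by (rule variance_single[OF p x e2 c ell_expansion_nondegenerate[OF p xm, folded c_def]])
  moreover have "(real p * x ^ (p - 1))\<^sup>2 * (c powr (- (2 / real 2)) * Gamma (3 / real 2) / Gamma (1 / real 2))
     = real p ^ 2 * x ^ (2 * p - 2) / \<bar>ell_d2 p b2 x\<bar>"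
  proof -
    have "Gamma (1 / 2 + 1) = 1 / 2 * Gamma (1 / 2 :: real)" by (rule Gamma_plus1) (auto dest: nonpos_Ints_nonpos)
    then have "Gamma (3 / 2) / Gamma (1 / 2 :: real) = 1 / 2" by (simp add: Gamma_one_half_real)
    moreover have "c powr - 1 = 1 / c" using c by (simp add: powr_minus inverse_eq_divide)
    moreover have "(x ^ (p - 1))\<^sup>2 = x ^ (2 * p - 2)"
      unfolding power_mult[symmetric] by (rule arg_cong[where f = "\<lambda>i. x ^ i"]) simp
    moreover have "\<bar>ell_d2 p b2 x\<bar> = 2 * c" using d2 by (simp add: c_def)
    ultimately show ?thesis by (simp add: power_mult_distrib)
  qed
  ultimately have "(\<lambda>n. (real n powr (1 / real 2))\<^sup>2 / n * (deriv ^^ 2) (\<lambda>b. psi p n b1 b) b2)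
    \<longlonglongrightarrow> real p ^ 2 * x ^ (2 * p - 2) / \<bar>ell_d2 p b2 x\<bar>" by (simp only:)
  then show ?thesis
  proof (rule Lim_transform_eventually)
    show "\<forall>\<^sub>F n in sequentially. (real n powr (1 / real 2))\<^sup>2 / n * (deriv ^^ 2) (\<lambda>b. psi p n b1 b) b2 = (deriv ^^ 2) (\<lambda>b. psi p n b1 b) b2"
      using eventually_gt_at_top[of 0]
    proof eventually_elim
      case (elim n)
      then have "(real n powr (1 / real 2))\<^sup>2 / n = 1" by (simp add: powr_half_sqrt)
      then show ?case by (simp only: mult_1)
    qed
  qed
qed

text \<open>The first derivative of \<open>psi_lim\<close> is \<open>X b ^ p\<close> for the
  maximizer \<open>X b\<close>, and must be known on a neighbourhood to be differentiated again,
  hence \<open>uniq\<close>. Since \<open>X\<close> has derivative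
  \<open>p * x ^ (p - 1) / |ell_d2|\<close>, the chain rule supplies the second factor
  \<open>p * x ^ (p - 1)\<close>.\<close>

lemma off_curve_psi_lim:
  assumes p: "p \<ge> 2" and x: "maximizers p b1 b2 = {x}" and d2: "ell_d2 p b2 x < 0"
    and uniq: "\<forall>\<^sub>F b in nhds b2. \<exists>y. maximizers p b1 b = {y}"
  shows "twice_differentiable_at (\<lambda>b. psi_lim p b1 b) b2"
    and "(deriv ^^ 2) (\<lambda>b. psi_lim p b1 b) b2 = real p ^ 2 * x ^ (2 * p - 2) / \<bar>ell_d2 p b2 x\<bar>"
proof -
  let ?X = "some_maximizer p b1"
  have Xb: "?X b2 = x" using some_maximizer[of p b1 b2] x by simp
  have xm: "x \<in> maximizers p b1 b2" using x by simp
  note x01 = maximizers_interior[OF p xm]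
  have ev: "\<forall>\<^sub>F b in nhds b2. ((\<lambda>b. psi_lim p b1 b) has_real_derivative ?X b ^ p) (at b)"
    using uniq by eventually_elim (blast intro: psi_lim_deriv[OF p])
  have dev: "\<forall>\<^sub>F b in nhds b2. deriv (\<lambda>b. psi_lim p b1 b) b = ?X b ^ p"
    using ev by eventually_elim (rule DERIV_imp_deriv)
  define V where "V = real p ^ 2 * x ^ (2 * p - 2) / \<bar>ell_d2 p b2 x\<bar>"
  have "((\<lambda>b. ?X b ^ p) has_real_derivative real p * (inverse (- ell_d2 p b2 x / (real p * x ^ (p - 1))) * ?X b2 ^ (p - Suc 0))) (at b2)"
    by (rule DERIV_power[OF some_maximizer_deriv[OF p x d2]])
  also have "real p * (inverse (- ell_d2 p b2 x / (real p * x ^ (p - 1))) * ?X b2 ^ (p - Suc 0)) = V"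
  proof -
    have sq: "x ^ (2 * p - 2) = x ^ (p - 1) * x ^ (p - 1)"
      unfolding power_add[symmetric] by (rule arg_cong[where f = "\<lambda>i. x ^ i"]) simp
    have abs: "\<bar>ell_d2 p b2 x\<bar> = - ell_d2 p b2 x" using d2 by simp
    have "P * (inverse (d / (P * z)) * z) = P ^ 2 * (z * z) / d" for P d z :: real
      by (simp add: power2_eq_square)
    from this[of "real p"] show ?thesis unfolding V_def Xb sq abs One_nat_def[symmetric] .
  qed
  finally have "((\<lambda>b. ?X b ^ p) has_real_derivative V) (at b2)" .
  then have D: "(deriv (\<lambda>b. psi_lim p b1 b) has_real_derivative V) (at b2)"
    using DERIV_cong_ev[OF refl dev refl] by blast
  show "twice_differentiable_at (\<lambda>b. psi_lim p b1 b) b2"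
    unfolding twice_differentiable_at_def
  proof
    show "\<forall>\<^sub>F y in nhds b2. (\<lambda>b. psi_lim p b1 b) differentiable at y"
      using ev by eventually_elim (auto simp: real_differentiable_def)
    show "deriv (\<lambda>b. psi_lim p b1 b) differentiable at b2"
      using D by (auto simp: real_differentiable_def)
  qed
  show "(deriv ^^ 2) (\<lambda>b. psi_lim p b1 b) b2 = real p ^ 2 * x ^ (2 * p - 2) / \<bar>ell_d2 p b2 x\<bar>"
    using DERIV_imp_deriv[OF D] by (simp add: numeral_2_eq_2 V_def)
qed

text \<open>The case \<open>m = 4\<close>, where
  \<open>(n powr (1 / 4)) ^ 2 / n = 1 / sqrt n\<close>. The surd \<open>2 * sqrt 6 = sqrt 24\<close>
  and the fractional power of \<open>p\<close> both come from \<open>1 / sqrt c\<close>.\<close>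

lemma critical_second_deriv:
  assumes p: "p \<ge> 2" and x: "maximizers p (crit1 p) (crit2 p) = {x}"
  shows "(\<lambda>n. 1 / sqrt (real n) * (deriv ^^ 2) (\<lambda>b. psi p n (crit1 p) b) (crit2 p))
         \<longlonglongrightarrow> 2 * sqrt 6 * Gamma (3 / 4) / Gamma (1 / 4)
            * ((real p - 1) ^ (2 * p - 1) / real p powr (2 * real p - 3 / 2))"
proof -
  have xm: "x \<in> maximizers p (crit1 p) (crit2 p)" using x by simp
  have x_eq: "x = (real p - 1) / real p" by (rule critical_maximizer[OF p xm])
  note x01 = maximizers_interior[OF p xm]
  have p0: "real p > 0" "real p - 1 > 0" using p by auto
  \<comment> \<open>Chosen so that \<open>4 * 3 * c\<close> is the quadratic coefficient
    \<open>p ^ 5 / (2 * (p - 1) ^ 2)\<close> of \<open>- ell_d2\<close> at the critical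
    point.\<close>
  define c where "c = real p ^ 5 / (24 * (real p - 1) ^ 2)"
  have c: "c > 0" unfolding c_def using p0 by simp
  have "((\<lambda>t. ell_d2 p (crit2 p) t / (t - x) ^ (4 - 2)) \<longlongrightarrow> - (c * real 4 * real (4 - 1))) (at x)"
  proof -
    have "- (c * real 4 * real (4 - 1)) = - (real p ^ 5 / (2 * (real p - 1) ^ 2))" by (simp add: c_def)
    then show ?thesis using ell_d2_critical(2)[OF p] unfolding x_eq by simp
  qed
  then have "((\<lambda>t. (ell p (crit1 p) (crit2 p) x - ell p (crit1 p) (crit2 p) t) / (t - x) ^ 4) \<longlongrightarrow> c) (at x)"
    by (intro ell_expansion[OF p x01 maximizers_ell_d1[OF p xm]]) simp_all
  then have lim: "(\<lambda>n. (real n powr (1 / real 4))\<^sup>2 / n * (deriv ^^ 2) (\<lambda>b. psi p n (crit1 p) b) (crit2 p))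
    \<longlonglongrightarrow> (real p * x ^ (p - 1))\<^sup>2 * (c powr (- (2 / real 4)) * Gamma (3 / real 4) / Gamma (1 / real 4))"
    by (intro variance_single[OF p x _ _ c]) simp_all
  have const: "(real p * x ^ (p - 1))\<^sup>2 * c powr (- (2 / real 4)) = 2 * sqrt 6 * ((real p - 1) ^ (2 * p - 1) / real p powr (2 * real p - 3 / 2))"
  proof -
    define P Q where "P = real p" and "Q = real p - 1"
    have PQ: "P > 0" "Q > 0" using p0 by (simp_all add: P_def Q_def)
    have s24: "sqrt 24 = 2 * sqrt 6" using real_sqrt_mult[of 4 6] by simp
    have "c powr (- (2 / real 4)) = 1 / sqrt c" using c by (simp add: powr_minus powr_half_sqrt inverse_eq_divide)
    also have "sqrt c = P powr (5 / 2) / (2 * sqrt 6 * Q)"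
    proof -
      have P5: "P ^ 5 = P powr 5" using PQ by simp
      have "sqrt (P ^ 5) = (P ^ 5) powr (1 / 2)" using PQ by (simp add: powr_half_sqrt)
      also have "\<dots> = P powr (5 / 2)" unfolding P5 powr_powr by simp
      finally have "sqrt (P ^ 5) = P powr (5 / 2)" .
      moreover have "sqrt (Q ^ 2) = Q" using PQ by simp
      ultimately show ?thesis
        unfolding c_def Q_def[symmetric] unfolding P_def[symmetric] real_sqrt_divide real_sqrt_mult s24 by (simp only:)
    qed
    finally have c1: "c powr (- (2 / real 4)) = 2 * sqrt 6 * Q / P powr (5 / 2)" by simp
    have sq: "(real p * x ^ (p - 1))\<^sup>2 = P\<^sup>2 * (Q ^ (2 * p - 2) / P ^ (2 * p - 2))"
    proof -
      have "(x ^ (p - 1))\<^sup>2 = x ^ (2 * p - 2)"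
        unfolding power_mult[symmetric] by (rule arg_cong[where f = "\<lambda>i. x ^ i"]) simp
      then show ?thesis unfolding power_mult_distrib P_def Q_def by (simp add: x_eq power_divide)
    qed
    have pow: "P\<^sup>2 / (P ^ (2 * p - 2) * P powr (5 / 2)) = 1 / P powr (2 * real p - 3 / 2)"
    proof -
      have "real (2 * p - 2) = 2 * real p - 2" using p by (simp add: of_nat_diff)
      then have "P ^ (2 * p - 2) = P powr (2 * real p - 2)" using powr_realpow[OF PQ(1), of "2 * p - 2"] by simp
      moreover have "P\<^sup>2 = P powr 2" using PQ by simp
      ultimately have e: "P\<^sup>2 / (P ^ (2 * p - 2) * P powr (5 / 2)) = P powr 2 / (P powr (2 * real p - 2) * P powr (5 / 2))"
        by (simp only:)
      have "P powr 2 / (P powr (2 * real p - 2) * P powr (5 / 2)) = P powr (2 - (2 * real p - 2 + 5 / 2))"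
        by (simp only: powr_add[symmetric] powr_diff[symmetric])
      also have "2 - (2 * real p - 2 + 5 / 2) = - (2 * real p - 3 / 2)" by simp
      also have "P powr (- (2 * real p - 3 / 2)) = 1 / P powr (2 * real p - 3 / 2)"
        by (simp only: powr_minus inverse_eq_divide)
      finally show ?thesis unfolding e .
    qed
    have Q: "Q ^ (2 * p - 1) = Q ^ (2 * p - 2) * Q"
    proof -
      have "2 * p - 1 = Suc (2 * p - 2)" using p by simp
      then show ?thesis by (simp only: power_Suc2)
    qed
    have gen: "A * (B / D) * (2 * S * R / E) = 2 * S * (B * R * (A / (D * E)))" for A B D E S R :: real
      by (simp only: divide_inverse inverse_mult_distrib mult_ac)
    have "P\<^sup>2 * (Q ^ (2 * p - 2) / P ^ (2 * p - 2)) * (2 * sqrt 6 * Q / P powr (5 / 2)) =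
        2 * sqrt 6 * (Q ^ (2 * p - 1) / P powr (2 * real p - 3 / 2))"
      unfolding gen pow Q by simp
    then show ?thesis unfolding c1 sq unfolding P_def Q_def .
  qed
  have "(real p * x ^ (p - 1))\<^sup>2 * (c powr (- (2 / real 4)) * Gamma (3 / real 4) / Gamma (1 / real 4)) =
    2 * sqrt 6 * Gamma (3 / 4) / Gamma (1 / 4) * ((real p - 1) ^ (2 * p - 1) / real p powr (2 * real p - 3 / 2))"
  proof -
    have "u * (v * g / h) = s * g / h * w" if "u * v = s * w" for u v g h s w :: real
    proof -
      have "u * (v * g / h) = (u * v) * g / h" by simp
      then show ?thesis unfolding that by simp
    qed
    from this[OF const] show ?thesis by simp
  qed
  with lim have "(\<lambda>n. (real n powr (1 / real 4))\<^sup>2 / n * (deriv ^^ 2) (\<lambda>b. psi p n (crit1 p) b) (crit2 p))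
    \<longlonglongrightarrow> 2 * sqrt 6 * Gamma (3 / 4) / Gamma (1 / 4) * ((real p - 1) ^ (2 * p - 1) / real p powr (2 * real p - 3 / 2))"
    by (simp only:)
  then show ?thesis
  proof (rule Lim_transform_eventually)
    show "\<forall>\<^sub>F n in sequentially. (real n powr (1 / real 4))\<^sup>2 / n * (deriv ^^ 2) (\<lambda>b. psi p n (crit1 p) b) (crit2 p) =
        1 / sqrt (real n) * (deriv ^^ 2) (\<lambda>b. psi p n (crit1 p) b) (crit2 p)"
      using eventually_gt_at_top[of 0]
    proof eventually_elim
      case (elim n)
      have "(real n powr (1 / real 4))\<^sup>2 = real n powr (1 / 2)"
        unfolding power2_eq_square powr_add[symmetric] by simp
      also have "\<dots> = sqrt n" by (simp add: powr_half_sqrt)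
      finally have "(real n powr (1 / real 4))\<^sup>2 / n = 1 / sqrt n"
        using elim by (simp add: real_div_sqrt field_simps)
      then show ?case by (simp only:)
    qed
  qed
qed

theorem theorem5:
  fixes p :: nat and q :: "real \<Rightarrow> real" and \<beta>\<^sub>1 \<beta>\<^sub>2 :: real
  assumes "p \<ge> 2" and "phase_transition_curve p q"
  shows
    "((\<beta>\<^sub>1, \<beta>\<^sub>2) \<notin> graph_of p q \<longrightarrow>
       (\<forall>x. maximizers p \<beta>\<^sub>1 \<beta>\<^sub>2 = {x} \<longrightarrow>
          (\<lambda>n. (deriv ^^ 2) (\<lambda>b. psi p n \<beta>\<^sub>1 b) \<beta>\<^sub>2)
            \<longlonglongrightarrow> real p ^ 2 * x ^ (2 * p - 2) / \<bar>ell'' p \<beta>\<^sub>1 \<beta>\<^sub>2 x\<bar> \<and>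
          (\<forall>\<^sub>F b in nhds \<beta>\<^sub>2. convergent (\<lambda>n. psi p n \<beta>\<^sub>1 b)) \<and>
          twice_differentiable_at (\<lambda>b. psi_lim p \<beta>\<^sub>1 b) \<beta>\<^sub>2 \<and>
          (deriv ^^ 2) (\<lambda>b. psi_lim p \<beta>\<^sub>1 b) \<beta>\<^sub>2
            = real p ^ 2 * x ^ (2 * p - 2) / \<bar>ell'' p \<beta>\<^sub>1 \<beta>\<^sub>2 x\<bar>))
   \<and>
    ((\<beta>\<^sub>1, \<beta>\<^sub>2) \<in> graph_of p q \<and> (\<beta>\<^sub>1, \<beta>\<^sub>2) \<noteq> (crit1 p, crit2 p) \<longrightarrow>
       (\<forall>x\<^sub>1 x\<^sub>2. x\<^sub>1 < x\<^sub>2 \<and> maximizers p \<beta>\<^sub>1 \<beta>\<^sub>2 = {x\<^sub>1, x\<^sub>2} \<longrightarrow>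
          (\<lambda>n. 1 / real n * (deriv ^^ 2) (\<lambda>b. psi p n \<beta>\<^sub>1 b) \<beta>\<^sub>2)
            \<longlonglongrightarrow> (x\<^sub>1 ^ p - x\<^sub>2 ^ p) ^ 2
               * sqrt (x\<^sub>1 * (1 - x\<^sub>1) * \<bar>ell'' p \<beta>\<^sub>1 \<beta>\<^sub>2 x\<^sub>1\<bar>)
               * sqrt (x\<^sub>2 * (1 - x\<^sub>2) * \<bar>ell'' p \<beta>\<^sub>1 \<beta>\<^sub>2 x\<^sub>2\<bar>)
               / (sqrt (x\<^sub>1 * (1 - x\<^sub>1) * \<bar>ell'' p \<beta>\<^sub>1 \<beta>\<^sub>2 x\<^sub>1\<bar>)
                  + sqrt (x\<^sub>2 * (1 - x\<^sub>2) * \<bar>ell'' p \<beta>\<^sub>1 \<beta>\<^sub>2 x\<^sub>2\<bar>)) ^ 2))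
   \<and>
    ((\<beta>\<^sub>1, \<beta>\<^sub>2) = (crit1 p, crit2 p) \<longrightarrow>
       (\<lambda>n. 1 / sqrt (real n) * (deriv ^^ 2) (\<lambda>b. psi p n \<beta>\<^sub>1 b) \<beta>\<^sub>2)
         \<longlonglongrightarrow> 2 * sqrt 6 * Gamma (3 / 4) / Gamma (1 / 4)
            * ((real p - 1) ^ (2 * p - 1) / real p powr (2 * real p - 3 / 2)))"
proof -
  note p = assms(1)
  have q_crit: "q (crit1 p) = crit2 p"
    and single: "\<And>b1 b2. (b1, b2) \<notin> graph_of p q \<or> (b1, b2) = (crit1 p, crit2 p) \<Longrightarrow>
      \<exists>x. 0 < x \<and> x < 1 \<and> maximizers p b1 b2 = {x}"
    using assms(2) unfolding phase_transition_curve_def by blast+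
  have crit_on: "(crit1 p, crit2 p) \<in> graph_of p q" by (simp add: graph_of_def q_crit)
  \<comment> \<open>Away from the critical point every maximizer is nondegenerate, so the quadratic
    case applies both off the curve and on it.\<close>
  have d2: "ell_d2 p \<beta>\<^sub>2 x < 0" if "x \<in> maximizers p \<beta>\<^sub>1 \<beta>\<^sub>2" "(\<beta>\<^sub>1, \<beta>\<^sub>2) \<noteq> (crit1 p, crit2 p)" for x
    using maximizer_degenerate(2,3)[OF p that(1)] that(2) by force
  have ell'': "ell'' p \<beta>\<^sub>1 \<beta>\<^sub>2 x = ell_d2 p \<beta>\<^sub>2 x" if "x \<in> maximizers p \<beta>\<^sub>1 \<beta>\<^sub>2" for x
    by (rule ell''_eq[OF p maximizers_interior[OF p that]])
  \<comment> \<open>No regularity of \<open>q\<close> enters: with the first parameter fixed, the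
    vertical line meets the graph in at most one point, so being off the curve is an open condition
    in \<open>b\<close>.\<close>
  have uniq: "\<forall>\<^sub>F b in nhds \<beta>\<^sub>2. \<exists>y. maximizers p \<beta>\<^sub>1 b = {y}" if off: "(\<beta>\<^sub>1, \<beta>\<^sub>2) \<notin> graph_of p q"
  proof -
    have "\<forall>\<^sub>F b in nhds \<beta>\<^sub>2. (\<beta>\<^sub>1, b) \<notin> graph_of p q"
    proof (cases "\<beta>\<^sub>1 \<le> crit1 p")
      case True
      then have "\<beta>\<^sub>2 \<in> - {q \<beta>\<^sub>1}" using off by (simp add: graph_of_def)
      then have "\<forall>\<^sub>F b in nhds \<beta>\<^sub>2. b \<in> - {q \<beta>\<^sub>1}" by (intro eventually_nhds_in_open) auto
      then show ?thesis by eventually_elim (simp add: graph_of_def)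
    next
      case False
      then show ?thesis by (simp add: graph_of_def)
    qed
    then show ?thesis by eventually_elim (use single in blast)
  qed
  show ?thesis
  proof (intro conjI impI allI, goal_cases)
    case (1 x)
    have x: "x \<in> maximizers p \<beta>\<^sub>1 \<beta>\<^sub>2" using 1 by simp
    have "(\<beta>\<^sub>1, \<beta>\<^sub>2) \<noteq> (crit1 p, crit2 p)" using 1(1) crit_on by auto
    from off_curve_second_deriv[OF p 1(2) d2[OF x this]] show ?case unfolding ell''[OF x] .
  next
    case (2 x)
    have "convergent (\<lambda>n. psi p n \<beta>\<^sub>1 b)" for b
      using maximizers_nonempty[of p \<beta>\<^sub>1 b] psi_tendsto[OF p] unfolding convergent_def by blast
    then show ?case by (intro always_eventually allI)
  next
    case (3 x)
    have x: "x \<in> maximizers p \<beta>\<^sub>1 \<beta>\<^sub>2" using 3 by simp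
    have nc: "(\<beta>\<^sub>1, \<beta>\<^sub>2) \<noteq> (crit1 p, crit2 p)" using 3(1) crit_on by auto
    show ?case by (rule off_curve_psi_lim(1)[OF p 3(2) d2[OF x nc] uniq[OF 3(1)]])
  next
    case (4 x)
    have x: "x \<in> maximizers p \<beta>\<^sub>1 \<beta>\<^sub>2" using 4 by simp
    have nc: "(\<beta>\<^sub>1, \<beta>\<^sub>2) \<noteq> (crit1 p, crit2 p)" using 4(1) crit_on by auto
    show ?case unfolding ell''[OF x]
      by (rule off_curve_psi_lim(2)[OF p 4(2) d2[OF x nc] uniq[OF 4(1)]])
  next
    case (5 x1 x2)
    have nc: "(\<beta>\<^sub>1, \<beta>\<^sub>2) \<noteq> (crit1 p, crit2 p)" and lt: "x1 < x2" and max: "maximizers p \<beta>\<^sub>1 \<beta>\<^sub>2 = {x1, x2}"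
      using 5 by blast+
    have x: "x1 \<in> maximizers p \<beta>\<^sub>1 \<beta>\<^sub>2" "x2 \<in> maximizers p \<beta>\<^sub>1 \<beta>\<^sub>2" unfolding max by simp_all
    show ?case unfolding ell''[OF x(1)] ell''[OF x(2)]
      by (rule variance_double[OF p max lt d2[OF x(1) nc] d2[OF x(2) nc]])
  next
    case 6
    then have b: "\<beta>\<^sub>1 = crit1 p" "\<beta>\<^sub>2 = crit2 p" by simp_all
    obtain x where "maximizers p (crit1 p) (crit2 p) = {x}" using single[of "crit1 p" "crit2 p"] by blast
    from critical_second_deriv[OF p this] show ?case unfolding b .
  qed
qed

end
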